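(* Let $\mathbb{D}$ be the closed unit disc in the plane. There is an algorithm which, given an integer $n\ge 2$, a set $P$ of $n$ points in $\operatorname{int}(\mathbb{D})$, a cyclic braid $\beta\in B_n$, and an integer $m>0$, determines a homeomorphism $f\colon\mathbb{D}\to\mathbb{D}$ such that: (1) $f|_{\partial\mathbb{D}}=\mathrm{id}$; (2) $P$ is an $n$-periodic orbit of $f$ and, as such, induces the braid $\beta$; (3) $f$ has an $m$-periodic orbit linked with $P$.
   Context: Periodic orbits. For a self-map $f\colon X\to X$, the orbit of $x\in X$ is $\{f^k(x) : k\in\mathbb{N}\}$ (including $x$ itself). A point $x$ is periodic of (least) period $n$ if it is periodic and its orbit has exactly $n$ elements; the orbit is then called an $n$-periodic orbit. A fixed point is a $1$-periodic point. A subset $A\subset X$ is invariant if $f(A)\subset A$. Linked invariant sets. Let $M$ be a surface and $h\colon M\to M$ a homeomorphism. Two invariant sets $A_1,A_2$ of $h$ are unlinked if there are disjoint closed discs $D_1,D_2$ in $M$ such that, for $i=1,2$, $A_i\subset\operatorname{int}(D_i)$ and $h(\partial D_i)$ is isotopic to $\partial D_i$ in $M-(A_1\cup A_2)$. Otherwise they are linked. Here $M=\mathbb{D}$ and $h=f$. Braids. $B_n$ is the Artin braid group, i.e. the group of isotopy classes of geometric braids with $n$ strands, with generators $\sigma_1,\dots,\sigma_{n-1}$ and relations $\sigma_i\sigma_j=\sigma_j\sigma_i$ for $|i-j|\ge 2$, and $\sigma_i\sigma_{i+1}\sigma_i=\sigma_{i+1}\sigma_i\sigma_{i+1}$ for $1\le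 i\le n-2$. Let $\pi\colon B_n\to S_n$ be the canonical homomorphism sending $\sigma_i$ to the transposition $(i,i+1)$. A braid $\beta\in B_n$ is cyclic if $\pi(\beta)$ is an $n$-cycle. Braid induced by a periodic orbit. Any orientation-preserving homeomorphism $f$ of $\mathbb{D}$ is isotopic to $\mathrm{id}_{\mathbb{D}}$. Fix an isotopy $f_t$, $t\in I=[0,1]$, from $\mathrm{id}_{\mathbb{D}}$ to $f$. For $n\ge 2$ and an $n$-periodic orbit $P$ of $f$, the braid induced by $P$ is the geometric $n$-strand braid $\beta(P,f_t)=\{(f_t(P),t) : t\in I\}\subset\mathbb{D}\times I$, regarded as an element of $B_n$; the isotopy $f_t$ is usually omitted from the notation. *)

theory Defs
  imports "HOL-Analysis.Analysis" "HOL-Combinatorics.Combinatorics"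
begin

section \<open>Periodic orbits\<close>

definition forward_orbit :: "('a \<Rightarrow> 'a) \<Rightarrow> 'a \<Rightarrow> 'a set" where
  "forward_orbit f x = range (\<lambda>k::nat. (f ^^ k) x)"

definition periodic_point :: "('a \<Rightarrow> 'a) \<Rightarrow> 'a \<Rightarrow> bool" where
  "periodic_point f x \<longleftrightarrow> (\<exists>k::nat. k > 0 \<and> (f ^^ k) x = x)"

definition periodic_orbit :: "'a set \<Rightarrow> ('a \<Rightarrow> 'a) \<Rightarrow> nat \<Rightarrow> 'a set \<Rightarrow> bool" where
  "periodic_orbit X f n P \<longleftrightarrow>
     (\<exists>x\<in>X. periodic_point f x \<and> P = forward_orbit f x \<and> card P = n)"

section \<open>Linked invariant sets\<close>

text \<open>Surfaces are restricted to subsets of the plane. By invariance of domain, the interior and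
  the boundary circle of an embedded closed disc are then its interior and frontier in the plane.\<close>

definition closed_disc_in :: "complex set \<Rightarrow> complex set \<Rightarrow> bool" where
  "closed_disc_in M D \<longleftrightarrow> D \<subseteq> M \<and> D homeomorphic (cball 0 1 :: complex set)"

text \<open>Isotopy of simple closed curves: a homotopy through injective (hence, by compactness,
  embedded) circles.\<close>

definition isotopic_curves :: "complex set \<Rightarrow> complex set \<Rightarrow> complex set \<Rightarrow> bool" where
  "isotopic_curves X C C' \<longleftrightarrow>
     (\<exists>H :: real \<times> complex \<Rightarrow> complex.
        continuous_on ({0..1} \<times> sphere 0 1) H \<and>
        H ` ({0..1} \<times> sphere 0 1) \<subseteq> X \<and>
        (\<forall>s\<in>{0..1}. inj_on (\<lambda>z. H (s, z)) (sphere 0 1)) \<and>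
        (\<lambda>z. H (0, z)) ` sphere 0 1 = C \<and>
        (\<lambda>z. H (1, z)) ` sphere 0 1 = C')"

definition unlinked :: "complex set \<Rightarrow> (complex \<Rightarrow> complex) \<Rightarrow> complex set \<Rightarrow> complex set \<Rightarrow> bool" where
  "unlinked M h A1 A2 \<longleftrightarrow>
     (\<exists>D1 D2. closed_disc_in M D1 \<and> closed_disc_in M D2 \<and> D1 \<inter> D2 = {} \<and>
        A1 \<subseteq> interior D1 \<and> A2 \<subseteq> interior D2 \<and>
        isotopic_curves (M - (A1 \<union> A2)) (h ` frontier D1) (frontier D1) \<and>
        isotopic_curves (M - (A1 \<union> A2)) (h ` frontier D2) (frontier D2))"

definition linked :: "complex set \<Rightarrow> (complex \<Rightarrow> complex) \<Rightarrow> complex set \<Rightarrow> complex set \<Rightarrow> bool" where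
  "linked M h A1 A2 \<longleftrightarrow> h ` A1 \<subseteq> A1 \<and> h ` A2 \<subseteq> A2 \<and> \<not> unlinked M h A1 A2"

section \<open>Braids\<close>

text \<open>A geometric braid with \<open>n\<close> strands is a path in the space of ordered configurations,
  the \<open>j\<close>-th coordinate (\<open>j < n\<close>) tracing the strand that starts at the \<open>j\<close>-th point. Isotopy of
  geometric braids is homotopy of such paths with fixed end points. Coordinates \<open>j \<ge> n\<close> are frozen
  at 0, so that the product topology on \<^typ>\<open>nat \<Rightarrow> complex\<close> induces the usual one.\<close>

definition configurations :: "nat \<Rightarrow> (nat \<Rightarrow> complex) set" where
  "configurations n =
     {c. inj_on c {..<n} \<and> c ` {..<n} \<subseteq> cball 0 1 \<and> (\<forall>j\<ge>n. c j = 0)}"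

text \<open>The base configuration consists of \<open>n\<close> points on the real axis, numbered from left to right.\<close>

definition base_point :: "nat \<Rightarrow> nat \<Rightarrow> complex" where
  "base_point n j = (if j < n then of_real (2 * (real j + 1) / (real n + 1) - 1) else 0)"

text \<open>Elements of the Artin group \<open>B\<^sub>n\<close> are given by words in the generators: the letter \<open>k > 0\<close>
  stands for \<open>\<sigma>\<^sub>k\<close> and \<open>k < 0\<close> for the inverse of \<open>\<sigma>\<^bsub>-k\<^esub>\<close>. As strands are numbered
  from 0, \<open>\<sigma>\<^sub>k\<close> exchanges the strands in positions \<open>k - 1\<close> and \<open>k\<close>.\<close>

definition braid_word :: "nat \<Rightarrow> int list \<Rightarrow> bool" where
  "braid_word n w \<longleftrightarrow> (\<forall>k\<in>set w. k \<noteq> 0 \<and> \<bar>k\<bar> < int n)"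

definition letter_perm :: "int \<Rightarrow> nat \<Rightarrow> nat" where
  "letter_perm k = Transposition.transpose (nat \<bar>k\<bar> - 1) (nat \<bar>k\<bar>)"

text \<open>The canonical homomorphism to the symmetric group.\<close>

primrec word_perm :: "int list \<Rightarrow> nat \<Rightarrow> nat" where
  "word_perm [] = id"
| "word_perm (k # w) = letter_perm k \<circ> word_perm w"

definition cyclic_word :: "nat \<Rightarrow> int list \<Rightarrow> bool" where
  "cyclic_word n w \<longleftrightarrow> (\<exists>cs. distinct cs \<and> set cs = {..<n} \<and> word_perm w = cycle_of_list cs)"

text \<open>The generator \<open>\<sigma>\<^sub>k\<close> is the counterclockwise half turn of two neighbouring base points about
  their midpoint.\<close>

definition half_twist :: "nat \<Rightarrow> int \<Rightarrow> real \<Rightarrow> nat \<Rightarrow> complex" where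
  "half_twist n k t j =
     (let i = nat \<bar>k\<bar>; c = (base_point n (i - 1) + base_point n i) / 2
      in if j = i - 1 \<or> j = i then c + (base_point n j - c) * cis (of_int (sgn k) * pi * t)
         else base_point n j)"

text \<open>Words are read in the direction of increasing time. After the first letter the strand \<open>j\<close> is
  in position \<open>letter_perm k j\<close> and from there follows the strand of the remaining braid that starts
  in that position.\<close>

primrec word_path :: "nat \<Rightarrow> int list \<Rightarrow> real \<Rightarrow> nat \<Rightarrow> complex" where
  "word_path n [] = (\<lambda>t. base_point n)"
| "word_path n (k # w) = half_twist n k +++ (\<lambda>t. word_path n w t \<circ> letter_perm k)"

section \<open>The braid induced by a periodic orbit\<close>

definition isotopy_from_id :: "(real \<times> complex \<Rightarrow> complex) \<Rightarrow> (complex \<Rightarrow> complex) \<Rightarrow> bool" where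
  "isotopy_from_id h f \<longleftrightarrow>
     continuous_on ({0..1} \<times> cball 0 1) h \<and>
     (\<forall>t\<in>{0..1}. \<exists>g. homeomorphism (cball 0 1) (cball 0 1) (\<lambda>z. h (t, z)) g) \<and>
     (\<forall>z\<in>cball 0 1. h (0, z) = z) \<and>
     (\<forall>z\<in>cball 0 1. h (1, z) = f z)"

text \<open>Geometric braids based at an arbitrary \<open>n\<close>-point set \<open>P\<close> are identified with braids based at
  the base configuration as usual by projecting to the real axis (points above each
  other being ordered by their imaginary parts, as after an arbitrarily small rotation): \<open>P\<close> is
  joined to the base configuration along straight segments, preserving this order. No two points
  collide on the way.\<close>

definition lex_less :: "complex \<Rightarrow> complex \<Rightarrow> bool" where
  "lex_less z w \<longleftrightarrow> Re z < Re w \<or> (Re z = Re w \<and> Im z < Im w)"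

definition lex_rank :: "complex set \<Rightarrow> complex \<Rightarrow> nat" where
  "lex_rank P z = card {z' \<in> P. lex_less z' z}"

definition slide :: "nat \<Rightarrow> complex set \<Rightarrow> complex \<Rightarrow> real \<Rightarrow> complex" where
  "slide n P z = linepath (base_point n (lex_rank P z)) z"

definition induced_strand ::
    "nat \<Rightarrow> (real \<times> complex \<Rightarrow> complex) \<Rightarrow> complex set \<Rightarrow> complex \<Rightarrow> real \<Rightarrow> complex" where
  "induced_strand n h P z =
     slide n P z +++ (\<lambda>t. h (t, z)) +++ reversepath (slide n P (h (1, z)))"

definition induced_path ::
    "nat \<Rightarrow> (real \<times> complex \<Rightarrow> complex) \<Rightarrow> complex set \<Rightarrow> real \<Rightarrow> nat \<Rightarrow> complex" where
  "induced_path n h P t j =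
     (if j < n then induced_strand n h P (inv_into P (lex_rank P) j) t else 0)"

definition induces_braid :: "(complex \<Rightarrow> complex) \<Rightarrow> nat \<Rightarrow> complex set \<Rightarrow> int list \<Rightarrow> bool" where
  "induces_braid f n P w \<longleftrightarrow>
     (\<exists>h. isotopy_from_id h f \<and>
          homotopic_paths (configurations n) (induced_path n h P) (word_path n w))"

section \<open>Algorithms over the reals\<close>

text \<open>Structured programs for the Blum--Shub--Smale model of computation with exact real arithmetic:
  a state is a finite sequence of reals, and programs may do arithmetic, branch on the sign of the
  first entry, and loop. The only machine constant is 1, since arbitrary real constants could encode
  noncomputable discrete information.\<close>

datatype prog =
    Skip
  | Clear
  | One
  | Head
  | Tail
  | Plus
  | Minus
  | Times
  | Divide
  | Seq prog prog
  | Juxt prog prog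
  | IfPos prog prog
  | WhilePos prog

definition head_pos :: "real list \<Rightarrow> bool" where
  "head_pos xs \<longleftrightarrow> xs \<noteq> [] \<and> hd xs > 0"

text \<open>\<open>runs p xs ys\<close>: started in \<open>xs\<close>, the program \<open>p\<close> halts in \<open>ys\<close>. Arithmetic on a state with
  fewer than two entries, and division by zero, have no result.\<close>

inductive runs :: "prog \<Rightarrow> real list \<Rightarrow> real list \<Rightarrow> bool" where
  "runs Skip xs xs"
| "runs Clear xs []"
| "runs One xs [1]"
| "runs Head xs (take 1 xs)"
| "runs Tail xs (drop 1 xs)"
| "runs Plus (x # y # xs) ((x + y) # xs)"
| "runs Minus (x # y # xs) ((x - y) # xs)"
| "runs Times (x # y # xs) ((x * y) # xs)"
| "y \<noteq> 0 \<Longrightarrow> runs Divide (x # y # xs) ((x / y) # xs)"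
| "runs p xs ys \<Longrightarrow> runs q ys zs \<Longrightarrow> runs (Seq p q) xs zs"
| "runs p xs ys \<Longrightarrow> runs q xs zs \<Longrightarrow> runs (Juxt p q) xs (ys @ zs)"
| "head_pos xs \<Longrightarrow> runs p xs ys \<Longrightarrow> runs (IfPos p q) xs ys"
| "\<not> head_pos xs \<Longrightarrow> runs q xs ys \<Longrightarrow> runs (IfPos p q) xs ys"
| "head_pos xs \<Longrightarrow> runs p xs ys \<Longrightarrow> runs (WhilePos p) ys zs \<Longrightarrow> runs (WhilePos p) xs zs"
| "\<not> head_pos xs \<Longrightarrow> runs (WhilePos p) xs xs"

inductive_cases runsE:
  "runs Skip xs ys" "runs Clear xs ys" "runs One xs ys" "runs Head xs ys" "runs Tail xs ys"
  "runs Plus xs ys" "runs Minus xs ys" "runs Times xs ys" "runs Divide xs ys"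
  "runs (Seq p q) xs ys" "runs (Juxt p q) xs ys" "runs (IfPos p q) xs ys" "runs (WhilePos p) xs ys"

lemma runs_deterministic: "runs p xs ys \<Longrightarrow> runs p xs zs \<Longrightarrow> ys = zs"
  by (induction arbitrary: zs rule: runs.induct) (blast elim: runsE | (erule runsE; force))+

definition coords :: "complex \<Rightarrow> real list" where
  "coords z = [Re z, Im z]"

definition encode_input :: "nat \<Rightarrow> complex list \<Rightarrow> int list \<Rightarrow> nat \<Rightarrow> complex \<Rightarrow> real list" where
  "encode_input n ps w m z =
     [real n, real m, real (length w)] @ coords z @ concat (map coords ps) @ map real_of_int w"

text \<open>The algorithm determines \<open>f\<close> if, on the given data together with a point of the disc, it
  halts with the image of that point.\<close>

definition determines ::
    "prog \<Rightarrow> nat \<Rightarrow> complex list \<Rightarrow> int list \<Rightarrow> nat \<Rightarrow> (complex \<Rightarrow> complex) \<Rightarrow> bool" where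
  "determines A n ps w m f \<longleftrightarrow>
     (\<forall>z\<in>cball 0 1. runs A (encode_input n ps w m z) (coords (f z)))"

end

theory Submission
  imports Defs "HOL-Complex_Analysis.Complex_Analysis"
begin

text \<open>The homeomorphism is a product of explicit half twists, one for each letter of a word.

\<^bold>\<open>Realizing a braid.\<close> List a finite set of points in lexicographic order. This order is compatible with
convex combinations, so the segment between two neighbours contains no further point of the set, and
a half turn in a sufficiently thin ellipse about the segment, damped to the identity in a narrow
collar, exchanges the two neighbours and fixes all other points (\<open>twist\<close>, \<open>letter_twist\<close>). For the
same reason the slide to the base configuration runs through configurations in lexicographic order,
and it carries the twist of the \<open>i\<close>-th pair to the standard generator, if the ellipse is kept thin
enough on the way (\<open>slide_twisted\<close>). Composing the twists along a word \<open>w\<close> thus yields a homeomorphism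
that permutes the points and induces the braid of \<open>w\<close> (\<open>slide_word_strands\<close>); if this braid is cyclic,
the points form one periodic orbit.

\<^bold>\<open>The new orbit.\<close> Put \<open>m\<close> new points on a short horizontal segment that ends in the first point of
\<open>P\<close>. In the braid group on \<open>m + n\<close> strands consider the word
\<open>\<sigma>\<^sub>m \<sigma>\<^sub>m \<sigma>\<^sub>1 \<dots> \<sigma>\<^bsub>m-1\<^esub>\<close>, followed by \<open>w\<close> with all indices raised by \<open>m\<close>. Its homeomorphism
permutes the new points cyclically. As far as the points of \<open>P\<close> are concerned, the first part only
moves the first one, along a loop on which it precedes all others in the order; such a loop is
contractible, so \<open>P\<close> still induces the braid of \<open>w\<close> (\<open>slide_total_strands\<close>).

\<^bold>\<open>Why the orbits are linked.\<close> The linking number, that is the sum of the winding numbers of \<open>p\<close> about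
\<open>q\<close> along the isotopy over all pairs of a point \<open>p\<close> of \<open>P\<close> and a new point \<open>q\<close>, equals 1, since only
the full twist \<open>\<sigma>\<^sub>m \<sigma>\<^sub>m\<close> contributes (\<open>linking_number_full_twist\<close>, \<open>linking_number_unmixed\<close>).
For unlinked sets it is a multiple of \<open>n \<ge> 2\<close>: if \<open>D\<close> is a disc about \<open>P\<close> without new points, the
isotopy from \<open>f ` frontier D\<close> to \<open>frontier D\<close> forces the branches of \<open>log (z - q)\<close> on \<open>D\<close> and on
\<open>f ` D\<close> to have the same set of values on \<open>P\<close>, up to one common multiple of \<open>2 * pi * \<i>\<close>, which
enters the sum over \<open>P\<close> exactly \<open>n\<close> times (\<open>isotopic_discs_log_values\<close>, \<open>unlinked_imp_card_dvd_linking_number\<close>).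

\<^bold>\<open>The algorithm.\<close> The half turns have a rational parametrization, the order of the points is found by
comparisons, and the width of each ellipse is a rational expression in the points. Hence the
homeomorphism can be evaluated by a program that runs through the word (\<open>computes_word_map\<close>).\<close>

section \<open>Closed discs in the plane\<close>

text \<open>Invariance of domain, applied to the homeomorphism and to its inverse: open sets go to open sets in both
  directions.\<close>

lemma disc_interior_frontier:
  fixes \<psi> :: "complex \<Rightarrow> complex"
  assumes hom: "homeomorphism (cball 0 1) E \<psi> \<psi>'"
  shows "interior E = \<psi> ` ball 0 1" and "frontier E = \<psi> ` sphere 0 1"
proof -
  have cont: "continuous_on (cball 0 1) \<psi>" and inj: "inj_on \<psi> (cball 0 1)"
    and img: "\<psi> ` cball 0 1 = E" and cont': "continuous_on E \<psi>'"
    and inv: "\<And>x. x \<in> cball 0 1 \<Longrightarrow> \<psi>' (\<psi> x) = x" and img': "\<psi>' ` E = cball 0 1"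
    and inv': "\<And>y. y \<in> E \<Longrightarrow> \<psi> (\<psi>' y) = y"
    using hom unfolding homeomorphism_def inj_on_def by (metis+)
  have "open (\<psi> ` ball 0 1)"
    by (rule invariance_of_domain)
       (auto intro: continuous_on_subset[OF cont] inj_on_subset[OF inj])
  then have 1: "\<psi> ` ball 0 1 \<subseteq> interior E"
    using img by (intro interior_maximal) auto
  have "inj_on \<psi>' (interior E)"
    by (rule inj_onI) (metis inv' interior_subset subsetD)
  then have "open (\<psi>' ` interior E)"
    using invariance_of_domain[of "interior E" \<psi>'] continuous_on_subset[OF cont' interior_subset]
    by simp
  then have "\<psi>' ` interior E \<subseteq> interior (cball 0 1)"
    using img' interior_subset by (intro interior_maximal) auto
  then have 2: "\<psi>' ` interior E \<subseteq> ball 0 1" by simp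
  have "interior E \<subseteq> \<psi> ` ball 0 1"
  proof
    fix y assume y: "y \<in> interior E"
    then have "\<psi>' y \<in> ball 0 1" using 2 by blast
    moreover have "y = \<psi> (\<psi>' y)" using inv' y interior_subset by (metis subsetD)
    ultimately show "y \<in> \<psi> ` ball 0 1" by blast
  qed
  with 1 show int: "interior E = \<psi> ` ball 0 1" by blast
  have diff: "\<psi> ` (cball 0 1 - ball 0 1) = \<psi> ` cball 0 1 - \<psi> ` ball 0 1"
    by (rule inj_on_image_set_diff[OF inj]) auto
  have "closed E"
    using cont img compact_continuous_image compact_imp_closed compact_cball by metis
  then have "frontier E = E - interior E" by (simp add: frontier_def)
  also have "\<dots> = \<psi> ` (cball 0 1 - ball 0 1)"
    unfolding diff img int ..
  also have "cball 0 1 - ball 0 1 = (sphere 0 1 :: complex set)" by auto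
  finally show "frontier E = \<psi> ` sphere 0 1" .
qed

lemma homeomorphic_discE:
  assumes "E homeomorphic (cball 0 1 :: complex set)"
  obtains \<psi> \<psi>' :: "complex \<Rightarrow> complex" where "homeomorphism (cball 0 1) E \<psi> \<psi>'"
  using assms unfolding homeomorphic_sym[of E] by (auto simp: homeomorphic_def)

lemma disc_image:
  fixes g :: "complex \<Rightarrow> complex"
  assumes disc: "E homeomorphic (cball 0 1 :: complex set)"
    and cont: "continuous_on E g" and inj: "inj_on g E"
  shows "g ` E homeomorphic (cball 0 1 :: complex set)"
    and "interior (g ` E) = g ` interior E" and "frontier (g ` E) = g ` frontier E"
proof -
  obtain \<psi> \<psi>' :: "complex \<Rightarrow> complex" where \<psi>: "homeomorphism (cball 0 1) E \<psi> \<psi>'"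
    using disc by (rule homeomorphic_discE)
  have "compact E" using disc homeomorphic_compactness compact_cball by blast
  then obtain g' where "homeomorphism E (g ` E) g g'"
    using homeomorphism_compact[OF _ cont refl inj] by blast
  then have c: "homeomorphism (cball 0 1) (g ` E) (g \<circ> \<psi>) (\<psi>' \<circ> g')"
    using homeomorphism_compose[OF \<psi>] by blast
  then show "g ` E homeomorphic (cball 0 1 :: complex set)"
    unfolding homeomorphic_sym[of "g ` E"] by (auto simp: homeomorphic_def)
  show "interior (g ` E) = g ` interior E" "frontier (g ` E) = g ` frontier E"
    using disc_interior_frontier[OF c] disc_interior_frontier[OF \<psi>] by (auto simp: image_comp)
qed

text \<open>Both the interior of the disc and the complement of the disc are connected, so by the Jordan
  curve theorem they are the two sides of the boundary curve.\<close>

lemma winding_number_disc_boundary: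
  assumes disc: "E homeomorphic (cball 0 1 :: complex set)"
    and \<gamma>: "simple_path \<gamma>" "pathfinish \<gamma> = pathstart \<gamma>" "path_image \<gamma> = frontier E"
    and \<zeta>: "\<zeta> \<notin> frontier E"
  shows "winding_number \<gamma> \<zeta> \<noteq> 0 \<longleftrightarrow> \<zeta> \<in> interior E"
proof -
  obtain \<psi> \<psi>' :: "complex \<Rightarrow> complex" where \<psi>: "homeomorphism (cball 0 1) E \<psi> \<psi>'"
    using disc by (rule homeomorphic_discE)
  have intE: "interior E = \<psi> ` ball 0 1" by (rule disc_interior_frontier[OF \<psi>])
  have conn: "connected (interior E)"
    unfolding intE using \<psi> unfolding homeomorphism_def
    by (intro connected_continuous_image) (auto intro: continuous_on_subset)
  have cptE: "compact E" using disc homeomorphic_compactness compact_cball by blast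
  have clE: "closure E = E" using cptE compact_imp_closed closure_closed by blast
  have conn': "connected (- E)"
    by (rule connected_complement_homeomorphic_convex_compact[OF disc]) auto
  have out: "- E \<subseteq> outside (frontier E)"
  proof
    fix x assume x: "x \<in> - E"
    have "- E \<subseteq> - frontier E" using clE by (auto simp: frontier_def)
    then have "- E \<subseteq> connected_component_set (- frontier E) x"
      using connected_component_maximal[OF x conn'] by blast
    moreover have "\<not> bounded (- E)"
      using compact_imp_bounded[OF cptE] cobounded_imp_unbounded[of "- E"] by simp
    ultimately show "x \<in> outside (frontier E)"
      unfolding outside using bounded_subset by blast
  qed
  have disj: "interior E \<inter> frontier E = {}" by (auto simp: frontier_def)
  have ins: "interior E \<subseteq> inside (frontier E)"
  proof (rule ccontr)
    assume "\<not> ?thesis"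
    then obtain x where x: "x \<in> interior E" "x \<notin> inside (frontier E)" by blast
    then have "x \<in> outside (frontier E)"
      using disj inside_Un_outside[of "frontier E"] by blast
    have "interior E \<subseteq> connected_component_set (- frontier E) x"
      by (rule connected_component_maximal[OF x(1) conn]) (use disj in blast)
    then have "interior E \<subseteq> outside (frontier E)"
      using outside_same_component[OF _ \<open>x \<in> outside (frontier E)\<close>] by blast
    then have "- frontier E \<subseteq> outside (frontier E)"
      using out clE by (auto simp: frontier_def)
    then have "inside (frontier E) = {}"
      using inside_Int_outside[of "frontier E"] inside_no_overlap[of "frontier E"] by blast
    then show False using Jordan_inside_outside[OF \<gamma>(1,2)] \<gamma>(3) by simp
  qed
  show ?thesis
  proof
    assume w: "winding_number \<gamma> \<zeta> \<noteq> 0"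
    show "\<zeta> \<in> interior E"
    proof (rule ccontr)
      assume "\<zeta> \<notin> interior E"
      then have "\<zeta> \<in> outside (frontier E)" using \<zeta> out clE by (auto simp: frontier_def)
      then show False
        using w winding_number_zero_in_outside[OF simple_path_imp_path[OF \<gamma>(1)] \<gamma>(2)] \<gamma>(3) by simp
    qed
  next
    assume "\<zeta> \<in> interior E"
    then have "norm (winding_number \<gamma> \<zeta>) = 1"
      using ins \<gamma> by (intro simple_closed_path_norm_winding_number_inside) auto
    then show "winding_number \<gamma> \<zeta> \<noteq> 0" by auto
  qed
qed

section \<open>Branches of the logarithm\<close>

lemma exp_add_2pi_int: "exp (z + 2 * pi * \<i> * of_int k) = exp z"
proof -
  have "z + 2 * pi * \<i> * of_int k = z + \<i> * (of_int k * (of_real pi * 2))" by (simp add: mult_ac)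
  then show ?thesis using exp_plus_2pin by presburger
qed

lemma exp_eq_diff:
  assumes "exp a = exp (b :: complex)"
  obtains k :: int where "a - b = 2 * pi * \<i> * of_int k"
proof -
  obtain k :: int where "a = b + of_real (of_int (2 * k) * pi) * \<i>"
    using assms unfolding exp_eq by blast
  then have "a - b = 2 * pi * \<i> * of_int k" by simp
  then show thesis by (rule that)
qed

lemma continuous_log_unique:
  fixes g1 g2 :: "'a::real_normed_vector \<Rightarrow> complex"
  assumes S: "connected S" and cont: "continuous_on S g1" "continuous_on S g2"
    and eq: "\<And>x. x \<in> S \<Longrightarrow> exp (g1 x) = exp (g2 x)"
  obtains k :: int where "\<And>x. x \<in> S \<Longrightarrow> g1 x = g2 x + 2 * pi * \<i> * of_int k"
proof -
  have int: "\<exists>k::int. g1 x - g2 x = 2 * pi * \<i> * of_int k" if x: "x \<in> S" for x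
    using exp_eq_diff[OF eq[OF x]] by blast
  have "(\<lambda>x. g1 x - g2 x) constant_on S"
  proof (rule continuous_discrete_range_constant[OF S])
    show "continuous_on S (\<lambda>x. g1 x - g2 x)" by (intro continuous_intros cont)
    show "\<exists>e>0. \<forall>y. y \<in> S \<and> g1 y - g2 y \<noteq> g1 x - g2 x \<longrightarrow> e \<le> cmod (g1 y - g2 y - (g1 x - g2 x))"
      if x: "x \<in> S" for x
    proof (intro exI[of _ "2 * pi"] conjI allI impI)
      fix y assume y: "y \<in> S \<and> g1 y - g2 y \<noteq> g1 x - g2 x"
      obtain k l :: int where kl: "g1 x - g2 x = 2 * pi * \<i> * of_int k" "g1 y - g2 y = 2 * pi * \<i> * of_int l"
        using int[of x] int[of y] x y by blast
      then have "k \<noteq> l" using y by auto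
      have "g1 y - g2 y - (g1 x - g2 x) = 2 * pi * \<i> * of_int (l - k)"
        unfolding kl by (simp add: algebra_simps)
      then have "cmod (g1 y - g2 y - (g1 x - g2 x)) = 2 * pi * \<bar>of_int (l - k)\<bar>"
        by (simp add: norm_mult del: of_int_diff)
      moreover have "1 \<le> \<bar>of_int (l - k) :: real\<bar>" using \<open>k \<noteq> l\<close> by linarith
      ultimately show "2 * pi \<le> cmod (g1 y - g2 y - (g1 x - g2 x))"
        by (simp del: of_int_diff)
    qed auto
  qed
  then obtain c where c: "\<And>x. x \<in> S \<Longrightarrow> g1 x - g2 x = c" unfolding constant_on_def by blast
  show thesis
  proof (cases "S = {}")
    case True
    then show ?thesis using that[of 0] by simp
  next
    case False
    then obtain x where "x \<in> S" by blast
    with int obtain k :: int where k: "g1 x - g2 x = 2 * pi * \<i> * of_int k" by blast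
    show ?thesis
    proof (rule that[of k])
      fix y assume "y \<in> S"
      then show "g1 y = g2 y + 2 * pi * \<i> * of_int k"
        using c[of y] c[OF \<open>x \<in> S\<close>] k by (simp add: algebra_simps)
    qed
  qed
qed

text \<open>Lift the isotopy of the boundary curves through \<open>\<zeta> \<mapsto> q + exp \<zeta>\<close>. The points of the logarithmic
  plane lying over \<open>P\<close> are never met, so the winding numbers about them do not change; but these
  winding numbers single out the values on \<open>P\<close> of the branch of \<open>log (z - q)\<close> on the disc.\<close>

lemma isotopic_discs_log_values:
  assumes disc: "E homeomorphic (cball 0 1 :: complex set)" "E' homeomorphic (cball 0 1 :: complex set)"
    and P: "P \<subseteq> interior E" "P \<subseteq> interior E'"
    and g: "continuous_on E g" "\<And>z. z \<in> E \<Longrightarrow> exp (g z) = z - q"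
    and g': "continuous_on E' g'" "\<And>z. z \<in> E' \<Longrightarrow> exp (g' z) = z - q"
    and iso: "isotopic_curves X (frontier E') (frontier E)" and X: "X \<inter> P = {}" "q \<notin> X"
  obtains k :: int where "g' ` P = (\<lambda>p. g p + 2 * pi * \<i> * of_int k) ` P"
proof -
  obtain H :: "real \<times> complex \<Rightarrow> complex"
    where H: "continuous_on ({0..1} \<times> sphere 0 1) H" "H ` ({0..1} \<times> sphere 0 1) \<subseteq> X"
     "\<forall>s\<in>{0..1}. inj_on (\<lambda>z. H (s, z)) (sphere 0 1)"
     "(\<lambda>z. H (0, z)) ` sphere 0 1 = frontier E'" "(\<lambda>z. H (1::real, z)) ` sphere 0 1 = frontier E"
    using iso unfolding isotopic_curves_def by (elim exE conjE) (rule that)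
  define c :: "real \<Rightarrow> complex" where "c \<theta> = exp (2 * pi * \<i> * \<theta>)" for \<theta>
  have c_sphere: "c \<theta> \<in> sphere 0 1" for \<theta> by (simp add: c_def norm_exp_eq_Re)
  have c_img: "c ` {0..1} = sphere 0 1"
  proof
    show "c ` {0..1} \<subseteq> sphere 0 1" using c_sphere by blast
    show "sphere 0 1 \<subseteq> c ` {0..1}"
    proof
      fix z :: complex assume "z \<in> sphere 0 1"
      then have z: "cmod z = 1" by simp
      have 1: "2 * of_real pi * \<i> * complex_of_real (Arg2pi z / (2 * pi)) = \<i> * of_real (Arg2pi z)"
        by (simp add: field_simps)
      have "c (Arg2pi z / (2 * pi)) = z"
        unfolding c_def 1 using Arg2pi_eq[of z] z by simp
      moreover have "Arg2pi z \<ge> 0" "Arg2pi z < 2 * pi" using Arg2pi[of z] by blast+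
      then have "Arg2pi z / (2 * pi) \<in> {0..1}" by simp
      ultimately show "z \<in> c ` {0..1}" by (metis image_eqI)
    qed
  qed
  have c_inj: "x = y \<or> x = 0 \<and> y = 1 \<or> x = 1 \<and> y = 0" if xy: "c x = c y" "x \<in> {0..1}" "y \<in> {0..1}" for x y
  proof -
    obtain n :: int where "2 * pi * \<i> * x - 2 * pi * \<i> * y = 2 * pi * \<i> * of_int n"
      using xy(1) unfolding c_def by (rule exp_eq_diff)
    then have "2 * pi * \<i> * of_real x = 2 * pi * \<i> * of_real (y + of_int n)"
      unfolding of_real_add of_real_of_int_eq distrib_left diff_eq_eq by simp
    then have "x = y + of_int n" unfolding mult_cancel_left of_real_eq_iff by simp
    then have "of_int n \<ge> (-1::real)" "of_int n \<le> (1::real)" using xy by auto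
    then have "n = -1 \<or> n = 0 \<or> n = 1" by linarith
    then show ?thesis using \<open>x = y + of_int n\<close> xy by auto
  qed
  have c01: "c 0 = 1" "c 1 = 1" by (simp_all add: c_def)
  define K where "K y = H (fst y, c (snd y))" for y
  have contK: "continuous_on ({0..1} \<times> {0..1}) K"
    unfolding K_def
    by (rule continuous_on_compose2[OF H(1)])
       (use c_sphere in \<open>auto intro!: continuous_intros simp: c_def\<close>)
  have KX: "K y \<in> X" if "y \<in> {0..1} \<times> {0..1}" for y
  proof -
    have "(fst y, c (snd y)) \<in> {0..1} \<times> sphere 0 1" using that c_sphere by (simp add: mem_Times_iff)
    then show ?thesis unfolding K_def using H(2) by blast
  qed
  have contr: "contractible ({0..1} \<times> {0..1} :: (real \<times> real) set)"
    by (intro convex_imp_contractible convex_Times) auto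
  obtain \<Lambda> where \<Lambda>: "continuous_on ({0..1} \<times> {0..1}) \<Lambda>"
     "\<And>y. y \<in> {0..1} \<times> {0..1} \<Longrightarrow> K y - q = exp (\<Lambda> y)"
  proof (rule continuous_logarithm_on_contractible[OF _ contr])
    show "continuous_on ({0..1} \<times> {0..1}) (\<lambda>y. K y - q)" by (intro continuous_intros contK)
    show "K y - q \<noteq> 0" if "y \<in> {0..1} \<times> {0..1}" for y using KX[OF that] X(2) by auto
  qed blast
  have cont\<Lambda>: "continuous_on {0..1} (\<lambda>\<theta>. \<Lambda> (s, \<theta>))" if "s \<in> {0..1}" for s
    by (rule continuous_on_compose2[OF \<Lambda>(1)]) (use that in \<open>auto intro!: continuous_intros\<close>)
  have contK1: "continuous_on {0..1} (\<lambda>\<theta>. K (s, \<theta>))" if "s \<in> {0..1}" for s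
    by (rule continuous_on_compose2[OF contK]) (use that in \<open>auto intro!: continuous_intros\<close>)
  have Kfr: "(\<lambda>\<theta>. K (0, \<theta>)) ` {0..1} = frontier E'" "(\<lambda>\<theta>. K (1, \<theta>)) ` {0..1} = frontier E"
    unfolding K_def fst_conv snd_conv H(4,5)[symmetric] c_img[symmetric] image_image by (rule refl)+
  \<comment> \<open>Over each of the two discs the lift is a boundary value of a branch, and winds as its image disc.\<close>
  have branch: thesis0
    if s: "s \<in> {0..1}" and F: "F homeomorphic (cball 0 1 :: complex set)" "P \<subseteq> interior F"
      "(\<lambda>\<theta>. K (s, \<theta>)) ` {0..1} = frontier F"
      and l: "continuous_on F l" "\<And>z. z \<in> F \<Longrightarrow> exp (l z) = z - q"
      and *: "\<And>k :: int. pathfinish (\<lambda>\<theta>. \<Lambda> (s, \<theta>)) = pathstart (\<lambda>\<theta>. \<Lambda> (s, \<theta>)) \<Longrightarrow>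
         (\<And>\<zeta>. q + exp \<zeta> \<in> P \<Longrightarrow>
            winding_number (\<lambda>\<theta>. \<Lambda> (s, \<theta>)) \<zeta> \<noteq> 0 \<longleftrightarrow> \<zeta> \<in> (\<lambda>p. l p + 2 * pi * \<i> * of_int k) ` P) \<Longrightarrow> thesis0"
    for s F l thesis0
  proof -
    have clF: "closed F" using F(1) homeomorphic_compactness compact_cball compact_imp_closed by blast
    have frF: "frontier F \<subseteq> F" using clF frontier_subset_closed by blast
    have KF: "K (s, \<theta>) \<in> F" if "\<theta> \<in> {0..1}" for \<theta> using F(3) frF that by blast
    obtain k :: int where k: "\<And>\<theta>. \<theta> \<in> {0..1} \<Longrightarrow> \<Lambda> (s, \<theta>) = l (K (s, \<theta>)) + 2 * pi * \<i> * of_int k"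
    proof (rule continuous_log_unique[of "{0..1::real}" "\<lambda>\<theta>. \<Lambda> (s, \<theta>)" "\<lambda>\<theta>. l (K (s, \<theta>))"])
      show "continuous_on {0..1} (\<lambda>\<theta>. l (K (s, \<theta>)))"
        by (rule continuous_on_compose2[OF l(1) contK1[OF s]]) (use KF in auto)
      show "exp (\<Lambda> (s, \<theta>)) = exp (l (K (s, \<theta>)))" if "\<theta> \<in> {0..1}" for \<theta>
        using \<Lambda>(2)[of "(s, \<theta>)"] l(2)[OF KF[OF that]] s that by simp
    qed (use cont\<Lambda>[OF s] in auto)
    define l' where "l' z = l z + 2 * pi * \<i> * of_int k" for z
    have l': "continuous_on F l'" unfolding l'_def by (intro continuous_intros l(1))
    have exp_l': "exp (l' z) = z - q" if "z \<in> F" for z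
      using l(2)[OF that] unfolding l'_def exp_add_2pi_int .
    have inj: "inj_on l' F" by (rule inj_onI) (metis exp_l' diff_add_cancel)
    note im = disc_image[OF F(1) l' inj]
    define \<gamma> where "\<gamma> \<theta> = \<Lambda> (s, \<theta>)" for \<theta>
    have \<gamma>_eq: "\<gamma> \<theta> = l' (K (s, \<theta>))" if "\<theta> \<in> {0..1}" for \<theta>
      using k[OF that] by (simp add: \<gamma>_def l'_def)
    have simple: "simple_path \<gamma>"
      unfolding simple_path_def loop_free_def
    proof (intro conjI ballI impI)
      show "path \<gamma>" unfolding path_def \<gamma>_def using cont\<Lambda>[OF s] .
      fix x y assume xy: "x \<in> {0..1}" "y \<in> {0..1}" "\<gamma> x = \<gamma> y"
      then have "K (s, x) = K (s, y)" using \<gamma>_eq inj KF by (metis inj_on_def)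
      then have "c x = c y" using inj_onD[OF bspec[OF H(3) s]] c_sphere unfolding K_def by auto
      then show "x = y \<or> x = 0 \<and> y = 1 \<or> x = 1 \<and> y = 0" using c_inj xy by blast
    qed
    have closed: "pathfinish \<gamma> = pathstart \<gamma>"
      unfolding pathfinish_def pathstart_def using \<gamma>_eq[of 0] \<gamma>_eq[of 1] by (simp add: K_def c01)
    have image: "path_image \<gamma> = frontier (l' ` F)"
      unfolding path_image_def im(3) F(3)[symmetric] image_image using \<gamma>_eq by (intro image_cong) auto
    have "winding_number \<gamma> \<zeta> \<noteq> 0 \<longleftrightarrow> \<zeta> \<in> l' ` P" if \<zeta>: "q + exp \<zeta> \<in> P" for \<zeta>
    proof -
      have int: "q + exp \<zeta> \<in> interior F" using \<zeta> F(2) by blast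
      have uniq: "z = q + exp \<zeta>" if "z \<in> F" "\<zeta> = l' z" for z
        using exp_l'[OF that(1)] that(2) by simp
      have 1: "\<zeta> \<notin> frontier (l' ` F)"
      proof
        assume "\<zeta> \<in> frontier (l' ` F)"
        then obtain z where z: "z \<in> frontier F" "\<zeta> = l' z" using im(3) by auto
        have "z = q + exp \<zeta>" by (rule uniq) (use z frF in auto)
        then have "z \<in> interior F" using int by simp
        then show False using z(1) by (auto simp: frontier_def)
      qed
      have "winding_number \<gamma> \<zeta> \<noteq> 0 \<longleftrightarrow> \<zeta> \<in> interior (l' ` F)"
        by (rule winding_number_disc_boundary[OF im(1) simple closed image 1])
      also have "\<dots> \<longleftrightarrow> \<zeta> \<in> l' ` P"
      proof
        assume "\<zeta> \<in> interior (l' ` F)"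
        then obtain z where z: "z \<in> interior F" "\<zeta> = l' z" unfolding im(2) by (rule imageE)
        have "z = q + exp \<zeta>" by (rule uniq) (use z interior_subset in auto)
        then show "\<zeta> \<in> l' ` P" using z(2) \<zeta> by simp
      next
        assume "\<zeta> \<in> l' ` P"
        then show "\<zeta> \<in> interior (l' ` F)" unfolding im(2) using image_mono[OF F(2), of l'] by (rule rev_subsetD)
      qed
      finally show ?thesis .
    qed
    then show thesis0 using closed unfolding \<gamma>_def l'_def by (intro *[of k])
  qed
  obtain k0 :: int where k0: "pathfinish (\<lambda>\<theta>. \<Lambda> (0, \<theta>)) = pathstart (\<lambda>\<theta>. \<Lambda> (0, \<theta>))"
     "\<And>\<zeta>. q + exp \<zeta> \<in> P \<Longrightarrow>
            winding_number (\<lambda>\<theta>. \<Lambda> (0, \<theta>)) \<zeta> \<noteq> 0 \<longleftrightarrow> \<zeta> \<in> (\<lambda>p. g' p + 2 * pi * \<i> * of_int k0) ` P"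
    by (rule branch[OF _ disc(2) P(2) Kfr(1) g']) (simp, assumption, rule that, assumption+)
  obtain k1 :: int where k1: 
     "\<And>\<zeta>. q + exp \<zeta> \<in> P \<Longrightarrow>
            winding_number (\<lambda>\<theta>. \<Lambda> (1, \<theta>)) \<zeta> \<noteq> 0 \<longleftrightarrow> \<zeta> \<in> (\<lambda>p. g p + 2 * pi * \<i> * of_int k1) ` P"
    by (rule branch[OF _ disc(1) P(1) Kfr(2) g]) (simp, assumption, rule that, assumption)
  obtain k2 :: int where k2: "\<And>s. s \<in> {0..1} \<Longrightarrow> \<Lambda> (s, 1) = \<Lambda> (s, 0) + 2 * pi * \<i> * of_int k2"
  proof (rule continuous_log_unique[of "{0..1::real}" "\<lambda>s. \<Lambda> (s, 1)" "\<lambda>s. \<Lambda> (s, 0)"])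
    show "exp (\<Lambda> (s, 1)) = exp (\<Lambda> (s, 0))" if "s \<in> {0..1}" for s
      using \<Lambda>(2)[of "(s, 1)"] \<Lambda>(2)[of "(s, 0)"] that by (simp add: K_def c01)
  qed (auto intro!: continuous_on_compose2[OF \<Lambda>(1)] continuous_intros)
  have loop: "\<Lambda> (s, 1) = \<Lambda> (s, 0)" if "s \<in> {0..1}" for s
    using k2[OF that] k2[of 0] k0(1) by (simp add: pathfinish_def pathstart_def)
  have wn: "winding_number (\<lambda>\<theta>. \<Lambda> (0, \<theta>)) \<zeta> = winding_number (\<lambda>\<theta>. \<Lambda> (1, \<theta>)) \<zeta>"
    if "q + exp \<zeta> \<in> P" for \<zeta>
  proof (rule winding_number_homotopic_loops)
    have "\<Lambda> y \<noteq> \<zeta>" if "y \<in> {0..1} \<times> {0..1}" for y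
      using \<Lambda>(2)[OF that] KX[OF that] X(1) \<open>q + exp \<zeta> \<in> P\<close>
    proof -
      have "K y = q + exp (\<Lambda> y)" using \<Lambda>(2)[OF that] by (simp add: algebra_simps)
      then show ?thesis using KX[OF that] X(1) \<open>q + exp \<zeta> \<in> P\<close> by (metis disjoint_iff)
    qed
    then show "homotopic_loops (- {\<zeta>}) (\<lambda>\<theta>. \<Lambda> (0, \<theta>)) (\<lambda>\<theta>. \<Lambda> (1, \<theta>))"
      unfolding homotopic_loops
      by (intro exI[of _ \<Lambda>]) (use \<Lambda>(1) loop in \<open>auto simp: pathfinish_def pathstart_def\<close>)
  qed
  \<comment> \<open>The homotopy of lifts avoids the points over \<open>P\<close>, so both curves wind about the same ones.\<close>
  have eq: "(\<lambda>p. g' p + 2 * pi * \<i> * of_int k0) ` P = (\<lambda>p. g p + 2 * pi * \<i> * of_int k1) ` P"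
  proof -
    have PE: "p \<in> E" "p \<in> E'" if "p \<in> P" for p using that P interior_subset by blast+
    have "q + exp \<zeta> \<in> P" if "\<zeta> \<in> (\<lambda>p. g' p + 2 * pi * \<i> * of_int k0) ` P \<or> \<zeta> \<in> (\<lambda>p. g p + 2 * pi * \<i> * of_int k1) ` P" for \<zeta>
      using that
    proof (elim disjE imageE)
      fix p assume "\<zeta> = g' p + 2 * pi * \<i> * of_int k0" "p \<in> P"
      then show ?thesis using g'(2)[OF PE(2)] by (simp only: exp_add_2pi_int) simp
    next
      fix p assume "\<zeta> = g p + 2 * pi * \<i> * of_int k1" "p \<in> P"
      then show ?thesis using g(2)[OF PE(1)] by (simp only: exp_add_2pi_int) simp
    qed
    note over = this
    show ?thesis
    proof (intro set_eqI iffI)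
      fix \<zeta> assume "\<zeta> \<in> (\<lambda>p. g' p + 2 * pi * \<i> * of_int k0) ` P"
      then show "\<zeta> \<in> (\<lambda>p. g p + 2 * pi * \<i> * of_int k1) ` P"
        using k0(2)[of \<zeta>] k1[of \<zeta>] wn[of \<zeta>] over[of \<zeta>] by argo
    next
      fix \<zeta> assume "\<zeta> \<in> (\<lambda>p. g p + 2 * pi * \<i> * of_int k1) ` P"
      then show "\<zeta> \<in> (\<lambda>p. g' p + 2 * pi * \<i> * of_int k0) ` P"
        using k0(2)[of \<zeta>] k1[of \<zeta>] wn[of \<zeta>] over[of \<zeta>] by argo
    qed
  qed
  have "g' ` P = (\<lambda>x. x - 2 * pi * \<i> * of_int k0) ` (\<lambda>p. g' p + 2 * pi * \<i> * of_int k0) ` P"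
    by (simp add: image_image)
  also have "\<dots> = (\<lambda>p. g p + 2 * pi * \<i> * of_int (k1 - k0)) ` P"
    unfolding eq image_image by (simp add: algebra_simps)
  finally show thesis by (rule that)
qed

section \<open>The linking number of unlinked sets\<close>

lemma winding_number_eq_log:
  assumes g: "continuous_on {0..1} g" and exp: "\<And>t. t \<in> {0..1} \<Longrightarrow> exp (g t) = \<gamma> t"
  shows "2 * pi * \<i> * winding_number \<gamma> 0 = g 1 - g 0"
proof -
  have "continuous_on {0..1} (\<lambda>t. exp (g t))" by (intro continuous_intros g)
  then have "path \<gamma>" unfolding path_def using exp by (metis (no_types, lifting) continuous_on_eq)
  moreover have "0 \<notin> path_image \<gamma>" unfolding path_image_def
  proof
    assume "0 \<in> \<gamma> ` {0..1}"
    then obtain t where "t \<in> {0..1}" "\<gamma> t = 0" by auto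
    then show False using exp[of t] by simp
  qed
  ultimately obtain l where l: "path l" "pathfinish l - pathstart l = 2 * of_real pi * \<i> * winding_number \<gamma> 0"
    "\<And>t. t \<in> {0..1} \<Longrightarrow> \<gamma> t = 0 + exp (l t)"
    by (rule winding_number_as_continuous_log) (rule that)
  obtain k :: int where k: "\<And>t. t \<in> {0..1} \<Longrightarrow> l t = g t + 2 * pi * \<i> * of_int k"
  proof (rule continuous_log_unique[of "{0..1::real}" l g])
    show "continuous_on {0..1} l" using l(1) unfolding path_def .
    show "exp (l t) = exp (g t)" if "t \<in> {0..1}" for t using l(3)[OF that] exp[OF that] by simp
  qed (use g in auto)
  show ?thesis using l(2) k[of 0] k[of 1] unfolding pathfinish_def pathstart_def by simp
qed

lemma isotopy_from_id_homeomorphism: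
  assumes "isotopy_from_id h f"
  obtains g where "homeomorphism (cball 0 1) (cball 0 1) f g"
proof -
  obtain g where "homeomorphism (cball 0 1) (cball 0 1) (\<lambda>z. h (1, z)) g"
    using assms unfolding isotopy_from_id_def by (meson atLeastAtMost_iff order_refl zero_le_one)
  then have "homeomorphism (cball 0 1) (cball 0 1) f g"
    by (rule homeomorphism_cong) (use assms in \<open>auto simp: isotopy_from_id_def\<close>)
  then show thesis by (rule that)
qed

lemma isotopy_from_id_inj:
  assumes "isotopy_from_id h f" "t \<in> {0..1}"
  shows "inj_on (\<lambda>z. h (t, z)) (cball 0 1)"
proof -
  obtain g where g: "homeomorphism (cball 0 1) (cball 0 1) (\<lambda>z. h (t, z)) g"
    using assms unfolding isotopy_from_id_def by blast
  show ?thesis by (rule inj_on_inverseI) (rule homeomorphism_apply1[OF g])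
qed

text \<open>On the disc \<open>D\<close> about \<open>P\<close>, which contains no point of \<open>Q\<close>, the differences \<open>h (t, z) - h (t, q)\<close> have a
  continuous logarithm \<open>G q (t, z)\<close>. It is a branch of \<open>log (z - q)\<close> for \<open>t = 0\<close>, and one of
  \<open>log (z - f q)\<close> on \<open>f ` D\<close> for \<open>t = 1\<close>. By the preceding comparison of branches, summing
  \<open>G q (1, p) - G q (0, p)\<close> over all \<open>p\<close> and \<open>q\<close> leaves only \<open>card P\<close> equal multiples of
  \<open>2 * pi * \<i>\<close> for each \<open>q\<close>.\<close>

lemma unlinked_imp_card_dvd_linking_number:
  assumes h: "isotopy_from_id h f"
    and P: "P \<subseteq> cball 0 1" "f ` P = P" "finite P" and Q: "Q \<subseteq> cball 0 1" "f ` Q = Q" "finite Q"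
    and unl: "unlinked (cball 0 1) f P Q"
  obtains k :: int where
    "(\<Sum>p\<in>P. \<Sum>q\<in>Q. winding_number (\<lambda>t. h (t, p) - h (t, q)) 0) = of_int k * of_nat (card P)"
proof -
  define W where "W p q = winding_number (\<lambda>t. h (t, p) - h (t, q)) 0" for p q
  obtain D D' where D: "closed_disc_in (cball 0 1) D" "closed_disc_in (cball 0 1) D'" "D \<inter> D' = {}"
    "P \<subseteq> interior D" "Q \<subseteq> interior D'"
    and iso: "isotopic_curves (cball 0 1 - (P \<union> Q)) (f ` frontier D) (frontier D)"
    using unl unfolding unlinked_def by (elim exE conjE) (rule that)
  have D1: "D \<subseteq> cball 0 1" "D homeomorphic (cball 0 1 :: complex set)"
    using D(1) by (auto simp: closed_disc_in_def)
  have PD: "p \<in> D" if "p \<in> P" for p using that D(4) interior_subset by blast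
  have QD: "q \<notin> D" if "q \<in> Q" for q using that D(3,5) interior_subset by blast
  obtain f' where f': "homeomorphism (cball 0 1) (cball 0 1) f f'"
    using h by (rule isotopy_from_id_homeomorphism)
  have f'f: "f' (f z) = z" if "z \<in> cball 0 1" for z using f' that by (rule homeomorphism_apply1)
  have contf: "continuous_on D f" using f' D1(1) continuous_on_subset homeomorphism_cont1 by blast
  have injf: "inj_on f D" by (rule inj_on_inverseI[of _ f']) (use f'f D1(1) in blast)
  note E = disc_image[OF D1(2) contf injf]
  have contf': "continuous_on (f ` D) f'"
  proof (rule continuous_on_subset[OF homeomorphism_cont2[OF f']])
    show "f ` D \<subseteq> cball 0 1" using homeomorphism_image1[OF f'] image_mono[OF D1(1), of f] by simp
  qed
  have conth: "continuous_on ({0..1} \<times> cball 0 1) h" using h by (simp add: isotopy_from_id_def)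
  have h0: "h (0, z) = z" "h (1, z) = f z" if "z \<in> cball 0 1" for z using h that by (simp_all add: isotopy_from_id_def)
  have contr: "contractible ({0..1::real} \<times> D)"
  proof (rule contractible_Times)
    show "contractible D"
      using homeomorphic_contractible_eq[OF D1(2)] convex_imp_contractible[OF convex_cball] by blast
  qed (simp add: convex_imp_contractible)
  have exG: "\<exists>G. continuous_on ({0..1} \<times> D) G \<and> (\<forall>y\<in>{0..1} \<times> D. exp (G y) = h y - h (fst y, q))"
    if q: "q \<in> Q" for q
  proof -
    have c: "continuous_on ({0..1} \<times> D) (\<lambda>y. h y - h (fst y, q))"
    proof (intro continuous_intros)
      show "continuous_on ({0..1} \<times> D) h"
        by (rule continuous_on_subset[OF conth]) (use D1(1) in auto)
      show "continuous_on ({0..1} \<times> D) (\<lambda>y. h (fst y, q))"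
        by (rule continuous_on_compose2[OF conth]) (use q Q(1) in \<open>auto intro!: continuous_intros\<close>)
    qed
    have nz: "h y - h (fst y, q) \<noteq> 0" if y: "y \<in> {0..1} \<times> D" for y
    proof
      assume "h y - h (fst y, q) = 0"
      then have "h (fst y, snd y) = h (fst y, q)" by simp
      moreover have "fst y \<in> {0..1}" "snd y \<in> D" using y by (auto simp: mem_Times_iff)
      ultimately have "snd y = q"
        using inj_onD[OF isotopy_from_id_inj[OF h], of "fst y" "snd y" q] D1(1) Q(1) q by blast
      then show False using QD[OF q] \<open>snd y \<in> D\<close> by simp
    qed
    obtain G where "continuous_on ({0..1} \<times> D) G"
      "\<And>y. y \<in> {0..1} \<times> D \<Longrightarrow> h y - h (fst y, q) = exp (G y)"
      by (rule continuous_logarithm_on_contractible[OF c contr nz]) (assumption, (rule that; assumption))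
    then show ?thesis by (intro exI[of _ G]) simp
  qed
  have "\<forall>q\<in>Q. \<exists>G. continuous_on ({0..1} \<times> D) G \<and> (\<forall>y\<in>{0..1} \<times> D. exp (G y) = h y - h (fst y, q))"
    by (intro ballI exG)
  from bchoice[OF this] obtain G where "\<forall>q\<in>Q. continuous_on ({0..1} \<times> D) (G q) \<and>
      (\<forall>y\<in>{0..1} \<times> D. exp (G q y) = h y - h (fst y, q))" by (elim exE)
  then have G: "\<And>q. q \<in> Q \<Longrightarrow> continuous_on ({0..1} \<times> D) (G q)"
    "\<And>q y. q \<in> Q \<Longrightarrow> y \<in> {0..1} \<times> D \<Longrightarrow> exp (G q y) = h y - h (fst y, q)"
    by blast+
  have cont_slice: "continuous_on D (\<lambda>z. G q (s, z))" if "q \<in> Q" "s \<in> {0..1}" for q s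
    by (rule continuous_on_compose2[OF G(1)[OF that(1)]]) (use that in \<open>auto intro!: continuous_intros\<close>)
  have W: "2 * pi * \<i> * W p q = G q (1, p) - G q (0, p)" if "p \<in> P" "q \<in> Q" for p q
    unfolding W_def
  proof (rule winding_number_eq_log)
    show "continuous_on {0..1} (\<lambda>t. G q (t, p))"
      by (rule continuous_on_compose2[OF G(1)[OF that(2)]]) (use PD that in \<open>auto intro!: continuous_intros\<close>)
    show "exp (G q (t, p)) = h (t, p) - h (t, q)" if "t \<in> {0..1}" for t
      using G(2)[OF \<open>q \<in> Q\<close>, of "(t, p)"] that PD[OF \<open>p \<in> P\<close>] by simp
  qed
  have fP: "P \<subseteq> interior (f ` D)" unfolding E(2) using image_mono[OF D(4), of f] P(2) by simp
  have exk: "\<exists>k::int. (\<Sum>p\<in>P. G q (1, p)) = (\<Sum>p\<in>P. G (f q) (0, p)) + 2 * pi * \<i> * of_int k * card P"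
    if q: "q \<in> Q" for q
  proof -
    have fq: "f q \<in> Q" using Q(2) q by blast
    define g g' where "g z = G (f q) (0, z)" and "g' z = G q (1, f' z)" for z
    have g: "continuous_on D g" unfolding g_def by (rule cont_slice[OF fq]) simp
    have eg: "exp (g z) = z - f q" if "z \<in> D" for z
    proof -
      have "z \<in> cball 0 1" "f q \<in> cball 0 1" using that D1(1) Q(1) fq by blast+
      then show ?thesis using G(2)[OF fq, of "(0, z)"] that h0 by (simp add: g_def)
    qed
    have f'D: "f' z \<in> D" if z: "z \<in> f ` D" for z 
    proof -
      obtain x where "z = f x" "x \<in> D" using z by (rule imageE)
      moreover have "x \<in> cball 0 1" using \<open>x \<in> D\<close> D1(1) by blast
      ultimately show ?thesis using f'f by simp
    qed
    have g': "continuous_on (f ` D) g'" unfolding g'_def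
      by (rule continuous_on_compose2[OF cont_slice[OF q] contf']) (use f'D in auto)
    have eg': "exp (g' z) = z - f q" if z: "z \<in> f ` D" for z
    proof -
      obtain x where x: "z = f x" "x \<in> D" using z by (rule imageE)
      have "x \<in> cball 0 1" "q \<in> cball 0 1" using x(2) D1(1) Q(1) q by blast+
      then show ?thesis using G(2)[OF q, of "(1, x)"] x f'f h0 by (simp add: g'_def)
    qed
    obtain k :: int where k: "g' ` P = (\<lambda>p. g p + 2 * pi * \<i> * of_int k) ` P"
    proof (rule isotopic_discs_log_values[OF D1(2) E(1) D(4) fP g eg g' eg' iso[folded E(3)]])
      show "(cball 0 1 - (P \<union> Q)) \<inter> P = {}" "f q \<notin> cball 0 1 - (P \<union> Q)" using fq by auto
    qed
    have inj1: "inj_on g' P"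
    proof (rule inj_onI)
      fix x y assume xy: "x \<in> P" "y \<in> P" "g' x = g' y"
      have "x \<in> f ` D" "y \<in> f ` D" using xy(1,2) fP interior_subset by blast+
      note eg'[OF this(1)] eg'[OF this(2)]
      then have "x - f q = y - f q" unfolding xy(3) by (rule subst)
      then show "x = y" by simp
    qed
    have inj2: "inj_on (\<lambda>p. g p + 2 * pi * \<i> * of_int k) P"
    proof (rule inj_onI)
      fix x y assume xy: "x \<in> P" "y \<in> P" "g x + 2 * pi * \<i> * of_int k = g y + 2 * pi * \<i> * of_int k"
      note eg[OF PD[OF xy(1)]] eg[OF PD[OF xy(2)]]
      then have "x - f q = y - f q" unfolding xy(3)[unfolded add_right_cancel] by (rule subst)
      then show "x = y" by simp
    qed
    have injP: "inj_on f P" by (rule inj_on_subset[OF injf]) (use PD in blast)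
    have "(\<Sum>p\<in>P. G q (1, p)) = (\<Sum>p\<in>P. g' (f p))"
    proof (intro sum.cong refl)
      fix p assume "p \<in> P"
      then have "f' (f p) = p" using f'f P(1) by blast
      then show "G q (1, p) = g' (f p)" by (simp only: g'_def)
    qed
    also have "\<dots> = sum g' P" using sum.reindex[OF injP, of g'] P(2) by (simp add: o_def)
    also have "\<dots> = sum id (g' ` P)" using sum.reindex[OF inj1, of id] by simp
    also have "\<dots> = (\<Sum>p\<in>P. g p + 2 * pi * \<i> * of_int k)"
      unfolding k using sum.reindex[OF inj2, of id] by simp
    also have "\<dots> = (\<Sum>p\<in>P. G (f q) (0, p)) + 2 * pi * \<i> * of_int k * card P"
      by (simp add: sum.distrib g_def)
    finally show ?thesis by blast
  qed
  have "\<forall>q\<in>Q. \<exists>k::int. (\<Sum>p\<in>P. G q (1, p)) = (\<Sum>p\<in>P. G (f q) (0, p)) + 2 * pi * \<i> * of_int k * card P"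
    by (intro ballI exk)
  from bchoice[OF this] obtain k :: "complex \<Rightarrow> int" where k: "\<forall>q\<in>Q.
      (\<Sum>p\<in>P. G q (1, p)) = (\<Sum>p\<in>P. G (f q) (0, p)) + 2 * pi * \<i> * of_int (k q) * card P" by (elim exE)
  have injQ: "inj_on f Q" by (rule inj_on_inverseI[of _ f']) (use f'f Q(1) in blast)
  have "2 * pi * \<i> * (\<Sum>p\<in>P. \<Sum>q\<in>Q. W p q) = (\<Sum>q\<in>Q. \<Sum>p\<in>P. 2 * pi * \<i> * W p q)"
    by (subst sum.swap) (simp add: sum_distrib_left)
  also have "\<dots> = (\<Sum>q\<in>Q. \<Sum>p\<in>P. G q (1, p) - G q (0, p))"
    by (intro sum.cong refl W)
  also have "\<dots> = (\<Sum>q\<in>Q. (\<Sum>p\<in>P. G (f q) (0, p)) + 2 * pi * \<i> * of_int (k q) * card P - (\<Sum>p\<in>P. G q (0, p)))"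
    by (intro sum.cong refl) (simp add: sum_subtractf bspec[OF k])
  also have "\<dots> = (\<Sum>q\<in>Q. \<Sum>p\<in>P. G (f q) (0, p)) - (\<Sum>q\<in>Q. \<Sum>p\<in>P. G q (0, p)) + (\<Sum>q\<in>Q. 2 * pi * \<i> * of_int (k q) * card P)"
    by (simp add: sum.distrib sum_subtractf)
  also have "(\<Sum>q\<in>Q. \<Sum>p\<in>P. G (f q) (0, p)) = (\<Sum>q\<in>Q. \<Sum>p\<in>P. G q (0, p))"
    using sum.reindex[OF injQ, of "\<lambda>q. \<Sum>p\<in>P. G q (0, p)"] Q(2) by (simp add: o_def)
  also have "(\<Sum>q\<in>Q. 2 * pi * \<i> * of_int (k q) * card P) = 2 * pi * \<i> * (of_int (\<Sum>q\<in>Q. k q) * of_nat (card P))"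
    by (simp add: sum_distrib_left sum_distrib_right mult_ac)
  finally have "2 * pi * \<i> * (\<Sum>p\<in>P. \<Sum>q\<in>Q. W p q) = 2 * pi * \<i> * (of_int (\<Sum>q\<in>Q. k q) * of_nat (card P))"
    by simp
  then have "(\<Sum>p\<in>P. \<Sum>q\<in>Q. W p q) = of_int (\<Sum>q\<in>Q. k q) * of_nat (card P)"
    unfolding mult_cancel_left by simp
  then show thesis unfolding W_def by (rule that)
qed

section \<open>The lexicographic order\<close>

lemma lex_less_irrefl: "\<not> lex_less z z"
  by (simp add: lex_less_def)

lemma lex_less_trans: "lex_less x y \<Longrightarrow> lex_less y z \<Longrightarrow> lex_less x z"
  by (auto simp: lex_less_def)

lemma lex_less_linear: "lex_less x y \<or> x = y \<or> lex_less y x"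
  by (auto simp: lex_less_def complex_eq_iff)

text \<open>All geometric arguments about the order rest on this compatibility with convex combinations.\<close>

lemma lex_less_convex:
  assumes "lex_less x y" "lex_less x' y'" "0 \<le> s" "s \<le> 1"
  shows "lex_less ((1 - s) *\<^sub>R x + s *\<^sub>R x') ((1 - s) *\<^sub>R y + s *\<^sub>R y')"
proof -
  consider "s = 0" | "s = 1" | "0 < s" "s < 1" using assms by linarith
  then show ?thesis
  proof cases
    case 3
    have le: "(1 - s) * a + s * b < (1 - s) * a' + s * b'" if "a \<le> a'" "b \<le> b'" "a < a' \<or> b < b'" for a b a' b'
      using that 3 by (smt (verit) mult_le_cancel_left_pos mult_less_cancel_left_pos)
    show ?thesis
      using assms(1,2) 3 le[of "Re x" "Re y" "Re x'" "Re y'"] le[of "Im x" "Im y" "Im x'" "Im y'"]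
      unfolding lex_less_def by auto
  qed (use assms in auto)
qed

section \<open>Half twists\<close>

definition stretch :: "real \<Rightarrow> complex \<Rightarrow> complex" where
  "stretch \<eta> z = Complex (Re z) (\<eta> * Im z)"

text \<open>For \<open>u\<close> from 0 to 1 (to -1), \<open>turn u\<close> runs through the upper (lower) half of the unit circle
  from 1 to -1. As this parametrization is rational, it can be evaluated exactly.\<close>

definition turn :: "real \<Rightarrow> complex" where
  "turn u = (Complex (1 - \<bar>u\<bar>) u)\<^sup>2 / of_real ((1 - \<bar>u\<bar>)\<^sup>2 + u\<^sup>2)"

text \<open>Damps the half turn of the unit disc to the identity within the collar \<open>1 \<le> (cmod z)\<^sup>2 \<le> 1 + \<eta>\<close>. In terms
  of the square of the modulus no roots have to be extracted.\<close>

definition fade :: "real \<Rightarrow> complex \<Rightarrow> real" where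
  "fade \<eta> z = max 0 (min 1 (1 - ((cmod z)\<^sup>2 - 1) / \<eta>))"

definition unit_twist :: "real \<Rightarrow> real \<Rightarrow> complex \<Rightarrow> complex" where
  "unit_twist \<eta> u z =
     stretch \<eta> (stretch (1 / \<eta>) z * turn (u * fade \<eta> (stretch (1 / \<eta>) z)))"

definition to_unit :: "complex \<Rightarrow> complex \<Rightarrow> complex \<Rightarrow> complex" where
  "to_unit a b z = (z - (a + b) / 2) / ((b - a) / 2)"

definition from_unit :: "complex \<Rightarrow> complex \<Rightarrow> complex \<Rightarrow> complex" where
  "from_unit a b z = (a + b) / 2 + (b - a) / 2 * z"

text \<open>The affine map \<open>to_unit a b\<close> takes the segment from \<open>a\<close> to \<open>b\<close> to the segment from -1 to 1. There
  a half turn is performed in the ellipse with semi-axes 1 and \<open>\<eta>\<close>, and damped in a narrow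
  collar outside it.\<close>

definition twist :: "complex \<Rightarrow> complex \<Rightarrow> real \<Rightarrow> real \<Rightarrow> complex \<Rightarrow> complex" where
  "twist a b \<eta> u z = from_unit a b (unit_twist \<eta> u (to_unit a b z))"

text \<open>In the coordinates of the segment, \<open>gap\<close> is positive off the segment and 0 at its end points. A point is
  fixed by all twists whose parameter \<open>\<eta> \<le> 1\<close> does not exceed its gap.\<close>

definition gap :: "complex \<Rightarrow> complex \<Rightarrow> complex \<Rightarrow> real" where
  "gap a b z = max ((Re (to_unit a b z))\<^sup>2 - 1) ((Im (to_unit a b z))\<^sup>2 / 2)"

lemma stretch_simps [simp]: "Re (stretch \<eta> z) = Re z" "Im (stretch \<eta> z) = \<eta> * Im z"
  by (simp_all add: stretch_def)

lemma stretch_inverse: "\<eta> \<noteq> 0 \<Longrightarrow> stretch \<eta> (stretch (1 / \<eta>) z) = z" "\<eta> \<noteq> 0 \<Longrightarrow> stretch (1 / \<eta>) (stretch \<eta> z) = z"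
  by (simp_all add: complex_eq_iff)

lemma turn_denom_pos: "(1 - \<bar>u\<bar>)\<^sup>2 + u\<^sup>2 > (0::real)"
  by (cases "u = 0") (auto intro: add_nonneg_pos)

lemma Re_turn: "Re (turn u) = ((1 - \<bar>u\<bar>)\<^sup>2 - u\<^sup>2) / ((1 - \<bar>u\<bar>)\<^sup>2 + u\<^sup>2)"
  and Im_turn: "Im (turn u) = 2 * (1 - \<bar>u\<bar>) * u / ((1 - \<bar>u\<bar>)\<^sup>2 + u\<^sup>2)"
  unfolding turn_def Re_divide_of_real Im_divide_of_real by (simp_all add: power2_eq_square)

lemma cmod_turn [simp]: "cmod (turn u) = 1"
proof -
  have "cmod ((Complex (1 - \<bar>u\<bar>) u)\<^sup>2) = (1 - \<bar>u\<bar>)\<^sup>2 + u\<^sup>2"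
    unfolding norm_power cmod_power2 by simp
  then show ?thesis using turn_denom_pos[of u] unfolding turn_def norm_divide norm_of_real by auto
qed

lemma turn_values [simp]: "turn 0 = 1" "turn 1 = -1" "turn (-1) = -1"
  by (simp_all add: complex_eq_iff Re_turn Im_turn)

lemma turn_minus: "turn (- u) = cnj (turn u)"
  by (simp add: complex_eq_iff Re_turn Im_turn)

lemma turn_mult_minus [simp]: "turn u * turn (- u) = 1"
  using complex_norm_square[of "turn u"] by (simp add: turn_minus)

lemma continuous_on_turn [continuous_intros]:
  "continuous_on S f \<Longrightarrow> continuous_on S (\<lambda>x. turn (f x))"
  unfolding turn_def Complex_eq using turn_denom_pos
  by (intro continuous_intros) (auto simp del: of_real_add of_real_power simp: less_imp_neq[symmetric])

lemma continuous_on_stretch [continuous_intros]: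
  "continuous_on S e \<Longrightarrow> continuous_on S f \<Longrightarrow> continuous_on S (\<lambda>x. stretch (e x) (f x))"
  unfolding stretch_def Complex_eq by (intro continuous_intros)

lemma from_to_unit: "a \<noteq> b \<Longrightarrow> from_unit a b (to_unit a b z) = z"
  and to_from_unit: "a \<noteq> b \<Longrightarrow> to_unit a b (from_unit a b z) = z"
proof -
  have *: "c + d * ((z - c) / d) = z" "(c + d * z - c) / d = z" if "d \<noteq> 0" for c d :: complex
    using that by simp_all
  assume "a \<noteq> b"
  then have "(b - a) / 2 \<noteq> 0" by simp
  from *[OF this] show "from_unit a b (to_unit a b z) = z" "to_unit a b (from_unit a b z) = z"
    unfolding from_unit_def to_unit_def by this+
qed

lemma from_unit_ends [simp]: "from_unit a b 1 = b" "from_unit a b (-1) = a"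
  by (simp_all add: from_unit_def field_simps)

lemma to_unit_ends: "a \<noteq> b \<Longrightarrow> to_unit a b a = -1" "a \<noteq> b \<Longrightarrow> to_unit a b b = 1"
  using to_from_unit[of a b "-1"] to_from_unit[of a b 1] by simp_all

text \<open>The damping only depends on the modulus, which rotations preserve; so turning back by the negative
  angle inverts the twist.\<close>

lemma fade_turn: "fade \<eta> (z * turn v) = fade \<eta> z"
  by (simp add: fade_def norm_mult)

lemma unit_twist_inverse:
  assumes "\<eta> \<noteq> 0"
  shows "unit_twist \<eta> (- u) (unit_twist \<eta> u z) = z"
proof -
  let ?Z = "stretch (1 / \<eta>) z"
  have "unit_twist \<eta> (- u) (unit_twist \<eta> u z) =
      stretch \<eta> (?Z * (turn (u * fade \<eta> ?Z) * turn (- (u * fade \<eta> ?Z))))"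
    unfolding unit_twist_def stretch_inverse(2)[OF assms] fade_turn by (simp add: mult.assoc)
  then show ?thesis using stretch_inverse(1)[OF assms] by simp
qed

lemma twist_inverse:
  assumes "\<eta> \<noteq> 0" "a \<noteq> b"
  shows "twist a b \<eta> (- u) (twist a b \<eta> u z) = z"
  unfolding twist_def to_from_unit[OF assms(2)] unit_twist_inverse[OF assms(1)] from_to_unit[OF assms(2)] ..

lemma continuous_on_twist [continuous_intros]:
  assumes "\<eta> \<noteq> 0" "a \<noteq> b" "continuous_on S u" "continuous_on S f"
  shows "continuous_on S (\<lambda>x. twist a b \<eta> (u x) (f x))"
  unfolding twist_def unit_twist_def fade_def to_unit_def from_unit_def
  by (intro continuous_intros assms) (use assms in auto)

lemma twist_0: "\<eta> \<noteq> 0 \<Longrightarrow> a \<noteq> b \<Longrightarrow> twist a b \<eta> 0 z = z"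
  by (simp add: twist_def unit_twist_def stretch_inverse from_to_unit)

lemma twist_outside:
  assumes "\<eta> > 0" "a \<noteq> b" "(cmod (stretch (1 / \<eta>) (to_unit a b z)))\<^sup>2 \<ge> 1 + \<eta>"
  shows "twist a b \<eta> u z = z"
proof -
  have "((cmod (stretch (1 / \<eta>) (to_unit a b z)))\<^sup>2 - 1) / \<eta> \<ge> 1"
    using assms by (simp add: field_simps)
  then have "fade \<eta> (stretch (1 / \<eta>) (to_unit a b z)) = 0" unfolding fade_def by simp
  then show ?thesis using assms(1,2) by (simp add: twist_def unit_twist_def stretch_inverse from_to_unit)
qed

lemma twist_ends:
  assumes "\<eta> > 0" "a \<noteq> b"
  shows "twist a b \<eta> u a = from_unit a b (- stretch \<eta> (turn u))"
    and "twist a b \<eta> u b = from_unit a b (stretch \<eta> (turn u))"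
proof -
  have 1: "stretch (1 / \<eta>) (-1) = -1" "stretch (1 / \<eta>) 1 = 1" "stretch \<eta> (- z) = - stretch \<eta> z" for z
    by (simp_all add: complex_eq_iff)
  then show "twist a b \<eta> u a = from_unit a b (- stretch \<eta> (turn u))"
    "twist a b \<eta> u b = from_unit a b (stretch \<eta> (turn u))"
    unfolding twist_def unit_twist_def to_unit_ends[OF assms(2)] 1 by (simp_all add: fade_def 1)
qed

lemma cmod_stretch_sq: "(cmod (stretch e z))\<^sup>2 = (Re z)\<^sup>2 + e\<^sup>2 * (Im z)\<^sup>2"
  by (simp add: cmod_power2 power_mult_distrib)

lemma gap_outside:
  assumes "0 < \<eta>" "\<eta> \<le> 1" "\<eta> \<le> gap a b z"
  shows "(cmod (stretch (1 / \<eta>) (to_unit a b z)))\<^sup>2 \<ge> 1 + \<eta>"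
proof -
  let ?X = "Re (to_unit a b z)" and ?Y = "Im (to_unit a b z)"
  consider "\<eta> \<le> ?X\<^sup>2 - 1" | "\<eta> \<le> ?Y\<^sup>2 / 2"
    using assms(3) unfolding gap_def by linarith
  then show ?thesis
  proof cases
    case 1
    moreover have "0 \<le> (1 / \<eta>)\<^sup>2 * ?Y\<^sup>2" by simp
    ultimately show ?thesis unfolding cmod_stretch_sq by linarith
  next
    case 2
    have "\<eta>\<^sup>2 \<le> \<eta>" using assms(1,2) unfolding power2_eq_square by (intro mult_left_le) auto
    then have "2 * \<eta>\<^sup>2 \<le> ?Y\<^sup>2" using 2 by linarith
    then have "2 \<le> (1 / \<eta>)\<^sup>2 * ?Y\<^sup>2"
      using assms(1) by (simp add: power_divide field_simps)
    moreover have "0 \<le> ?X\<^sup>2" by simp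
    ultimately show ?thesis unfolding cmod_stretch_sq using assms(2) by linarith
  qed
qed

lemma gap_pos:
  assumes "a \<noteq> b" "z \<notin> closed_segment a b"
  shows "gap a b z > 0"
proof (rule ccontr)
  assume "\<not> gap a b z > 0"
  then have 1: "(Re (to_unit a b z))\<^sup>2 \<le> 1" "(Im (to_unit a b z))\<^sup>2 \<le> 0"
    unfolding gap_def by linarith+
  then have im: "Im (to_unit a b z) = 0" by simp
  define x where "x = Re (to_unit a b z)"
  have x: "-1 \<le> x" "x \<le> 1" using 1(1) unfolding x_def[symmetric] by (auto simp: abs_square_le_1 abs_le_iff)
  have "to_unit a b z = of_real x" using im by (simp add: complex_eq_iff x_def)
  then have "z = from_unit a b (of_real x)" using from_to_unit[OF assms(1)] by metis
  also have "\<dots> = (1 - (1 + x) / 2) *\<^sub>R a + ((1 + x) / 2) *\<^sub>R b"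
    by (simp add: from_unit_def complex_eq_iff field_simps)
  finally have "z \<in> closed_segment a b"
    unfolding closed_segment_def using x by (intro CollectI exI[of _ "(1 + x) / 2"]) simp
  then show False using assms(2) by simp
qed

lemma gap_ends [simp]: "a \<noteq> b \<Longrightarrow> gap a b a = 0" "a \<noteq> b \<Longrightarrow> gap a b b = 0"
  by (simp_all add: gap_def to_unit_ends)

text \<open>Points of the ellipse and its collar have distance at most \<open>2 * \<eta>\<close> from the segment: up to \<open>\<eta> / 2\<close> beyond its ends and
  up to \<open>3 / 2 * \<eta>\<close> across it. The bounds on \<open>\<eta>\<close> make this smaller than the distance of the segment
  from the unit circle.\<close>

lemma ellipse_in_ball:
  assumes ab: "cmod a < 1" "cmod b < 1" and \<eta>: "0 < \<eta>" "\<eta> \<le> 1"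
    and room: "\<eta> \<le> (1 - (cmod a)\<^sup>2) / 4" "\<eta> \<le> (1 - (cmod b)\<^sup>2) / 4"
    and \<zeta>: "(cmod (stretch (1 / \<eta>) \<zeta>))\<^sup>2 \<le> 1 + \<eta>"
  shows "cmod (from_unit a b \<zeta>) < 1"
proof -
  let ?X = "Re \<zeta>" and ?Y = "Im \<zeta>"
  have le: "?X\<^sup>2 + (1 / \<eta>)\<^sup>2 * ?Y\<^sup>2 \<le> 1 + \<eta>" using \<zeta> unfolding cmod_stretch_sq .
  have nn: "0 \<le> ?X\<^sup>2" "0 \<le> (1 / \<eta>)\<^sup>2 * ?Y\<^sup>2" by simp_all
  have "?X\<^sup>2 \<le> 1 + \<eta>" using le nn by linarith
  also have "\<dots> \<le> (1 + \<eta> / 2)\<^sup>2" using \<eta> by (simp add: power2_eq_square algebra_simps)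
  finally have X: "\<bar>?X\<bar> \<le> 1 + \<eta> / 2" using \<eta> by (simp add: abs_le_square_iff[symmetric])
  have "(1 / \<eta>)\<^sup>2 * ?Y\<^sup>2 \<le> 2" using le nn \<eta> by linarith
  then have "?Y\<^sup>2 \<le> 2 * \<eta>\<^sup>2" using \<eta> by (simp add: power_divide field_simps)
  also have "\<dots> \<le> (3 / 2 * \<eta>)\<^sup>2" unfolding power_mult_distrib by (simp add: power2_eq_square)
  finally have Y: "\<bar>?Y\<bar> \<le> 3 / 2 * \<eta>" using \<eta> abs_le_square_iff[of ?Y "3 / 2 * \<eta>"] by simp
  define x where "x = max (-1) (min 1 ?X)"
  have x: "-1 \<le> x" "x \<le> 1" "\<bar>?X - x\<bar> \<le> \<eta> / 2" using X \<eta> unfolding x_def by linarith+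
  define M where "M = max (cmod a) (cmod b)"
  have "from_unit a b (of_real x) = (1 - (1 + x) / 2) *\<^sub>R a + ((1 + x) / 2) *\<^sub>R b"
    by (simp add: from_unit_def complex_eq_iff field_simps)
  also have "cmod \<dots> \<le> (1 - (1 + x) / 2) * cmod a + ((1 + x) / 2) * cmod b"
    using x by (intro order_trans[OF norm_triangle_ineq]) (simp add: abs_if)
  also have "\<dots> \<le> (1 - (1 + x) / 2) * M + ((1 + x) / 2) * M"
    using x unfolding M_def by (intro add_mono mult_left_mono) auto
  also have "\<dots> = M" by (simp add: algebra_simps)
  finally have 1: "cmod (from_unit a b (of_real x)) \<le> M" .
  have "cmod (\<zeta> - of_real x) \<le> \<bar>?X - x\<bar> + \<bar>?Y\<bar>" using cmod_le[of "\<zeta> - of_real x"] by simp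
  also have "\<dots> \<le> 2 * \<eta>" using x(3) Y by linarith
  finally have 2: "cmod (\<zeta> - of_real x) \<le> 2 * \<eta>" .
  have "cmod (b - a) \<le> cmod b + cmod a" by (rule norm_triangle_ineq4)
  then have d: "cmod ((b - a) / 2) \<le> 1" using ab by (simp add: norm_divide)
  have "from_unit a b \<zeta> = from_unit a b (of_real x) + (b - a) / 2 * (\<zeta> - of_real x)"
    unfolding from_unit_def right_diff_distrib by simp
  then have "cmod (from_unit a b \<zeta>) \<le> M + cmod ((b - a) / 2) * cmod (\<zeta> - of_real x)"
    using 1 norm_triangle_ineq[of "from_unit a b (of_real x)" "(b - a) / 2 * (\<zeta> - of_real x)"]
    unfolding norm_mult by simp
  also have "\<dots> \<le> M + 1 * (2 * \<eta>)" by (intro add_left_mono mult_mono d 2) (use \<eta> in auto)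
  also have "\<dots> \<le> M + (1 - M\<^sup>2) / 2" using room unfolding M_def max_def by auto
  also have "\<dots> < 1"
  proof -
    have "M < 1" "M \<ge> 0" using ab by (auto simp: M_def le_max_iff_disj)
    then have "(1 - M) * (1 + M) < (1 - M) * 2" by (intro mult_strict_left_mono) auto
    then have "2 * M + (1 - M\<^sup>2) < 2" by (simp add: power2_eq_square algebra_simps)
    then have "(2 * M + (1 - M\<^sup>2)) / 2 < 1" by simp
    then show ?thesis unfolding add_divide_distrib by simp
  qed
  finally show ?thesis .
qed

lemma twist_homeomorphism:
  assumes ab: "cmod a < 1" "cmod b < 1" "a \<noteq> b" and \<eta>: "0 < \<eta>" "\<eta> \<le> 1"
    and room: "\<eta> \<le> (1 - (cmod a)\<^sup>2) / 4" "\<eta> \<le> (1 - (cmod b)\<^sup>2) / 4"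
  shows "homeomorphism (cball 0 1) (cball 0 1) (twist a b \<eta> u) (twist a b \<eta> (- u))"
    and "cmod z = 1 \<Longrightarrow> twist a b \<eta> u z = z"
proof -
  have outside: "twist a b \<eta> v z = z" if "cmod z \<ge> 1" for v z
  proof (rule twist_outside[OF \<eta>(1) ab(3)], rule ccontr)
    assume "\<not> 1 + \<eta> \<le> (cmod (stretch (1 / \<eta>) (to_unit a b z)))\<^sup>2"
    then have "cmod (from_unit a b (to_unit a b z)) < 1"
      by (intro ellipse_in_ball[OF ab(1,2) \<eta> room]) simp
    then show False using that from_to_unit[OF ab(3)] by simp
  qed
  show "cmod z = 1 \<Longrightarrow> twist a b \<eta> u z = z" using outside by simp
  have inv: "twist a b \<eta> (- v) (twist a b \<eta> v z) = z" for v z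
    using twist_inverse ab(3) \<eta>(1) by simp
  have maps: "twist a b \<eta> v z \<in> cball 0 1" if "z \<in> cball 0 1" for v z
  proof (rule ccontr)
    assume *: "twist a b \<eta> v z \<notin> cball 0 1"
    then have "twist a b \<eta> (- v) (twist a b \<eta> v z) = twist a b \<eta> v z"
      by (intro outside) simp
    then show False using inv[of v z] that * by simp
  qed
  have "twist a b \<eta> v ` cball 0 1 = cball 0 1" for v
  proof
    show "twist a b \<eta> v ` cball 0 1 \<subseteq> cball 0 1" using maps by blast
    show "cball 0 1 \<subseteq> twist a b \<eta> v ` cball 0 1"
    proof
      fix z :: complex assume "z \<in> cball 0 1"
      then show "z \<in> twist a b \<eta> v ` cball 0 1"
        using inv[of "- v" z] maps[of z "- v"] by (intro image_eqI[of _ _ "twist a b \<eta> (- v) z"]) simp_all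
    qed
  qed
  then show "homeomorphism (cball 0 1) (cball 0 1) (twist a b \<eta> u) (twist a b \<eta> (- u))"
    unfolding homeomorphism_def using inv[of u] inv[of "- u"] \<eta>(1) ab(3)
    by (auto intro!: continuous_intros)
qed

section \<open>Twisting along a chain of points\<close>

text \<open>The reciprocal of a sum of reciprocals is a common lower bound that needs no case distinctions:
  the two end points of the segment have gap 0, and their terms vanish by the convention \<open>1 / 0 = 0\<close>.\<close>

definition clearance :: "nat \<Rightarrow> (nat \<Rightarrow> complex) \<Rightarrow> nat \<Rightarrow> real" where
  "clearance N r i = 1 / (1 + (\<Sum>j<N. 1 / gap (r (i - 1)) (r i) (r j) + 4 / (1 - (cmod (r j))\<^sup>2)))"

definition letter_twist :: "nat \<Rightarrow> (nat \<Rightarrow> complex) \<Rightarrow> int \<Rightarrow> real \<Rightarrow> complex \<Rightarrow> complex" where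
  "letter_twist N r k t =
     twist (r (nat \<bar>k\<bar> - 1)) (r (nat \<bar>k\<bar>)) (clearance N r (nat \<bar>k\<bar>)) (of_int (sgn k) * t)"

locale lex_chain =
  fixes N :: nat and r :: "nat \<Rightarrow> complex"
  assumes sorted: "\<And>i j. i < j \<Longrightarrow> j < N \<Longrightarrow> lex_less (r i) (r j)"
    and in_ball: "\<And>j. j < N \<Longrightarrow> cmod (r j) < 1"

lemma lex_less_closed_segment:
  assumes "x \<in> closed_segment a b" "lex_less a c" "lex_less b c"
  shows "lex_less x c"
proof -
  obtain s where s: "0 \<le> s" "s \<le> 1" and x: "x = (1 - s) *\<^sub>R a + s *\<^sub>R b"
    using assms(1) unfolding closed_segment_def by auto
  have "(1 - s) *\<^sub>R c + s *\<^sub>R c = c" by (simp add: scaleR_left_diff_distrib)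
  then show ?thesis using lex_less_convex[OF assms(2,3) s] unfolding x by simp
qed

lemma lex_less_closed_segment':
  assumes "x \<in> closed_segment a b" "lex_less c a" "lex_less c b"
  shows "lex_less c x"
proof -
  obtain s where s: "0 \<le> s" "s \<le> 1" and x: "x = (1 - s) *\<^sub>R a + s *\<^sub>R b"
    using assms(1) unfolding closed_segment_def by auto
  have "(1 - s) *\<^sub>R c + s *\<^sub>R c = c" by (simp add: scaleR_left_diff_distrib)
  then show ?thesis using lex_less_convex[OF assms(2,3) s] unfolding x by simp
qed

lemma letter_perm_simps:
  "letter_perm k (nat \<bar>k\<bar> - 1) = nat \<bar>k\<bar>" "letter_perm k (nat \<bar>k\<bar>) = nat \<bar>k\<bar> - 1"
  "j \<noteq> nat \<bar>k\<bar> - 1 \<Longrightarrow> j \<noteq> nat \<bar>k\<bar> \<Longrightarrow> letter_perm k j = j"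
  by (simp_all add: letter_perm_def)

context lex_chain
begin

lemma distinct_points: "i < N \<Longrightarrow> j < N \<Longrightarrow> i \<noteq> j \<Longrightarrow> r i \<noteq> r j"
  using sorted[of i j] sorted[of j i] lex_less_irrefl[of "r i"] by (cases "i < j") auto

lemma inj_points: "inj_on r {..<N}"
  using distinct_points by (auto simp: inj_on_def)

lemma points_in_disc: "j < N \<Longrightarrow> r j \<in> cball 0 1"
  using in_ball[of j] by simp

text \<open>Any other point is below both ends or above both ends, hence below or above the whole segment.\<close>

lemma neighbours_segment:
  assumes "0 < i" "i < N" "j < N" "j \<noteq> i - 1" "j \<noteq> i"
  shows "r j \<notin> closed_segment (r (i - 1)) (r i)"
proof
  assume *: "r j \<in> closed_segment (r (i - 1)) (r i)"
  consider "j < i - 1" | "i < j" using assms by linarith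
  then show False
  proof cases
    case 1
    then have "lex_less (r j) (r j)"
      using assms by (intro lex_less_closed_segment'[OF *] sorted) auto
    then show False using lex_less_irrefl by blast
  next
    case 2
    then have "lex_less (r j) (r j)"
      using assms by (intro lex_less_closed_segment[OF *] sorted) auto
    then show False using lex_less_irrefl by blast
  qed
qed

lemma gap_nonneg:
  assumes "0 < i" "i < N" "j < N"
  shows "gap (r (i - 1)) (r i) (r j) \<ge> 0"
    and "j \<noteq> i - 1 \<Longrightarrow> j \<noteq> i \<Longrightarrow> gap (r (i - 1)) (r i) (r j) > 0"
proof -
  have ne: "r (i - 1) \<noteq> r i" using distinct_points[of "i - 1" i] assms by simp
  show *: "j \<noteq> i - 1 \<Longrightarrow> j \<noteq> i \<Longrightarrow> gap (r (i - 1)) (r i) (r j) > 0"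
    using gap_pos[OF ne] neighbours_segment assms by blast
  show "gap (r (i - 1)) (r i) (r j) \<ge> 0"
    using * gap_ends[OF ne] by (cases "j = i - 1 \<or> j = i") auto
qed

lemma in_ball_sq: "j < N \<Longrightarrow> 1 - (cmod (r j))\<^sup>2 > 0"
  using in_ball[of j] by (simp add: abs_square_less_1)

lemma clearance_terms:
  assumes i: "0 < i" "i < N" and j: "j < N"
  shows "1 / gap (r (i - 1)) (r i) (r j) \<ge> 0" "4 / (1 - (cmod (r j))\<^sup>2) > 0"
  using gap_nonneg(1)[OF i j] in_ball_sq[OF j] by simp_all

lemma clearance_ge:
  assumes i: "0 < i" "i < N" and j: "j < N"
  shows "1 / gap (r (i - 1)) (r i) (r j) + 4 / (1 - (cmod (r j))\<^sup>2) \<le>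
           1 / clearance N r i"
proof -
  let ?s = "\<lambda>j. 1 / gap (r (i - 1)) (r i) (r j) + 4 / (1 - (cmod (r j))\<^sup>2)"
  have nn: "0 \<le> ?s j" if "j < N" for j
    using clearance_terms[OF i that] by linarith
  have "?s j \<le> (\<Sum>j<N. ?s j)"
    by (rule member_le_sum) (use j nn in auto)
  then show ?thesis by (simp add: clearance_def)
qed

lemma clearance_bounds:
  assumes i: "0 < i" "i < N"
  shows "0 < clearance N r i" "clearance N r i \<le> 1"
proof -
  let ?s = "\<lambda>j. 1 / gap (r (i - 1)) (r i) (r j) + 4 / (1 - (cmod (r j))\<^sup>2)"
  have nn: "0 \<le> ?s j" if "j < N" for j
    using clearance_terms[OF i that] by linarith
  have "0 \<le> (\<Sum>j<N. ?s j)" using nn by (intro sum_nonneg) auto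
  then show "0 < clearance N r i" "clearance N r i \<le> 1" unfolding clearance_def by simp_all
qed

lemma clearance_gap:
  assumes i: "0 < i" "i < N" and j: "j < N" "j \<noteq> i - 1" "j \<noteq> i"
  shows "clearance N r i \<le> gap (r (i - 1)) (r i) (r j)"
proof -
  have "1 / gap (r (i - 1)) (r i) (r j) \<le> 1 / clearance N r i"
    using clearance_ge[OF i j(1)] clearance_terms[OF i j(1)] by linarith
  then show ?thesis using clearance_bounds[OF i] gap_nonneg(2)[OF i j] by (simp add: field_simps)
qed

lemma clearance_room:
  assumes i: "0 < i" "i < N" and j: "j < N"
  shows "clearance N r i \<le> (1 - (cmod (r j))\<^sup>2) / 4"
proof -
  have "4 / (1 - (cmod (r j))\<^sup>2) \<le> 1 / clearance N r i"
    using clearance_ge[OF i j] clearance_terms[OF i j] by linarith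
  then show ?thesis using clearance_bounds[OF i] in_ball_sq[OF j] by (simp add: field_simps)
qed

lemma neighbours_distinct: "0 < i \<Longrightarrow> i < N \<Longrightarrow> r (i - 1) \<noteq> r i"
  using distinct_points[of "i - 1" i] by simp

context
  fixes k :: int
  assumes k: "k \<noteq> 0" "\<bar>k\<bar> < int N"
begin

lemma letter_index: "0 < nat \<bar>k\<bar>" "nat \<bar>k\<bar> < N" "nat \<bar>k\<bar> - 1 < N" "nat \<bar>k\<bar> - 1 \<noteq> nat \<bar>k\<bar>"
  using k by auto

lemma letter_twist_homeomorphism:
  "homeomorphism (cball 0 1) (cball 0 1) (letter_twist N r k t) (letter_twist N r k (- t))"
  "cmod z = 1 \<Longrightarrow> letter_twist N r k t z = z"
proof -
  let ?i = "nat \<bar>k\<bar>"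
  note facts = in_ball[OF letter_index(3)] in_ball[OF letter_index(2)] neighbours_distinct[OF letter_index(1,2)]
    clearance_bounds[OF letter_index(1,2)] clearance_room[OF letter_index(1,2) letter_index(3)]
    clearance_room[OF letter_index(1,2) letter_index(2)]
  show "homeomorphism (cball 0 1) (cball 0 1) (letter_twist N r k t) (letter_twist N r k (- t))"
    using twist_homeomorphism(1)[OF facts] by (simp add: letter_twist_def)
  show "cmod z = 1 \<Longrightarrow> letter_twist N r k t z = z"
    using twist_homeomorphism(2)[OF facts] by (simp add: letter_twist_def)
qed

lemma letter_twist_0: "letter_twist N r k 0 z = z"
  using twist_0 clearance_bounds[OF letter_index(1,2)] neighbours_distinct[OF letter_index(1,2)]
  by (simp add: letter_twist_def)

lemma continuous_on_letter_twist:
  "continuous_on S u \<Longrightarrow> continuous_on S f \<Longrightarrow> continuous_on S (\<lambda>x. letter_twist N r k (u x) (f x))"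
  unfolding letter_twist_def
  using clearance_bounds[OF letter_index(1,2)] neighbours_distinct[OF letter_index(1,2)]
  by (intro continuous_intros) auto

lemma letter_twist_isotopy: "isotopy_from_id (\<lambda>(t, z). letter_twist N r k t z) (letter_twist N r k 1)"
  unfolding isotopy_from_id_def case_prod_beta fst_conv snd_conv
  using letter_twist_homeomorphism letter_twist_0
  by (auto intro!: continuous_on_letter_twist continuous_intros)

lemma letter_twist_other:
  assumes "j < N" "j \<noteq> nat \<bar>k\<bar> - 1" "j \<noteq> nat \<bar>k\<bar>"
  shows "letter_twist N r k t (r j) = r j"
  unfolding letter_twist_def
  by (rule twist_outside gap_outside clearance_bounds clearance_gap neighbours_distinct letter_index assms)+

lemma letter_twist_ends:
  "letter_twist N r k t (r (nat \<bar>k\<bar> - 1)) =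
     from_unit (r (nat \<bar>k\<bar> - 1)) (r (nat \<bar>k\<bar>)) (- stretch (clearance N r (nat \<bar>k\<bar>)) (turn (of_int (sgn k) * t)))"
  "letter_twist N r k t (r (nat \<bar>k\<bar>)) =
     from_unit (r (nat \<bar>k\<bar> - 1)) (r (nat \<bar>k\<bar>)) (stretch (clearance N r (nat \<bar>k\<bar>)) (turn (of_int (sgn k) * t)))"
  unfolding letter_twist_def
  by (rule twist_ends clearance_bounds neighbours_distinct letter_index)+

lemma letter_perm_less: "j < N \<Longrightarrow> letter_perm k j < N"
  using letter_index letter_perm_simps by metis

lemma letter_twist_perm:
  assumes "j < N"
  shows "letter_twist N r k 1 (r j) = r (letter_perm k j)"
proof -
  have "turn (of_int (sgn k) * 1) = -1" using k by (cases "k > 0") (auto simp: sgn_if)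
  moreover have "stretch e (-1) = -1" for e by (simp add: complex_eq_iff)
  ultimately have swap: "letter_twist N r k 1 (r (nat \<bar>k\<bar> - 1)) = r (nat \<bar>k\<bar>)"
    "letter_twist N r k 1 (r (nat \<bar>k\<bar>)) = r (nat \<bar>k\<bar> - 1)"
    unfolding letter_twist_ends by simp_all
  show ?thesis
  proof (cases "j = nat \<bar>k\<bar> - 1 \<or> j = nat \<bar>k\<bar>")
    case True
    then show ?thesis by (elim disjE) (simp_all only: swap letter_perm_simps)
  next
    case False
    then show ?thesis using letter_twist_other[OF assms, of 1] letter_perm_simps(3)[of j] by presburger
  qed
qed

end

end

section \<open>Concatenating isotopies\<close>

definition isotopy_join ::
    "(real \<times> complex \<Rightarrow> complex) \<Rightarrow> (real \<times> complex \<Rightarrow> complex) \<Rightarrow> real \<times> complex \<Rightarrow> complex" where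
  "isotopy_join h1 h2 = (\<lambda>(t, z). if t \<le> 1 / 2 then h1 (2 * t, z) else h2 (2 * t - 1, h1 (1, z)))"

lemma isotopy_join_path:
  "(\<lambda>t. isotopy_join h1 h2 (t, z)) = (\<lambda>t. h1 (t, z)) +++ (\<lambda>t. h2 (t, h1 (1, z)))"
  by (simp add: isotopy_join_def joinpaths_def fun_eq_iff)

lemma isotopy_from_id_join:
  assumes h1: "isotopy_from_id h1 f1" and h2: "isotopy_from_id h2 f2"
  shows "isotopy_from_id (isotopy_join h1 h2) (f2 \<circ> f1)"
proof -
  obtain g1 where g1: "homeomorphism (cball 0 1) (cball 0 1) f1 g1"
    using h1 by (rule isotopy_from_id_homeomorphism)
  have f1: "f1 z \<in> cball 0 1" if "z \<in> cball 0 1" for z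
    using homeomorphism_image1[OF g1] that by blast
  have c1: "continuous_on ({0..1} \<times> cball 0 1) h1" and c2: "continuous_on ({0..1} \<times> cball 0 1) h2"
    using h1 h2 by (auto simp: isotopy_from_id_def)
  have h1_1: "h1 (1, z) = f1 z" if "z \<in> cball 0 1" for z
    using h1 that by (auto simp: isotopy_from_id_def)
  have h2_0: "h2 (0, z) = z" if "z \<in> cball 0 1" for z
    using h2 that by (auto simp: isotopy_from_id_def)
  have h2_1: "h2 (1, z) = f2 z" if "z \<in> cball 0 1" for z
    using h2 that by (auto simp: isotopy_from_id_def)
  have h1_0: "h1 (0, z) = z" if "z \<in> cball 0 1" for z
    using h1 that by (auto simp: isotopy_from_id_def)
  have split: "{0..1::real} \<times> cball (0::complex) 1 = {0..1/2} \<times> cball 0 1 \<union> {1/2..1} \<times> cball 0 1"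
    by auto
  have "continuous_on ({0..1} \<times> cball 0 1) (\<lambda>y. if fst y \<le> 1 / 2 then h1 (2 * fst y, snd y) else h2 (2 * fst y - 1, h1 (1, snd y)))"
    unfolding split
  proof (rule continuous_on_cases)
    show "closed ({0..1 / 2::real} \<times> cball (0::complex) 1)" "closed ({1 / 2..1::real} \<times> cball (0::complex) 1)"
      by (intro closed_Times; simp)+
    show "continuous_on ({0..1 / 2} \<times> cball 0 1) (\<lambda>y. h1 (2 * fst y, snd y))"
      by (rule continuous_on_compose2[OF c1]) (auto intro!: continuous_intros)
    have "continuous_on ({1 / 2..1::real} \<times> cball 0 1) (\<lambda>y. h1 (1, snd y))"
      by (rule continuous_on_compose2[OF c1]) (auto intro!: continuous_intros)
    then show "continuous_on ({1 / 2..1} \<times> cball 0 1) (\<lambda>y. h2 (2 * fst y - 1, h1 (1, snd y)))"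
      by (intro continuous_on_compose2[OF c2] continuous_intros)
        (use f1 h1_1 in \<open>auto simp del: mem_cball\<close>)
    show "\<forall>y. y \<in> {0..1 / 2} \<times> cball 0 1 \<and> \<not> fst y \<le> 1 / 2 \<or> y \<in> {1 / 2..1} \<times> cball 0 1 \<and> fst y \<le> 1 / 2 \<longrightarrow>
        h1 (2 * fst y, snd y) = h2 (2 * fst y - 1, h1 (1, snd y))"
    proof (intro allI impI)
      fix y :: "real \<times> complex"
      assume "y \<in> {0..1 / 2} \<times> cball 0 1 \<and> \<not> fst y \<le> 1 / 2 \<or> y \<in> {1 / 2..1} \<times> cball 0 1 \<and> fst y \<le> 1 / 2"
      then have y: "fst y = 1 / 2" "snd y \<in> cball 0 1" by (auto simp: mem_Times_iff)
      have "h2 (0, h1 (1, snd y)) = h1 (1, snd y)" unfolding h1_1[OF y(2)] by (rule h2_0[OF f1[OF y(2)]])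
      then show "h1 (2 * fst y, snd y) = h2 (2 * fst y - 1, h1 (1, snd y))" unfolding y(1) by simp
    qed
  qed
  then have 1: "continuous_on ({0..1} \<times> cball 0 1) (isotopy_join h1 h2)"
    unfolding isotopy_join_def case_prod_beta .
  have 2: "\<exists>g. homeomorphism (cball 0 1) (cball 0 1) (\<lambda>z. isotopy_join h1 h2 (t, z)) g" if t: "t \<in> {0..1}" for t
  proof (cases "t \<le> 1 / 2")
    case True
    then have "2 * t \<in> {0..1}" using t by auto
    then show ?thesis using h1 True unfolding isotopy_from_id_def isotopy_join_def by simp
  next
    case False
    then have "2 * t - 1 \<in> {0..1}" using t by auto
    then obtain g where "homeomorphism (cball 0 1) (cball 0 1) (\<lambda>z. h2 (2 * t - 1, z)) g"
      using h2 unfolding isotopy_from_id_def by blast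
    from homeomorphism_compose[OF g1 this]
    have "homeomorphism (cball 0 1) (cball 0 1) (\<lambda>z. isotopy_join h1 h2 (t, z)) (g1 \<circ> g)"
      by (rule homeomorphism_cong) (use False h1_1 in \<open>simp_all add: isotopy_join_def\<close>)
    then show ?thesis by (intro exI)
  qed
  have 3: "isotopy_join h1 h2 (0, z) = z" "isotopy_join h1 h2 (1, z) = (f2 \<circ> f1) z" if "z \<in> cball 0 1" for z
    using h1_0[OF that] h2_1[OF f1[OF that]] h1_1[OF that] unfolding isotopy_join_def by simp_all
  show ?thesis unfolding isotopy_from_id_def by (intro conjI ballI 1 2 3)
qed

primrec word_isotopy :: "nat \<Rightarrow> (nat \<Rightarrow> complex) \<Rightarrow> int list \<Rightarrow> real \<times> complex \<Rightarrow> complex" where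
  "word_isotopy N r [] = snd"
| "word_isotopy N r (k # w) = isotopy_join (\<lambda>(t, z). letter_twist N r k t z) (word_isotopy N r w)"

primrec word_map :: "nat \<Rightarrow> (nat \<Rightarrow> complex) \<Rightarrow> int list \<Rightarrow> complex \<Rightarrow> complex" where
  "word_map N r [] = id"
| "word_map N r (k # w) = word_map N r w \<circ> letter_twist N r k 1"

text \<open>Strands are followed forward in time, which makes this the inverse of \<open>word_perm\<close>.\<close>

primrec end_position :: "int list \<Rightarrow> nat \<Rightarrow> nat" where
  "end_position [] = id"
| "end_position (k # w) = end_position w \<circ> letter_perm k"

lemma word_perm_end_position: "word_perm w (end_position w j) = j"
proof (induction w arbitrary: j)
  case (Cons k w)
  then show ?case by (simp add: letter_perm_def)
qed simp

lemma braid_word_Cons [simp]: "braid_word n (k # w) \<longleftrightarrow> k \<noteq> 0 \<and> \<bar>k\<bar> < int n \<and> braid_word n w"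
  and braid_word_Nil [simp]: "braid_word n []"
  by (auto simp: braid_word_def)

lemma end_position_append: "end_position (u @ v) = end_position v \<circ> end_position u"
  by (induction u) auto

lemma word_map_append: "word_map N r (u @ v) = word_map N r v \<circ> word_map N r u"
  by (induction u) (auto simp: o_assoc)

context lex_chain
begin

lemma word_isotopy: "braid_word N w \<Longrightarrow> isotopy_from_id (word_isotopy N r w) (word_map N r w)"
proof (induction w)
  case Nil
  show ?case
    unfolding isotopy_from_id_def by (auto intro!: continuous_intros intro: exI[of _ id] simp: homeomorphism_ident id_def)
next
  case (Cons k w)
  then show ?case
    using isotopy_from_id_join[OF letter_twist_isotopy, of k "word_isotopy N r w" "word_map N r w"] by (simp add: o_def)
qed

lemma word_map_sphere: "braid_word N w \<Longrightarrow> cmod z = 1 \<Longrightarrow> word_map N r w z = z"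
  by (induction w) (auto simp: letter_twist_homeomorphism(2))

lemma word_map_point: "braid_word N w \<Longrightarrow> j < N \<Longrightarrow> word_map N r w (r j) = r (end_position w j)"
  by (induction w arbitrary: j) (auto simp: letter_twist_perm letter_perm_less)

end

section \<open>The linking number of two groups of strands\<close>

lemma isotopy_difference_path:
  assumes h: "isotopy_from_id h f" and xy: "x \<in> cball 0 1" "y \<in> cball 0 1" "x \<noteq> y"
  shows "path (\<lambda>t. h (t, x) - h (t, y))" "0 \<notin> path_image (\<lambda>t. h (t, x) - h (t, y))"
proof -
  have cont: "continuous_on ({0..1} \<times> cball 0 1) h" using h by (simp add: isotopy_from_id_def)
  have c: "continuous_on {0..1} (\<lambda>t. h (t, z))" if "z \<in> cball 0 1" for z
    by (rule continuous_on_compose2[OF cont]) (use that in \<open>auto intro!: continuous_intros\<close>)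
  show "path (\<lambda>t. h (t, x) - h (t, y))"
    unfolding path_def by (rule continuous_on_diff[OF c[OF xy(1)] c[OF xy(2)]])
  have "h (t, x) \<noteq> h (t, y)" if "t \<in> {0..1}" for t
    using inj_onD[OF isotopy_from_id_inj[OF h that], of x y] xy by blast
  then show "0 \<notin> path_image (\<lambda>t. h (t, x) - h (t, y))" unfolding path_image_def by force
qed

definition strand_winding :: "(real \<times> complex \<Rightarrow> complex) \<Rightarrow> complex \<Rightarrow> complex \<Rightarrow> complex" where
  "strand_winding h x y = winding_number (\<lambda>t. h (t, x) - h (t, y)) 0"

lemma strand_winding_join:
  assumes h1: "isotopy_from_id h1 f1" and h2: "isotopy_from_id h2 f2"
    and xy: "x \<in> cball 0 1" "y \<in> cball 0 1" "x \<noteq> y"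
  shows "strand_winding (isotopy_join h1 h2) x y = strand_winding h1 x y + strand_winding h2 (f1 x) (f1 y)"
proof -
  obtain g1 where g1: "homeomorphism (cball 0 1) (cball 0 1) f1 g1"
    using h1 by (rule isotopy_from_id_homeomorphism)
  have f1: "f1 x \<in> cball 0 1" "f1 y \<in> cball 0 1" using homeomorphism_image1[OF g1] xy by blast+
  have ne: "f1 x \<noteq> f1 y" using homeomorphism_apply1[OF g1] xy by metis
  have h1_1: "h1 (1, x) = f1 x" "h1 (1, y) = f1 y" and h2_0: "h2 (0, f1 x) = f1 x" "h2 (0, f1 y) = f1 y"
    using h1 h2 xy f1 by (simp_all add: isotopy_from_id_def)
  have eq: "(\<lambda>t. isotopy_join h1 h2 (t, x) - isotopy_join h1 h2 (t, y)) =
      (\<lambda>t. h1 (t, x) - h1 (t, y)) +++ (\<lambda>t. h2 (t, f1 x) - h2 (t, f1 y))"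
    by (auto simp: isotopy_join_def joinpaths_def fun_eq_iff h1_1)
  show ?thesis unfolding strand_winding_def eq
    by (intro winding_number_join isotopy_difference_path[OF h1] isotopy_difference_path[OF h2] xy f1 ne)
       (simp add: pathfinish_def pathstart_def h1_1 h2_0)
qed

text \<open>Two points that exchange their places trace, together, a closed loop in the convex set.\<close>

lemma convex_exchange_winding:
  assumes C: "convex C" "x \<notin> C" and ab: "path a" "path b" "path_image a \<subseteq> C" "path_image b \<subseteq> C"
    and ends: "pathfinish a = pathstart b" "pathfinish b = pathstart a"
  shows "winding_number (\<lambda>t. a t - x) 0 + winding_number (\<lambda>t. b t - x) 0 = 0"
    and "winding_number (\<lambda>t. x - a t) 0 + winding_number (\<lambda>t. x - b t) 0 = 0"
proof -
  have loop: "winding_number (\<lambda>t. g (a t)) 0 + winding_number (\<lambda>t. g (b t)) 0 = 0"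
    if g: "continuous_on UNIV g" "convex (g ` C)" "0 \<notin> g ` C" for g :: "complex \<Rightarrow> complex"
  proof -
    have p: "path (\<lambda>t. g (a t))" "path (\<lambda>t. g (b t))"
      using ab(1,2) unfolding path_def by (auto intro!: continuous_on_compose2[OF g(1)])
    have i: "path_image (\<lambda>t. g (a t)) \<subseteq> g ` C" "path_image (\<lambda>t. g (b t)) \<subseteq> g ` C"
      using ab(3,4) unfolding path_image_def by auto
    have e: "pathfinish (\<lambda>t. g (a t)) = pathstart (\<lambda>t. g (b t))" "pathfinish (\<lambda>t. g (b t)) = pathstart (\<lambda>t. g (a t))"
      using ends by (simp_all add: pathfinish_def pathstart_def)
    have "winding_number ((\<lambda>t. g (a t)) +++ (\<lambda>t. g (b t))) 0 = 0"
      by (rule winding_number_zero_outside[OF _ g(2) _ g(3)]) (use p i e in \<open>auto simp: path_image_join\<close>)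
    then show ?thesis using p i e g(3) by (subst (asm) winding_number_join) auto
  qed
  have "(\<lambda>z. z - x) ` C = (\<lambda>z. -x + z) ` C" by (simp add: algebra_simps)
  then have "convex ((\<lambda>z. z - x) ` C)" using C(1) convex_translation_eq by metis
  then show "winding_number (\<lambda>t. a t - x) 0 + winding_number (\<lambda>t. b t - x) 0 = 0"
    by (intro loop) (use C(2) in \<open>auto intro!: continuous_intros\<close>)
  have "(\<lambda>z. x - z) ` C = (\<lambda>z. x + z) ` uminus ` C" by (simp add: image_image)
  then have "convex ((\<lambda>z. x - z) ` C)" using C(1) convex_translation_eq convex_negations by metis
  then show "winding_number (\<lambda>t. x - a t) 0 + winding_number (\<lambda>t. x - b t) 0 = 0"
    by (intro loop) (use C(2) in \<open>auto intro!: continuous_intros\<close>)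
qed

text \<open>Multiplied by \<open>-\<i>\<close>, the upper half of the ellipse avoids the cut of the principal logarithm.\<close>

lemma winding_number_half_ellipse:
  assumes "\<eta> > 0" "d \<noteq> 0"
  shows "winding_number (\<lambda>t. d * stretch \<eta> (turn t)) 0 = 1 / 2"
proof -
  define g where "g t = Ln (- \<i> * stretch \<eta> (turn t)) + Ln (\<i> * d)" for t
  have nonneg: "- \<i> * stretch \<eta> (turn t) \<notin> \<real>\<^sub>\<le>\<^sub>0" if "t \<in> {0..1}" for t
  proof
    assume "- \<i> * stretch \<eta> (turn t) \<in> \<real>\<^sub>\<le>\<^sub>0"
    then have *: "\<eta> * Im (turn t) \<le> 0" "Re (turn t) = 0" by (auto simp: complex_nonpos_Reals_iff)
    have "(Re (turn t))\<^sup>2 + (Im (turn t))\<^sup>2 = 1" using cmod_power2[of "turn t"] by simp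
    then have "Im (turn t) \<noteq> 0" using * by auto
    moreover have "Im (turn t) \<ge> 0"
      using that turn_denom_pos[of t] unfolding Im_turn by auto
    ultimately show False using * assms(1) by (simp add: mult_le_0_iff)
  qed
  have "2 * pi * \<i> * winding_number (\<lambda>t. d * stretch \<eta> (turn t)) 0 = g 1 - g 0"
  proof (rule winding_number_eq_log)
    show "continuous_on {0..1} g" unfolding g_def
      using nonneg by (intro continuous_intros) auto
    show "exp (g t) = d * stretch \<eta> (turn t)" if "t \<in> {0..1}" for t
    proof -
      have "stretch \<eta> (turn t) \<noteq> 0" using nonneg[OF that] by auto
      then show ?thesis unfolding g_def exp_add using assms(2) by (simp add: mult_ac)
    qed
  qed
  also have "g 1 - g 0 = Ln \<i> - Ln (- \<i>)"
  proof -
    have "stretch \<eta> 1 = 1" "stretch \<eta> (-1) = -1" by (simp_all add: complex_eq_iff)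
    then show ?thesis by (simp add: g_def)
  qed
  also have "\<dots> = \<i> * pi" by (simp add: field_simps)
  finally have "2 * pi * \<i> * winding_number (\<lambda>t. d * stretch \<eta> (turn t)) 0 = 2 * pi * \<i> * (1 / 2)" by simp
  then show ?thesis unfolding mult_cancel_left by simp
qed

context lex_chain
begin

context
  fixes k :: int and a b :: nat and L :: "nat \<Rightarrow> nat \<Rightarrow> complex"
  assumes k: "k \<noteq> 0" "\<bar>k\<bar> < int N"
  defines "b \<equiv> nat \<bar>k\<bar>" and "a \<equiv> nat \<bar>k\<bar> - 1"
    and "L \<equiv> \<lambda>i j. strand_winding (\<lambda>(t, z). letter_twist N r k t z) (r i) (r j)"
begin

lemma letter_winding_other:
  assumes "i < N" "j < N" "i \<noteq> j" "i \<noteq> a" "i \<noteq> b" "j \<noteq> a" "j \<noteq> b"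
  shows "L i j = 0"
proof -
  have "(\<lambda>t. letter_twist N r k t (r i) - letter_twist N r k t (r j)) = (\<lambda>t. r i - r j)"
    using letter_twist_other[OF k] assms unfolding a_def b_def by simp
  moreover have "winding_number (\<lambda>t. r i - r j) 0 = 0"
    using winding_number_eq_log[of "\<lambda>t. Ln (r i - r j)" "\<lambda>t. r i - r j"] distinct_points[OF assms(1,2,3)] by simp
  ultimately show ?thesis unfolding L_def strand_winding_def by simp
qed

lemma letter_winding_exchange:
  assumes j: "j < N" "j \<noteq> a" "j \<noteq> b"
  shows "L a j + L b j = 0" "L j a + L j b = 0"
proof -
  note ab = letter_index[OF k, folded a_def b_def]
  have ne: "r a \<noteq> r b" using distinct_points ab by blast
  define \<eta> where "\<eta> = clearance N r b"
  have \<eta>: "0 < \<eta>" "\<eta> \<le> 1" using clearance_bounds ab unfolding \<eta>_def by blast+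
  define C where "C = from_unit (r a) (r b) ` stretch \<eta> ` cball 0 1"
  define pa pb where "pa t = letter_twist N r k t (r a)" and "pb t = letter_twist N r k t (r b)" for t
  note ends = letter_twist_ends[OF k, folded a_def b_def, folded \<eta>_def]
  have C: "convex C"
  proof -
    have "linear (stretch \<eta>)"
      by (rule linearI) (simp_all add: complex_eq_iff algebra_simps)
    then have 1: "convex (stretch \<eta> ` cball 0 1)" by (rule convex_linear_image) simp
    have 2: "linear (\<lambda>z. (r b - r a) / 2 * z)"
      by (intro bounded_linear.linear bounded_linear_mult_right)
    have "convex ((\<lambda>z. (r a + r b) / 2 + z) ` (\<lambda>z. (r b - r a) / 2 * z) ` stretch \<eta> ` cball 0 1)"
      by (rule convex_translation[OF convex_linear_image[OF 2 1]])
    then show ?thesis unfolding C_def from_unit_def image_image .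
  qed
  have notin: "r j \<notin> C"
  proof
    assume "r j \<in> C"
    then obtain Z where Z: "cmod Z \<le> 1" "r j = from_unit (r a) (r b) (stretch \<eta> Z)"
      unfolding C_def by auto
    have "\<eta> \<le> gap (r a) (r b) (r j)"
      using clearance_gap[OF ab(1,2), folded a_def b_def] j ab unfolding \<eta>_def a_def b_def by simp
    then have "1 + \<eta> \<le> (cmod (stretch (1 / \<eta>) (to_unit (r a) (r b) (r j))))\<^sup>2"
      by (rule gap_outside[OF \<eta>])
    also have "stretch (1 / \<eta>) (to_unit (r a) (r b) (r j)) = Z"
      unfolding Z(2) to_from_unit[OF ne] using \<eta> by (simp add: stretch_inverse)
    also have "(cmod Z)\<^sup>2 \<le> 1" using Z(1) by (simp add: abs_square_le_1)
    finally show False using \<eta> by simp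
  qed
  have path: "path pa" "path pb"
    unfolding pa_def pb_def path_def
    by (intro continuous_on_letter_twist[OF k] continuous_intros)+
  have minus: "- stretch \<eta> z = stretch \<eta> (- z)" for z by (simp add: complex_eq_iff)
  have im: "path_image pa \<subseteq> C" "path_image pb \<subseteq> C"
    unfolding path_image_def pa_def pb_def ends C_def minus by (intro image_subsetI imageI; simp)+
  have ends': "pathfinish pa = pathstart pb" "pathfinish pb = pathstart pa"
    using letter_twist_perm[OF k ab(3)] letter_twist_perm[OF k ab(2)] letter_perm_simps(1,2)[of k, folded a_def b_def]
      letter_twist_0[OF k] unfolding pathfinish_def pathstart_def pa_def pb_def by simp_all
  have fixed: "letter_twist N r k t (r j) = r j" for t
    using letter_twist_other[OF k] j unfolding a_def b_def by simp
  show "L a j + L b j = 0" "L j a + L j b = 0"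
    using convex_exchange_winding[OF C notin path im ends']
    unfolding L_def strand_winding_def pa_def pb_def by (simp_all add: fixed)
qed

lemma letter_winding_half:
  assumes "k > 0"
  shows "L b a = 1 / 2" "L a b = 1 / 2"
proof -
  note ab = letter_index[OF k, folded a_def b_def]
  have ne: "r a \<noteq> r b" using distinct_points ab by blast
  define \<eta> where "\<eta> = clearance N r b"
  have \<eta>: "0 < \<eta>" using clearance_bounds ab unfolding \<eta>_def by blast
  note ends = letter_twist_ends[OF k, folded a_def b_def, folded \<eta>_def]
  have "letter_twist N r k t (r b) - letter_twist N r k t (r a) = (r b - r a) * stretch \<eta> (turn t)"
    "letter_twist N r k t (r a) - letter_twist N r k t (r b) = (r a - r b) * stretch \<eta> (turn t)" for t
    using assms unfolding ends from_unit_def by (simp_all add: field_simps)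
  then show "L b a = 1 / 2" "L a b = 1 / 2"
    unfolding L_def strand_winding_def using winding_number_half_ellipse[OF \<eta>] ne by simp_all
qed

end

lemma sum_two_cancel:
  fixes f :: "'a \<Rightarrow> complex"
  assumes "finite A" "x \<in> A" "y \<in> A" "x \<noteq> y" "f x + f y = 0" "\<And>z. z \<in> A \<Longrightarrow> z \<noteq> x \<Longrightarrow> z \<noteq> y \<Longrightarrow> f z = 0"
  shows "sum f A = 0"
proof -
  have "sum f A = sum f {x, y}"
    by (rule sum.mono_neutral_right) (use assms in auto)
  then show ?thesis using assms(4,5) by simp
qed

definition linking_number :: "nat \<Rightarrow> int list \<Rightarrow> complex" where
  "linking_number m w = (\<Sum>i\<in>{m..<N}. \<Sum>j<m. strand_winding (word_isotopy N r w) (r i) (r j))"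

lemma strand_winding_Cons:
  assumes w: "braid_word N (k # w)" and ij: "i < N" "j < N" "i \<noteq> j"
  shows "strand_winding (word_isotopy N r (k # w)) (r i) (r j) =
     strand_winding (\<lambda>(t, z). letter_twist N r k t z) (r i) (r j) +
     strand_winding (word_isotopy N r w) (r (letter_perm k i)) (r (letter_perm k j))"
proof -
  have k: "k \<noteq> 0" "\<bar>k\<bar> < int N" "braid_word N w" using w by auto
  show ?thesis
    using strand_winding_join[OF letter_twist_isotopy[OF k(1,2)] word_isotopy[OF k(3)], of "r i" "r j"]
      points_in_disc[OF ij(1)] points_in_disc[OF ij(2)] distinct_points[OF ij]
    by (simp add: letter_twist_perm[OF k(1,2)] ij)
qed

text \<open>A letter that moves two strands of the same group lets them exchange their places within a
  convex region that contains no strand of the other group.\<close>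

lemma linking_number_Cons:
  assumes w: "braid_word N (k # w)" and m: "m \<le> N" "nat \<bar>k\<bar> \<noteq> m"
  shows "linking_number m (k # w) = linking_number m w"
proof -
  have k: "k \<noteq> 0" "\<bar>k\<bar> < int N" using w by auto
  define b where "b = nat \<bar>k\<bar>"
  have ab: "0 < b" "b < N" "b - 1 < N" "b - 1 \<noteq> b" "b \<noteq> m" using letter_index[OF k] m unfolding b_def by auto
  define L where "L i j = strand_winding (\<lambda>(t, z). letter_twist N r k t z) (r i) (r j)" for i j
  note other = letter_winding_other[OF k, folded b_def L_def]
    and exchange = letter_winding_exchange[OF k, folded b_def L_def]
  have zero: "(\<Sum>i\<in>{m..<N}. \<Sum>j<m. L i j) = 0"
  proof (cases "m < b")
    case True
    have "(\<Sum>i\<in>{m..<N}. L i j) = 0" if "j < m" for j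
    proof (rule sum_two_cancel[of _ "b - 1" b])
      show "L (b - 1) j + L b j = 0" by (rule exchange(1)) (use True that m in auto)
      show "L z j = 0" if "z \<in> {m..<N}" "z \<noteq> b - 1" "z \<noteq> b" for z
        by (rule other) (use True that \<open>j < m\<close> m in auto)
    qed (use True ab in auto)
    then show ?thesis by (subst sum.swap) simp
  next
    case False
    have "(\<Sum>j<m. L i j) = 0" if "i \<in> {m..<N}" for i
    proof (rule sum_two_cancel[of _ "b - 1" b])
      show "L i (b - 1) + L i b = 0" by (rule exchange(2)) (use False that ab in auto)
      show "L i z = 0" if "z \<in> {..<m}" "z \<noteq> b - 1" "z \<noteq> b" for z
        by (rule other) (use False that \<open>i \<in> {m..<N}\<close> ab m in auto)
    qed (use False ab in auto)
    then show ?thesis by simp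
  qed
  have perm: "letter_perm k i \<in> {m..<N} \<longleftrightarrow> i \<in> {m..<N}" "letter_perm k i < m \<longleftrightarrow> i < m" for i
  proof -
    consider "i = b - 1" | "i = b" | "i \<noteq> b - 1" "i \<noteq> b" by blast
    then show "letter_perm k i \<in> {m..<N} \<longleftrightarrow> i \<in> {m..<N}" "letter_perm k i < m \<longleftrightarrow> i < m"
      using ab letter_perm_simps[where k = k, folded b_def] by (cases; simp; linarith)+
  qed
  have inv: "letter_perm k (letter_perm k i) = i" for i by (simp add: letter_perm_def)
  have "linking_number m (k # w) = (\<Sum>i\<in>{m..<N}. \<Sum>j<m. L i j) +
      (\<Sum>i\<in>{m..<N}. \<Sum>j<m. strand_winding (word_isotopy N r w) (r (letter_perm k i)) (r (letter_perm k j)))"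
    unfolding linking_number_def sum.distrib[symmetric] L_def
    by (intro sum.cong refl strand_winding_Cons[OF w]) (use m in auto)
  also have "(\<Sum>i\<in>{m..<N}. \<Sum>j<m. strand_winding (word_isotopy N r w) (r (letter_perm k i)) (r (letter_perm k j))) =
      (\<Sum>i\<in>{m..<N}. \<Sum>j<m. strand_winding (word_isotopy N r w) (r i) (r j))"
  proof (rule sum.reindex_bij_witness[of _ "letter_perm k" "letter_perm k"])
    fix i assume "i \<in> {m..<N}"
    show "(\<Sum>j<m. strand_winding (word_isotopy N r w) (r (letter_perm k i)) (r j)) =
          (\<Sum>j<m. strand_winding (word_isotopy N r w) (r (letter_perm k i)) (r (letter_perm k j)))"
      by (rule sum.reindex_bij_witness[of _ "letter_perm k" "letter_perm k"]) (simp_all add: inv perm(2))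
  qed (simp_all only: inv perm)
  finally show ?thesis unfolding zero linking_number_def by simp
qed

lemma linking_number_unmixed:
  assumes "braid_word N w" "m \<le> N" "\<forall>k\<in>set w. nat \<bar>k\<bar> \<noteq> m"
  shows "linking_number m w = 0"
  using assms
proof (induction w)
  case Nil
  have "strand_winding snd (r i) (r j) = 0" if "i \<in> {m..<N}" "j < m" for i j
    using winding_number_eq_log[of "\<lambda>t. Ln (r i - r j)" "\<lambda>t. r i - r j"] distinct_points[of i j] that Nil
    unfolding strand_winding_def by auto
  then show ?case unfolding linking_number_def by simp
next
  case (Cons k w)
  then show ?case using linking_number_Cons[of k w m] by simp
qed

text \<open>The pair of strands that is twisted contributes two half turns; every other pair contributes a loop
  within a convex region, or nothing.\<close>

lemma linking_number_full_twist:
  assumes w: "braid_word N w" and m: "0 < m" "m < N"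
  shows "linking_number m (int m # int m # w) = 1 + linking_number m w"
proof -
  have k: "int m \<noteq> 0" "\<bar>int m\<bar> < int N" using m by auto
  have bw: "braid_word N (int m # w)" "braid_word N (int m # int m # w)" using k w by auto
  define L where "L i j = strand_winding (\<lambda>(t, z). letter_twist N r (int m) t z) (r i) (r j)" for i j
  have nat: "nat \<bar>int m\<bar> = m" by simp
  note other = letter_winding_other[OF k, folded L_def, unfolded nat]
    and exchange = letter_winding_exchange[OF k, folded L_def, unfolded nat]
    and half = letter_winding_half[OF k, folded L_def, unfolded nat]
  define \<pi> where "\<pi> = letter_perm (int m)"
  have \<pi>: "\<pi> m = m - 1" "\<pi> (m - 1) = m" "\<And>i. i \<noteq> m - 1 \<Longrightarrow> i \<noteq> m \<Longrightarrow> \<pi> i = i"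
    using letter_perm_simps[where k = "int m", unfolded nat] unfolding \<pi>_def by auto
  have inv: "\<pi> (\<pi> i) = i" for i by (simp add: \<pi>_def letter_perm_def)
  have less: "\<pi> i < N" if "i < N" for i using letter_perm_less[OF k that] unfolding \<pi>_def .
  have pair: "L i j + L (\<pi> i) (\<pi> j) = (if i = m then if j = m - 1 then 1 else 0 else 0)"
    if "i \<in> {m..<N}" "j < m" for i j
  proof -
    have ij: "i < N" "j < N" "i \<noteq> j" "m \<le> i" "j < m" "i \<noteq> m - 1" "j \<noteq> m" using that m by auto
    show ?thesis
    proof (cases "i = m")
      case im: True
      show ?thesis
      proof (cases "j = m - 1")
        case True
        have "int m > 0" using m by simp
        have "L m (m - 1) + L (m - 1) m = 1"
          unfolding half(1)[OF \<open>int m > 0\<close>] half(2)[OF \<open>int m > 0\<close>] by simp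
        then show ?thesis unfolding im True \<pi>(1,2) by simp
      next
        case False
        then show ?thesis using im exchange(1)[of j] ij \<pi>(1) \<pi>(3)[of j] by (simp add: add.commute)
      qed
    next
      case im: False
      show ?thesis
      proof (cases "j = m - 1")
        case True
        then show ?thesis using im exchange(2)[of i] ij \<pi>(2) \<pi>(3)[of i] by simp
      next
        case False
        then show ?thesis using im other[of i j] ij \<pi>(3)[of i] \<pi>(3)[of j] by simp
      qed
    qed
  qed
  have "strand_winding (word_isotopy N r (int m # int m # w)) (r i) (r j) =
      L i j + L (\<pi> i) (\<pi> j) + strand_winding (word_isotopy N r w) (r i) (r j)"
    if ij: "i < N" "j < N" "i \<noteq> j" for i j
  proof -
    have ne: "\<pi> i \<noteq> \<pi> j" using inv ij(3) by metis
    show ?thesis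
      unfolding strand_winding_Cons[OF bw(2) ij] 
        strand_winding_Cons[OF bw(1) less[OF ij(1)] less[OF ij(2)] ne, unfolded \<pi>_def]
      using inv unfolding L_def \<pi>_def by simp
  qed
  then have "linking_number m (int m # int m # w) =
      (\<Sum>i\<in>{m..<N}. \<Sum>j<m. (L i j + L (\<pi> i) (\<pi> j)) + strand_winding (word_isotopy N r w) (r i) (r j))"
    unfolding linking_number_def using m by (intro sum.cong refl) auto
  also have "\<dots> = (\<Sum>i\<in>{m..<N}. \<Sum>j<m. L i j + L (\<pi> i) (\<pi> j)) + linking_number m w"
    unfolding linking_number_def sum.distrib by (simp add: algebra_simps)
  also have "(\<Sum>i\<in>{m..<N}. \<Sum>j<m. L i j + L (\<pi> i) (\<pi> j)) =
      (\<Sum>i\<in>{m..<N}. \<Sum>j<m. if i = m then if j = m - 1 then 1 else 0 else 0)"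
    using pair by (intro sum.cong refl) auto
  also have "\<dots> = (\<Sum>i\<in>{m..<N}. if i = m then 1 else 0)"
    using m by (intro sum.cong refl) (auto simp: sum.delta)
  also have "\<dots> = 1" using m by (simp add: sum.delta)
  finally show ?thesis .
qed

end

section \<open>Paths of configurations\<close>

text \<open>Both ways round the boundary of the square are homotopic in the square, and \<open>H\<close> carries this homotopy
  over.\<close>

lemma homotopic_paths_square:
  fixes H :: "real \<times> real \<Rightarrow> 'a::topological_space"
  assumes "continuous_on ({0..1} \<times> {0..1}) H" "H ` ({0..1} \<times> {0..1}) \<subseteq> S"
  shows "homotopic_paths S ((\<lambda>s. H (s, 0)) +++ (\<lambda>t. H (1, t))) ((\<lambda>t. H (0, t)) +++ (\<lambda>s. H (s, 1)))"
proof -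
  let ?I = "{0..1} \<times> {0..1::real} :: (real \<times> real) set"
  have 0: "convex ?I" by (intro convex_Times) auto
  have "homotopic_paths ?I (linepath (0, 0) (1, 0) +++ linepath (1, 0) (1, 1)) (linepath (0, 0) (0, 1) +++ linepath (0, 1) (1, 1))"
  proof (rule homotopic_paths_linear)
    fix t :: real assume t: "t \<in> {0..1}"
    have "path_image (linepath (0, 0) (1, 0) +++ linepath (1, 0) (1, 1)) \<subseteq> ?I"
      "path_image (linepath (0, 0) (0, 1) +++ linepath (0, 1) (1, 1)) \<subseteq> ?I"
      by (intro subset_path_image_join; simp add: closed_segment_subset[OF _ _ 0])+
    then show "closed_segment ((linepath (0, 0) (1, 0) +++ linepath (1, 0) (1, 1)) t)
      ((linepath (0, 0) (0, 1) +++ linepath (0, 1) (1, 1)) t) \<subseteq> ?I"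
      by (intro closed_segment_subset 0) (use t in \<open>auto simp: path_image_def\<close>)
  qed auto
  then have "homotopic_paths S (H \<circ> (linepath (0, 0) (1, 0) +++ linepath (1, 0) (1, 1)))
      (H \<circ> (linepath (0, 0) (0, 1) +++ linepath (0, 1) (1, 1)))"
    using assms by (intro homotopic_paths_continuous_image) auto
  then show ?thesis unfolding path_compose_join by (simp add: o_def linepath_def)
qed

lemma homotopic_paths_backtrack:
  fixes p :: "real \<Rightarrow> 'a::topological_space"
  assumes "path p" "path_image p \<subseteq> S"
  shows "homotopic_paths S (p +++ ((\<lambda>t. pathfinish p) +++ reversepath p)) (\<lambda>t. pathstart p)"
proof -
  have "homotopic_paths {0..1::real} (linepath 0 1 +++ (linepath 1 1 +++ linepath 1 0)) (linepath 0 0)"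
  proof (rule homotopic_paths_linear)
    fix t :: real assume t: "t \<in> {0..1}"
    have "path_image (linepath 0 1 +++ (linepath 1 1 +++ linepath 1 0)) \<subseteq> {0..1::real}"
      by (intro subset_path_image_join; simp add: closed_segment_eq_real_ivl)
    then have "(linepath 0 1 +++ (linepath 1 1 +++ linepath 1 0)) t \<in> {0..1::real}" using t unfolding path_image_def by blast
    moreover have "linepath 0 0 t \<in> {0..1::real}" using t by (simp add: linepath_def)
    ultimately show "closed_segment ((linepath 0 1 +++ (linepath 1 1 +++ linepath 1 0)) t) (linepath 0 0 t) \<subseteq> {0..1::real}"
      by (intro closed_segment_subset convex_closed_interval)
  qed auto
  then have "homotopic_paths S (p \<circ> (linepath 0 1 +++ (linepath 1 1 +++ linepath 1 0))) (p \<circ> linepath 0 0)"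
    using assms by (intro homotopic_paths_continuous_image[where S = "{0..1}"]) (auto simp: path_def path_image_def)
  then show ?thesis
    unfolding path_compose_join by (simp add: o_def linepath_def reversepath_def pathstart_def pathfinish_def)
qed

text \<open>This and the preceding lemma are images of homotopies in the parameter interval.\<close>

lemma homotopic_paths_const_join:
  fixes p :: "real \<Rightarrow> 'a::topological_space"
  assumes "path p" "path_image p \<subseteq> S" "x = pathstart p"
  shows "homotopic_paths S ((\<lambda>t. x) +++ p) p"
proof -
  have "homotopic_paths {0..1::real} (linepath 0 0 +++ linepath 0 1) (linepath 0 1)"
  proof (rule homotopic_paths_linear)
    fix t :: real assume t: "t \<in> {0..1}"
    have "path_image (linepath 0 0 +++ linepath 0 1) \<subseteq> {0..1::real}"
      by (intro subset_path_image_join; simp add: closed_segment_eq_real_ivl)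
    then have "(linepath 0 0 +++ linepath 0 1) t \<in> {0..1::real}" using t unfolding path_image_def by blast
    moreover have "linepath 0 1 t \<in> {0..1::real}" using t by (simp add: linepath_def)
    ultimately show "closed_segment ((linepath 0 0 +++ linepath 0 1) t) (linepath 0 1 t) \<subseteq> {0..1::real}"
      by (intro closed_segment_subset convex_closed_interval)
  qed auto
  then have "homotopic_paths S (p \<circ> (linepath 0 0 +++ linepath 0 1)) (p \<circ> linepath 0 1)"
    using assms by (intro homotopic_paths_continuous_image[where S = "{0..1}"]) (auto simp: path_def path_image_def)
  then show ?thesis using assms(3)
    unfolding path_compose_join by (simp add: o_def linepath_def pathstart_def)
qed

lemma path_fun_iff: "path (\<gamma> :: real \<Rightarrow> nat \<Rightarrow> complex) \<longleftrightarrow> (\<forall>j. path (\<lambda>t. \<gamma> t j))"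
  unfolding path_def
  by (intro iffI allI; (rule continuous_on_product_then_coordinatewise, assumption)?;
      (rule continuous_on_coordinatewise_then_product, erule spec)?)

text \<open>Continuity may be checked in each coordinate separately.\<close>

lemma homotopic_paths_straight:
  fixes \<gamma> \<delta> :: "real \<Rightarrow> nat \<Rightarrow> complex"
  assumes paths: "path \<gamma>" "path \<delta>" and ends: "\<gamma> 0 = \<delta> 0" "\<gamma> 1 = \<delta> 1"
    and S: "\<And>s t. s \<in> {0..1} \<Longrightarrow> t \<in> {0..1} \<Longrightarrow> (\<lambda>j. (1 - s) *\<^sub>R \<gamma> t j + s *\<^sub>R \<delta> t j) \<in> S"
  shows "homotopic_paths S \<gamma> \<delta>"
  unfolding homotopic_paths
proof (intro exI[of _ "\<lambda>y j. (1 - fst y) *\<^sub>R \<gamma> (snd y) j + fst y *\<^sub>R \<delta> (snd y) j"] conjI ballI)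
  show "continuous_on ({0..1} \<times> {0..1}) (\<lambda>y j. (1 - fst y) *\<^sub>R \<gamma> (snd y) j + fst y *\<^sub>R \<delta> (snd y) j)"
  proof (rule continuous_on_coordinatewise_then_product)
    fix j
    have c: "continuous_on {0..1} (\<lambda>t. \<gamma> t j)" "continuous_on {0..1} (\<lambda>t. \<delta> t j)"
      using paths unfolding path_fun_iff path_def by blast+
    show "continuous_on ({0..1} \<times> {0..1}) (\<lambda>y. (1 - fst y) *\<^sub>R \<gamma> (snd y) j + fst y *\<^sub>R \<delta> (snd y) j)"
      by (intro continuous_intros continuous_on_compose2[OF c(1)] continuous_on_compose2[OF c(2)]) auto
  qed
  show "(\<lambda>y j. (1 - fst y) *\<^sub>R \<gamma> (snd y) j + fst y *\<^sub>R \<delta> (snd y) j) \<in> {0..1} \<times> {0..1} \<rightarrow> S"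
    using S by auto
  fix t :: real assume t: "t \<in> {0..1}"
  have eq: "(\<lambda>j. (1 - s) *\<^sub>R c j + s *\<^sub>R c j) = c" for s and c :: "nat \<Rightarrow> complex"
    by (simp add: scaleR_left_diff_distrib)
  show "pathstart ((\<lambda>y j. (1 - fst y) *\<^sub>R \<gamma> (snd y) j + fst y *\<^sub>R \<delta> (snd y) j) \<circ> Pair t) = pathstart \<gamma>"
    "pathfinish ((\<lambda>y j. (1 - fst y) *\<^sub>R \<gamma> (snd y) j + fst y *\<^sub>R \<delta> (snd y) j) \<circ> Pair t) = pathfinish \<gamma>"
    unfolding pathstart_def pathfinish_def using ends eq[of t] by simp_all
qed auto

lemma configurationsI:
  assumes "\<And>i j. i < n \<Longrightarrow> j < n \<Longrightarrow> i < j \<Longrightarrow> c i \<noteq> c j" "\<And>i. i < n \<Longrightarrow> cmod (c i) \<le> 1" "\<And>i. i \<ge> n \<Longrightarrow> c i = 0"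
  shows "c \<in> configurations n"
proof -
  have "inj_on c {..<n}"
  proof (rule inj_onI)
    fix i j assume "i \<in> {..<n}" "j \<in> {..<n}" "c i = c j"
    then show "i = j" using assms(1)[of i j] assms(1)[of j i] by (cases i j rule: linorder_cases) auto
  qed
  then show ?thesis using assms(2,3) unfolding configurations_def by auto
qed

section \<open>The braid of a word of twists\<close>

text \<open>The configurations that occur while the \<open>i\<close>-th pair is twisted: for \<open>\<zeta> = 1\<close> the initial one, and for
  \<open>\<zeta> = -1\<close> the one in which the two points are exchanged.\<close>

definition twisted :: "nat \<Rightarrow> (nat \<Rightarrow> complex) \<Rightarrow> nat \<Rightarrow> real \<Rightarrow> complex \<Rightarrow> nat \<Rightarrow> complex" where
  "twisted n c i \<eta> \<zeta> j =
     (if j = i - 1 then from_unit (c (i - 1)) (c i) (- stretch \<eta> \<zeta>)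
      else if j = i then from_unit (c (i - 1)) (c i) (stretch \<eta> \<zeta>)
      else if j < n then c j else 0)"

lemma twisted_perm:
  assumes "nat \<bar>k\<bar> < n" "k \<noteq> 0" "\<And>j. j \<ge> n \<Longrightarrow> c j = 0"
  shows "twisted n c (nat \<bar>k\<bar>) \<eta> 1 = c" "twisted n c (nat \<bar>k\<bar>) \<eta> (- 1) = c \<circ> letter_perm k"
proof -
  have s: "stretch \<eta> 1 = 1" "stretch \<eta> (-1) = -1" by (simp_all add: complex_eq_iff)
  show "twisted n c (nat \<bar>k\<bar>) \<eta> 1 = c"
    using assms unfolding twisted_def fun_eq_iff s by (auto simp: not_less)
  show "twisted n c (nat \<bar>k\<bar>) \<eta> (- 1) = c \<circ> letter_perm k"
  proof
    fix j
    consider "j = nat \<bar>k\<bar> - 1" | "j = nat \<bar>k\<bar>" "j \<noteq> nat \<bar>k\<bar> - 1" | "j \<noteq> nat \<bar>k\<bar> - 1" "j \<noteq> nat \<bar>k\<bar>" by blast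
    then show "twisted n c (nat \<bar>k\<bar>) \<eta> (- 1) j = (c \<circ> letter_perm k) j"
    proof cases
      case 1
      then show ?thesis unfolding twisted_def s comp_apply using letter_perm_simps(1)[of k] by (simp del: One_nat_def)
    next
      case 2
      then show ?thesis unfolding twisted_def s comp_apply using letter_perm_simps(2)[of k] by (simp del: One_nat_def)
    next
      case 3
      then show ?thesis unfolding twisted_def s comp_apply using letter_perm_simps(3)[of j k] assms(3)[of j]
        by (simp del: One_nat_def)
    qed
  qed
qed

text \<open>The two moving points stay on the ellipse, and all others lie outside its collar.\<close>

lemma (in lex_chain) twisted_configuration:
  assumes i: "0 < i" "i < N" and \<eta>: "0 < \<eta>" "\<eta> \<le> clearance N r i" and \<zeta>: "cmod \<zeta> = 1"
  shows "twisted N r i \<eta> \<zeta> \<in> configurations N"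
proof -
  have ne: "r (i - 1) \<noteq> r i" using neighbours_distinct[OF i] .
  have \<eta>1: "\<eta> \<le> 1" using \<eta> clearance_bounds[OF i] by simp
  have st: "stretch (1 / \<eta>) (stretch \<eta> \<zeta>) = \<zeta>" "stretch (1 / \<eta>) (- stretch \<eta> \<zeta>) = - \<zeta>"
    using \<eta>(1) by (simp_all add: complex_eq_iff)
  have i1: "i - 1 < N" using i by simp
  have inside: "cmod (from_unit (r (i - 1)) (r i) z) < 1" if "cmod (stretch (1 / \<eta>) z) = 1" for z
  proof (rule ellipse_in_ball[OF in_ball[OF i1] in_ball[OF i(2)] \<eta>(1) \<eta>1])
    show "\<eta> \<le> (1 - (cmod (r (i - 1)))\<^sup>2) / 4" "\<eta> \<le> (1 - (cmod (r i))\<^sup>2) / 4"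
      using clearance_room[OF i i1] clearance_room[OF i i(2)] \<eta>(2) by linarith+
  qed (use that \<eta> in auto)
  have apart: "r j \<noteq> from_unit (r (i - 1)) (r i) z"
    if "cmod (stretch (1 / \<eta>) z) = 1" "j < N" "j \<noteq> i - 1" "j \<noteq> i" for z j
  proof
    assume "r j = from_unit (r (i - 1)) (r i) z"
    then have "to_unit (r (i - 1)) (r i) (r j) = z" using to_from_unit[OF ne] by simp
    moreover have "\<eta> \<le> gap (r (i - 1)) (r i) (r j)" using clearance_gap[OF i that(2-4)] \<eta>(2) by linarith
    ultimately show False using gap_outside[OF \<eta>(1) \<eta>1, of "r (i - 1)" "r i" "r j"] that(1) \<eta>(1) by simp
  qed
  have opp: "from_unit (r (i - 1)) (r i) (- stretch \<eta> \<zeta>) \<noteq> from_unit (r (i - 1)) (r i) (stretch \<eta> \<zeta>)"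
  proof
    assume "from_unit (r (i - 1)) (r i) (- stretch \<eta> \<zeta>) = from_unit (r (i - 1)) (r i) (stretch \<eta> \<zeta>)"
    then have "- stretch \<eta> \<zeta> = stretch \<eta> \<zeta>" using to_from_unit[OF ne] by metis
    then have "stretch \<eta> \<zeta> = 0" by simp
    have "\<zeta> = stretch (1 / \<eta>) 0" using st(1) unfolding \<open>stretch \<eta> \<zeta> = 0\<close> ..
    then have "\<zeta> = 0" by (simp add: complex_eq_iff)
    then show False using \<zeta> by simp
  qed
  have \<zeta>1: "cmod (stretch (1 / \<eta>) (stretch \<eta> \<zeta>)) = 1" "cmod (stretch (1 / \<eta>) (- stretch \<eta> \<zeta>)) = 1"
    unfolding st using \<zeta> by simp_all
  show ?thesis
  proof (rule configurationsI)
    fix j l assume jl: "j < N" "l < N" "j < l"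
    show "twisted N r i \<eta> \<zeta> j \<noteq> twisted N r i \<eta> \<zeta> l"
    proof -
      define a where "a = i - 1"
      define A B where "A = from_unit (r a) (r i) (- stretch \<eta> \<zeta>)" and "B = from_unit (r a) (r i) (stretch \<eta> \<zeta>)"
      have tw: "twisted N r i \<eta> \<zeta> x = (if x = a then A else if x = i then B else r x)" if "x < N" for x
        using that unfolding twisted_def A_def B_def a_def by simp
      have AB: "A \<noteq> B" "\<And>x. x < N \<Longrightarrow> x \<noteq> a \<Longrightarrow> x \<noteq> i \<Longrightarrow> r x \<noteq> A \<and> r x \<noteq> B"
        using opp apart[OF \<zeta>1(1)] apart[OF \<zeta>1(2)] unfolding A_def B_def a_def by blast+
      have "r j \<noteq> r l" using distinct_points jl by blast
      then show ?thesis
        unfolding tw[OF jl(1)] tw[OF jl(2)] using AB(1) AB(2)[OF jl(1)] AB(2)[OF jl(2)] jl(3)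
        by (cases "j = a"; cases "j = i"; cases "l = a"; cases "l = i") auto
    qed
  next
    fix j assume "j < N"
    then show "cmod (twisted N r i \<eta> \<zeta> j) \<le> 1"
      unfolding twisted_def using inside[OF \<zeta>1(1)] inside[OF \<zeta>1(2)] in_ball[of j] by (simp add: less_imp_le)
  qed (use i in \<open>auto simp: twisted_def\<close>)
qed

lemma base_point_chain: "lex_chain n (base_point n)"
proof
  fix i j :: nat assume "i < j" "j < n"
  then show "lex_less (base_point n i) (base_point n j)"
    by (simp add: lex_less_def base_point_def divide_strict_right_mono)
next
  fix j assume "j < n"
  then have "\<bar>2 * (real j + 1) / (real n + 1) - 1\<bar> < 1" by (simp add: abs_less_iff field_simps)
  moreover have "base_point n j = of_real (2 * (real j + 1) / (real n + 1) - 1)"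
    using \<open>j < n\<close> by (simp only: base_point_def if_True)
  ultimately show "cmod (base_point n j) < 1" by (simp only: norm_of_real)
qed

lemma lex_chain_segment:
  assumes p: "lex_chain n p" and q: "lex_chain n q" and s: "0 \<le> s" "s \<le> 1"
  shows "lex_chain n (\<lambda>j. (1 - s) *\<^sub>R p j + s *\<^sub>R q j)"
proof
  fix i j :: nat assume "i < j" "j < n"
  then show "lex_less ((1 - s) *\<^sub>R p i + s *\<^sub>R q i) ((1 - s) *\<^sub>R p j + s *\<^sub>R q j)"
    using lex_less_convex s lex_chain.sorted[OF p] lex_chain.sorted[OF q] by blast
next
  fix j assume "j < n"
  then have "p j \<in> ball 0 1" "q j \<in> ball 0 1" using lex_chain.in_ball[OF p] lex_chain.in_ball[OF q] by auto
  then have "(1 - s) *\<^sub>R p j + s *\<^sub>R q j \<in> ball 0 1"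
    using convex_ball[of 0 1] s unfolding convex_alt by blast
  then show "cmod ((1 - s) *\<^sub>R p j + s *\<^sub>R q j) < 1" by simp
qed

lemma lex_chain_configuration:
  assumes "lex_chain n p" "\<And>j. j \<ge> n \<Longrightarrow> p j = 0"
  shows "p \<in> configurations n"
  using lex_chain.distinct_points[OF assms(1)] lex_chain.in_ball[OF assms(1)] assms(2)
  by (intro configurationsI) (auto simp: less_imp_le)

text \<open>The lexicographic order of the points is the same at both ends, hence at all times; so no two of them
  collide.\<close>

definition slide_path :: "nat \<Rightarrow> (nat \<Rightarrow> complex) \<Rightarrow> real \<Rightarrow> nat \<Rightarrow> complex" where
  "slide_path n c s j = (1 - s) *\<^sub>R base_point n j + s *\<^sub>R c j"

context
  fixes n :: nat and c :: "nat \<Rightarrow> complex"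
  assumes c: "lex_chain n c" "\<And>j. j \<ge> n \<Longrightarrow> c j = 0"
begin

lemma slide_path_chain: "s \<in> {0..1} \<Longrightarrow> lex_chain n (slide_path n c s)"
  using lex_chain_segment[OF base_point_chain c(1), of s] unfolding slide_path_def by simp

lemma slide_path_zero: "j \<ge> n \<Longrightarrow> slide_path n c s j = 0"
  by (simp add: slide_path_def base_point_def c(2))

lemma slide_path_ends: "slide_path n c 0 = base_point n" "slide_path n c 1 = c"
  by (simp_all add: slide_path_def fun_eq_iff)

lemma slide_path_in: "s \<in> {0..1} \<Longrightarrow> slide_path n c s \<in> configurations n"
  by (intro lex_chain_configuration slide_path_chain slide_path_zero)

lemma continuous_on_slide_path: "continuous_on S (\<lambda>s. slide_path n c s j)"
  unfolding slide_path_def by (intro continuous_intros)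

lemma path_slide_path: "path (slide_path n c)" "path_image (slide_path n c) \<subseteq> configurations n"
  using slide_path_in continuous_on_slide_path unfolding path_fun_iff path_image_def by (auto simp: path_def)

text \<open>The terms with index \<open>i - 1\<close> and \<open>i\<close> are constant, as these two points stay at the ends of the
  segment.\<close>

lemma continuous_on_clearance_slide:
  assumes i: "0 < i" "i < n"
  shows "continuous_on {0..1} (\<lambda>s. clearance n (slide_path n c s) i)"
proof -
  let ?p = "slide_path n c"
  have ne: "?p s (i - 1) \<noteq> ?p s i" if "s \<in> {0..1}" for s
    by (rule lex_chain.neighbours_distinct[OF slide_path_chain[OF that] i])
  have ne': "?p s i - ?p s (i - 1) \<noteq> 0" if "s \<in> {0..1}" for s
    using ne[OF that] by simp
  have nz: "1 + (\<Sum>j<n. 1 / gap (?p s (i - 1)) (?p s i) (?p s j) + 4 / (1 - (cmod (?p s j))\<^sup>2)) \<noteq> 0"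
    if "s \<in> {0..1}" for s
    using lex_chain.clearance_bounds[OF slide_path_chain[OF that] i] unfolding clearance_def by auto
  have sq: "1 - (cmod (?p s j))\<^sup>2 \<noteq> 0" if "s \<in> {0..1}" "j < n" for s j
    using lex_chain.in_ball_sq[OF slide_path_chain[OF that(1)] that(2)] by simp
  have summand: "continuous_on {0..1} (\<lambda>s. 1 / gap (?p s (i - 1)) (?p s i) (?p s j))" if j: "j < n" for j
  proof (cases "j = i - 1 \<or> j = i")
    case True
    have "gap (?p s (i - 1)) (?p s i) (?p s j) = 0" if "s \<in> {0..1}" for s
      using True gap_ends[OF ne[OF that]] by auto
    then have "continuous_on {0..1} (\<lambda>s. 1 / gap (?p s (i - 1)) (?p s i) (?p s j)) \<longleftrightarrow> continuous_on {0..1::real} (\<lambda>s. 0 :: real)"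
      by (intro continuous_on_cong) auto
    then show ?thesis by simp
  next
    case False
    have pos: "gap (?p s (i - 1)) (?p s i) (?p s j) \<noteq> 0" if "s \<in> {0..1}" for s
      using lex_chain.gap_nonneg(2)[OF slide_path_chain[OF that] i j] False by auto
    have "continuous_on {0..1} (\<lambda>s. gap (?p s (i - 1)) (?p s i) (?p s j))"
      unfolding gap_def to_unit_def
      by (intro continuous_intros continuous_on_slide_path) (use ne' in auto)
    then show ?thesis by (intro continuous_on_divide) (use pos in auto)
  qed
  show ?thesis unfolding clearance_def
    by (intro continuous_on_divide continuous_on_add continuous_on_const continuous_on_sum summand
        continuous_on_diff continuous_on_power continuous_on_norm continuous_on_slide_path)
      (use sq nz in auto)
qed

text \<open>Slide the points back to the base configuration while adapting the width of the ellipse.\<close>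

lemma slide_twisted:
  assumes k: "k \<noteq> 0" "\<bar>k\<bar> < int n" and \<eta>: "0 < \<eta>" "\<eta> \<le> clearance n c (nat \<bar>k\<bar>)"
  obtains \<eta>' where "0 < \<eta>'" "\<eta>' \<le> 1"
    "\<And>t. twisted n (base_point n) (nat \<bar>k\<bar>) \<eta>' (turn t) \<in> configurations n"
    "homotopic_paths (configurations n)
       (slide_path n c +++ (\<lambda>t. twisted n c (nat \<bar>k\<bar>) \<eta> (turn (of_int (sgn k) * t))))
       ((\<lambda>t. twisted n (base_point n) (nat \<bar>k\<bar>) \<eta>' (turn (of_int (sgn k) * t))) +++
        (\<lambda>s. slide_path n c s \<circ> letter_perm k))"
proof -
  let ?i = "nat \<bar>k\<bar>" and ?p = "slide_path n c"
  have i: "0 < ?i" "?i < n" using k by auto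
  \<comment> \<open>Thin enough for every intermediate configuration, and equal to the given width at the end of the slide.\<close>
  define e where "e s = min \<eta> (clearance n (?p s) ?i)" for s
  have conte: "continuous_on {0..1} e"
    unfolding e_def by (intro continuous_intros continuous_on_clearance_slide i)
  have e1: "e 1 = \<eta>" using \<eta> by (simp add: e_def slide_path_ends)
  have e: "0 < e s" "e s \<le> clearance n (?p s) ?i" if "s \<in> {0..1}" for s
    using lex_chain.clearance_bounds(1)[OF slide_path_chain[OF that] i] \<eta>(1) unfolding e_def by auto
  define H where "H y = twisted n (?p (fst y)) ?i (e (fst y)) (turn (of_int (sgn k) * snd y))" for y
  have contH: "continuous_on ({0..1} \<times> {0..1}) H"
  proof (rule continuous_on_coordinatewise_then_product)
    fix j
    have p: "continuous_on ({0..1} \<times> {0..1}) (\<lambda>y :: real \<times> real. ?p (fst y) l)" for l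
      by (rule continuous_on_compose2[OF continuous_on_slide_path[of UNIV]]) (auto intro!: continuous_intros)
    have e': "continuous_on ({0..1} \<times> {0..1}) (\<lambda>y :: real \<times> real. e (fst y))"
      by (rule continuous_on_compose2[OF conte]) (auto intro!: continuous_intros)
    have from_unit: "continuous_on ({0..1} \<times> {0..1}) (\<lambda>y :: real \<times> real. from_unit (?p (fst y) (?i - 1)) (?p (fst y) ?i) (g y))"
      if "continuous_on ({0..1} \<times> {0..1}) g" for g
      unfolding from_unit_def by (intro continuous_intros p that) auto
    have ne: "?i \<noteq> ?i - 1" using i by simp
    consider "j = ?i - 1" | "j = ?i" | "j \<noteq> ?i - 1" "j \<noteq> ?i" by blast
    then show "continuous_on ({0..1} \<times> {0..1}) (\<lambda>y. H y j)"
    proof cases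
      case 1
      show ?thesis unfolding H_def twisted_def 1
        by (simp only: simp_thms if_True) (intro from_unit continuous_intros e')
    next
      case 2
      show ?thesis unfolding H_def twisted_def 2
        by (simp only: simp_thms ne if_True if_False) (intro from_unit continuous_intros e')
    next
      case 3
      show ?thesis unfolding H_def twisted_def
        by (cases "j < n"; simp only: simp_thms 3 if_True if_False) (intro p continuous_intros)+
    qed
  qed
  have inH: "H ` ({0..1} \<times> {0..1}) \<subseteq> configurations n"
    unfolding H_def using lex_chain.twisted_configuration[OF slide_path_chain i e] by auto
  have turn1: "turn (of_int (sgn k)) = -1" using k by (cases "k > 0") (auto simp: sgn_if)
  have sides: "(\<lambda>s. H (s, 0)) = ?p" "(\<lambda>t. H (1, t)) = (\<lambda>t. twisted n c ?i \<eta> (turn (of_int (sgn k) * t)))"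
    "(\<lambda>t. H (0, t)) = (\<lambda>t. twisted n (base_point n) ?i (e 0) (turn (of_int (sgn k) * t)))"
    "(\<lambda>s. H (s, 1)) = (\<lambda>s. ?p s \<circ> letter_perm k)"
    unfolding H_def using twisted_perm[OF i(2) k(1) slide_path_zero] e1 turn1 by (simp_all add: slide_path_ends)
  show thesis
  proof (rule that[of "e 0"])
    show "0 < e 0" using e[of 0] by simp
    show "e 0 \<le> 1" using e(2)[of 0] lex_chain.clearance_bounds(2)[OF slide_path_chain[of 0] i] by simp
    show "twisted n (base_point n) ?i (e 0) (turn t) \<in> configurations n" for t
      using lex_chain.twisted_configuration[OF slide_path_chain i e, of 0] by (simp add: slide_path_ends)
    show "homotopic_paths (configurations n)
       (?p +++ (\<lambda>t. twisted n c ?i \<eta> (turn (of_int (sgn k) * t))))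
       ((\<lambda>t. twisted n (base_point n) ?i (e 0) (turn (of_int (sgn k) * t))) +++ (\<lambda>s. ?p s \<circ> letter_perm k))"
      using homotopic_paths_square[OF contH inH] unfolding sides .
  qed
qed

end

text \<open>In the coordinates of the segment the two strands are opposite to each other, and for \<open>0 < t < 1\<close> one of
  them remains in the upper half plane in both braids. So the straight homotopy from the flat to the
  round half turn avoids collisions.\<close>

lemma homotopic_twisted_half_twist:
  assumes k: "k \<noteq> 0" "\<bar>k\<bar> < int n" and \<eta>: "0 < \<eta>" "\<eta> \<le> 1"
  shows "homotopic_paths (configurations n)
    (\<lambda>t. twisted n (base_point n) (nat \<bar>k\<bar>) \<eta> (turn (of_int (sgn k) * t))) (half_twist n k)"
proof -
  define i \<sigma> where "i = nat \<bar>k\<bar>" and "\<sigma> = real_of_int (sgn k)"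
  have i: "0 < i" "i < n" "i \<noteq> i - 1" using k unfolding i_def by auto
  have \<sigma>: "\<sigma> = 1 \<or> \<sigma> = -1" using k unfolding \<sigma>_def by (auto simp: sgn_if)
  define a b where "a = base_point n (i - 1)" and "b = base_point n i"
  define d c where "d = 1 / (real n + 1)" and "c = (2 * real i + 1) / (real n + 1) - 1"
  have base: "base_point n j = of_real (c + (2 * (real j - real i) + 1) * d)" if "j < n" for j
  proof -
    have "c + (2 * (x - real i) + 1) * d = 2 * (x + 1) / D - 1" if "D = real n + 1" "D \<noteq> 0" for x D
      unfolding c_def d_def that(1)[symmetric] using that(2) by (simp add: field_simps)
    then show ?thesis using \<open>j < n\<close> unfolding base_point_def by simp
  qed
  have ab: "a = of_real (c - d)" "b = of_real (c + d)"
    unfolding a_def b_def using base[of "i - 1"] base[of i] i by (simp_all add: of_nat_diff)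
  have mid: "(a + b) / 2 = of_real c" "(b - a) / 2 = of_real d" unfolding ab by simp_all
  have unit: "from_unit a b z = of_real c + of_real d * z" for z unfolding from_unit_def mid ..
  have d1: "d > 0" unfolding d_def by simp
  have "cmod a < 1" "cmod b < 1"
    unfolding a_def b_def using lex_chain.in_ball[OF base_point_chain] i by simp_all
  then have "\<bar>c - d\<bar> < 1" "\<bar>c + d\<bar> < 1" unfolding ab norm_of_real .
  with d1 have d: "d > 0" "\<bar>c\<bar> + d \<le> 1" by linarith+
  have hj: "half_twist n k t j = (if j = i - 1 then from_unit a b (- cis (\<sigma> * pi * t)) else if j = i then from_unit a b (cis (\<sigma> * pi * t))
     else if j < n then base_point n j else 0)" for t j
  proof -
    have "half_twist n k t j = (if j = i - 1 \<or> j = i then of_real c + (base_point n j - of_real c) * cis (\<sigma> * pi * t) else base_point n j)"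
      unfolding half_twist_def Let_def i_def[symmetric] \<sigma>_def a_def[symmetric] b_def[symmetric] mid ..
    moreover have "base_point n (i - 1) - of_real c = - of_real d" "base_point n i - of_real c = of_real d"
      using ab unfolding a_def b_def by simp_all
    moreover have "j < n \<or> base_point n j = 0" by (simp add: base_point_def)
    ultimately show ?thesis using i(3) unfolding unit by (cases "j = i - 1"; cases "j = i") auto
  qed
  have tj: "twisted n (base_point n) i \<eta> z j = (if j = i - 1 then from_unit a b (- stretch \<eta> z) else if j = i then from_unit a b (stretch \<eta> z)
     else if j < n then base_point n j else 0)" for z j
    unfolding twisted_def a_def b_def ..
  have "homotopic_paths (configurations n) (\<lambda>t. twisted n (base_point n) i \<eta> (turn (\<sigma> * t))) (half_twist n k)"
  proof (rule homotopic_paths_straight)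
    have split: "path (\<lambda>t. if Q then f t else g t)" if "Q \<Longrightarrow> path f" "\<not> Q \<Longrightarrow> path g" for Q and f g :: "real \<Rightarrow> complex"
      using that by (cases Q) simp_all
    show "path (\<lambda>t. twisted n (base_point n) i \<eta> (turn (\<sigma> * t)))"
      unfolding path_fun_iff tj unit by (intro allI split) (auto simp: path_def intro!: continuous_intros)
    show "path (half_twist n k)"
      unfolding path_fun_iff hj unit by (intro allI split) (auto simp: path_def intro!: continuous_intros)
    have st: "stretch \<eta> 1 = 1" "stretch \<eta> (-1) = -1" by (simp_all add: complex_eq_iff)
    have turn1: "turn (\<sigma> * 1) = -1" "cis (\<sigma> * pi * 1) = -1" using \<sigma> by (auto simp: complex_eq_iff)
    show "twisted n (base_point n) i \<eta> (turn (\<sigma> * 0)) = half_twist n k 0"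
      "twisted n (base_point n) i \<eta> (turn (\<sigma> * 1)) = half_twist n k 1"
      unfolding fun_eq_iff hj tj turn1 by (simp_all add: st)
    fix s t :: real assume s: "s \<in> {0..1}" and t: "t \<in> {0..1}"
    define \<xi> where "\<xi> = (1 - s) *\<^sub>R stretch \<eta> (turn (\<sigma> * t)) + s *\<^sub>R cis (\<sigma> * pi * t)"
    have "(1 - s) *\<^sub>R twisted n (base_point n) i \<eta> (turn (\<sigma> * t)) j + s *\<^sub>R half_twist n k t j =
      (if j = i - 1 then from_unit a b (- \<xi>) else if j = i then from_unit a b \<xi> else if j < n then base_point n j else 0)" for j
      unfolding hj tj unit \<xi>_def by (simp add: scaleR_conv_of_real algebra_simps)
    then have eq: "(\<lambda>j. (1 - s) *\<^sub>R twisted n (base_point n) i \<eta> (turn (\<sigma> * t)) j + s *\<^sub>R half_twist n k t j) =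
      (\<lambda>j. if j = i - 1 then from_unit a b (- \<xi>) else if j = i then from_unit a b \<xi> else if j < n then base_point n j else 0)"
      by blast
    have \<xi>0: "\<xi> \<noteq> 0"
    proof (cases "t = 0 \<or> t = 1")
      case True
      then have "\<xi> = 1 \<or> \<xi> = -1"
        unfolding \<xi>_def using turn1 st by (auto simp: algebra_simps scaleR_left_diff_distrib)
      then show ?thesis by auto
    next
      case False
      then have t': "0 < t" "t < 1" using t by auto
      have "Im (turn t) > 0" unfolding Im_turn using t' turn_denom_pos[of t] by (intro divide_pos_pos mult_pos_pos) auto
      moreover have "sin (pi * t) > 0" using t' by (intro sin_gt_zero) auto
      ultimately have "(1 - s) * (\<eta> * Im (turn t)) + s * sin (pi * t) > 0"
        using s \<eta>(1) by (cases "s = 0") (auto intro!: add_nonneg_pos mult_pos_pos)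
      moreover have "Im \<xi> = \<sigma> * ((1 - s) * (\<eta> * Im (turn t)) + s * sin (pi * t))"
        using \<sigma> unfolding \<xi>_def by (auto simp: turn_minus algebra_simps)
      ultimately show ?thesis using \<sigma> by auto
    qed
    have "cmod (stretch \<eta> (turn (\<sigma> * t))) \<le> 1"
    proof -
      have "(cmod (stretch \<eta> (turn (\<sigma> * t))))\<^sup>2 \<le> (Re (turn (\<sigma> * t)))\<^sup>2 + 1 * (Im (turn (\<sigma> * t)))\<^sup>2"
        unfolding cmod_stretch_sq using \<eta> by (intro add_left_mono mult_right_mono) (auto simp: power_le_one)
      also have "\<dots> = 1" using cmod_power2[of "turn (\<sigma> * t)"] by simp
      finally show ?thesis by (rule power2_le_imp_le[of _ 1, unfolded one_power2]) simp_all
    qed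
    then have \<xi>1: "cmod \<xi> \<le> 1"
    proof -
      assume *: "cmod (stretch \<eta> (turn (\<sigma> * t))) \<le> 1"
      have "cmod \<xi> \<le> cmod ((1 - s) *\<^sub>R stretch \<eta> (turn (\<sigma> * t))) + cmod (s *\<^sub>R cis (\<sigma> * pi * t))"
        unfolding \<xi>_def by (rule norm_triangle_ineq)
      also have "\<dots> \<le> (1 - s) * 1 + s * 1" unfolding norm_scaleR using * s by (intro add_mono mult_mono) auto
      finally show ?thesis by simp
    qed
    have near: "cmod (from_unit a b z - of_real c) \<le> d" if "cmod z \<le> 1" for z
      unfolding unit using that d(1) mult_left_mono[of "cmod z" 1 d] by (simp add: norm_mult)
    have far: "cmod (base_point n j - of_real c) > d" if "j < n" "j \<noteq> i - 1" "j \<noteq> i" for j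
    proof -
      have "\<bar>2 * (real j - real i) + 1\<bar> \<ge> 3"
      proof -
        have "j + 2 \<le> i \<or> i + 1 \<le> j" using that i by arith
        then have "\<bar>2 * (int j - int i) + 1\<bar> \<ge> 3" by arith
        then have "real_of_int \<bar>2 * (int j - int i) + 1\<bar> \<ge> real_of_int 3" by (simp only: of_int_le_iff)
        then show ?thesis by simp
      qed
      then have "\<bar>2 * (real j - real i) + 1\<bar> * d \<ge> 3 * d" using d(1) by (intro mult_right_mono) auto
      moreover have "base_point n j - of_real c = of_real ((2 * (real j - real i) + 1) * d)"
        unfolding base[OF that(1)] by simp
      then have "cmod (base_point n j - of_real c) = \<bar>2 * (real j - real i) + 1\<bar> * d"
        using d(1) by (simp only: norm_of_real abs_mult abs_of_pos)
      ultimately show ?thesis using d(1) by linarith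
    qed
    have apart: "base_point n j \<noteq> from_unit a b z" if "j < n" "j \<noteq> i - 1" "j \<noteq> i" "cmod z \<le> 1" for j z
      using near[OF that(4)] far[OF that(1-3)] by auto
    have opp: "from_unit a b (- \<xi>) \<noteq> from_unit a b \<xi>" unfolding unit using \<xi>0 d(1) by simp
    have small: "cmod (from_unit a b z) \<le> 1" if "cmod z \<le> 1" for z
    proof -
      have "cmod (from_unit a b z) \<le> cmod (of_real c) + cmod (from_unit a b z - of_real c)"
        by (rule norm_triangle_sub)
      then show ?thesis using near[OF that] d(2) by simp
    qed
    show "(\<lambda>j. (1 - s) *\<^sub>R twisted n (base_point n) i \<eta> (turn (\<sigma> * t)) j + s *\<^sub>R half_twist n k t j) \<in> configurations n"
      unfolding eq
    proof (rule configurationsI)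
      fix j l assume jl: "j < n" "l < n" "j < l"
      have "base_point n j \<noteq> base_point n l"
        using lex_chain.distinct_points[OF base_point_chain] jl by blast
      then show "(if j = i - 1 then from_unit a b (- \<xi>) else if j = i then from_unit a b \<xi> else if j < n then base_point n j else 0) \<noteq>
          (if l = i - 1 then from_unit a b (- \<xi>) else if l = i then from_unit a b \<xi> else if l < n then base_point n l else 0)"
        using opp apart[of j \<xi>] apart[of j "- \<xi>"] apart[of l \<xi>] apart[of l "- \<xi>"] \<xi>1 jl
        by (cases "j = i - 1"; cases "j = i"; cases "l = i - 1"; cases "l = i") (simp_all del: One_nat_def)
    next
      fix j assume "j < n"
      then have "cmod (base_point n j) \<le> 1" using lex_chain.in_ball[OF base_point_chain[of n], of j] by simp
      then show "cmod (if j = i - 1 then from_unit a b (- \<xi>) else if j = i then from_unit a b \<xi> else if j < n then base_point n j else 0) \<le> 1"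
        using small[of \<xi>] small[of "- \<xi>"] \<xi>1 by simp
    qed (use i in auto)
  qed
  then show ?thesis unfolding i_def \<sigma>_def .
qed

definition strands :: "nat \<Rightarrow> (real \<times> complex \<Rightarrow> complex) \<Rightarrow> (nat \<Rightarrow> complex) \<Rightarrow> real \<Rightarrow> nat \<Rightarrow> complex" where
  "strands n h c t j = (if j < n then h (t, c j) else 0)"

definition map_points :: "nat \<Rightarrow> (complex \<Rightarrow> complex) \<Rightarrow> (nat \<Rightarrow> complex) \<Rightarrow> nat \<Rightarrow> complex" where
  "map_points n f c j = (if j < n then f (c j) else 0)"

lemma configurations_cball: "c \<in> configurations n \<Longrightarrow> j < n \<Longrightarrow> c j \<in> cball 0 1"
  by (auto simp: configurations_def)

lemma strands_path:
  assumes h: "isotopy_from_id h f" and c: "c \<in> configurations n"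
  shows "path (strands n h c)" "path_image (strands n h c) \<subseteq> configurations n"
    "pathstart (strands n h c) = c" "pathfinish (strands n h c) = map_points n f c"
    "map_points n f c \<in> configurations n"
proof -
  have cont: "continuous_on ({0..1} \<times> cball 0 1) h"
    and ends: "\<And>z. z \<in> cball 0 1 \<Longrightarrow> h (0, z) = z" "\<And>z. z \<in> cball 0 1 \<Longrightarrow> h (1, z) = f z"
    using h unfolding isotopy_from_id_def by blast+
  have zero: "c j = 0" if "j \<ge> n" for j using c that by (auto simp: configurations_def)
  show "path (strands n h c)"
    unfolding path_fun_iff
  proof
    fix j
    show "path (\<lambda>t. strands n h c t j)"
    proof (cases "j < n")
      case True
      have "continuous_on {0..1} (\<lambda>t. h (t, c j))"
        by (rule continuous_on_compose2[OF cont])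
          (use configurations_cball[OF c True] in \<open>auto intro!: continuous_intros\<close>)
      then show ?thesis using True by (simp add: strands_def path_def)
    qed (simp add: strands_def path_def)
  qed
  have in_conf: "strands n h c t \<in> configurations n" if t: "t \<in> {0..1}" for t
  proof (rule configurationsI)
    obtain g where g: "homeomorphism (cball 0 1) (cball 0 1) (\<lambda>z. h (t, z)) g"
      using h t unfolding isotopy_from_id_def by blast
    fix i assume i: "i < n"
    have "h (t, c i) \<in> cball 0 1"
      using homeomorphism_image1[OF g] configurations_cball[OF c i] by blast
    then show "cmod (strands n h c t i) \<le> 1" using i by (simp add: strands_def)
    fix j assume j: "j < n" "i < j"
    have "c i \<noteq> c j" using c i j unfolding configurations_def inj_on_def by force
    then show "strands n h c t i \<noteq> strands n h c t j"
      using inj_onD[OF isotopy_from_id_inj[OF h t]] configurations_cball[OF c] i j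
      unfolding strands_def by (metis (no_types, lifting))
  qed (simp add: strands_def)
  then show "path_image (strands n h c) \<subseteq> configurations n" unfolding path_image_def by blast
  show "pathstart (strands n h c) = c"
    using ends(1) configurations_cball[OF c] zero unfolding pathstart_def strands_def fun_eq_iff by simp
  show fin: "pathfinish (strands n h c) = map_points n f c"
    using ends(2) configurations_cball[OF c] unfolding pathfinish_def strands_def map_points_def fun_eq_iff by simp
  show "map_points n f c \<in> configurations n"
    using in_conf[of 1] unfolding fin[symmetric] pathfinish_def by simp
qed

lemma strands_join:
  assumes h: "isotopy_from_id h1 f1" and c: "c \<in> configurations n"
  shows "strands n (isotopy_join h1 h2) c = strands n h1 c +++ strands n h2 (map_points n f1 c)"
proof -
  have "h1 (1, c j) = f1 (c j)" if "j < n" for j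
    using h configurations_cball[OF c that] unfolding isotopy_from_id_def by blast
  then show ?thesis
    by (auto simp: fun_eq_iff strands_def isotopy_join_def joinpaths_def map_points_def)
qed

lemma join_perm: "(\<lambda>t. (\<gamma> +++ \<delta>) t \<circ> \<pi>) = (\<lambda>t. \<gamma> t \<circ> \<pi>) +++ (\<lambda>t. \<delta> t \<circ> \<pi>)"
  by (auto simp: joinpaths_def fun_eq_iff)

lemma configurations_perm:
  assumes "c \<in> configurations n" "bij_betw \<pi> {..<n} {..<n}" "\<And>j. j \<ge> n \<Longrightarrow> \<pi> j = j"
  shows "c \<circ> \<pi> \<in> configurations n"
  using assms unfolding configurations_def bij_betw_def
  by (auto intro!: comp_inj_on)

lemma homotopic_paths_perm:
  assumes "homotopic_paths (configurations n) \<gamma> \<delta>" "bij_betw \<pi> {..<n} {..<n}" "\<And>j. j \<ge> n \<Longrightarrow> \<pi> j = j"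
  shows "homotopic_paths (configurations n) (\<lambda>t. \<gamma> t \<circ> \<pi>) (\<lambda>t. \<delta> t \<circ> \<pi>)"
proof -
  have "homotopic_paths (configurations n) ((\<lambda>c. c \<circ> \<pi>) \<circ> \<gamma>) ((\<lambda>c. c \<circ> \<pi>) \<circ> \<delta>)"
  proof (rule homotopic_paths_continuous_image[OF assms(1)])
    show "continuous_on (configurations n) (\<lambda>c. c \<circ> \<pi>)"
      by (rule continuous_on_coordinatewise_then_product)
         (auto intro: continuous_on_subset[OF continuous_on_product_coordinates])
    show "(\<lambda>c. c \<circ> \<pi>) \<in> configurations n \<rightarrow> configurations n"
      using configurations_perm assms(2,3) by blast
  qed
  then show ?thesis by (simp add: o_def)
qed

lemma letter_perm_permutes:
  assumes "k \<noteq> 0" "\<bar>k\<bar> < int n"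
  shows "bij_betw (letter_perm k) {..<n} {..<n}" "j \<ge> n \<Longrightarrow> letter_perm k j = j"
proof -
  have "letter_perm k permutes {..<n}"
    unfolding letter_perm_def by (rule permutes_swap_id) (use assms in auto)
  then show "bij_betw (letter_perm k) {..<n} {..<n}" "j \<ge> n \<Longrightarrow> letter_perm k j = j"
    by (auto simp: permutes_imp_bij permutes_not_in)
qed

lemma end_position_permutes: "braid_word n w \<Longrightarrow> end_position w permutes {..<n}"
proof (induction w)
  case (Cons k w)
  have "letter_perm k permutes {..<n}"
    unfolding letter_perm_def by (rule permutes_swap_id) (use Cons.prems in auto)
  moreover have "end_position w permutes {..<n}" using Cons by simp
  ultimately show ?case unfolding end_position.simps by (rule permutes_compose)
qed (simp add: permutes_id)

definition shift_letter :: "nat \<Rightarrow> int \<Rightarrow> int" where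
  "shift_letter m k = k + sgn k * int m"

lemma shift_letter:
  assumes "k \<noteq> 0"
  shows "shift_letter m k \<noteq> 0" "\<bar>shift_letter m k\<bar> = \<bar>k\<bar> + int m" "sgn (shift_letter m k) = sgn k"
    "nat \<bar>shift_letter m k\<bar> = m + nat \<bar>k\<bar>"
  using assms by (auto simp: shift_letter_def sgn_if)

lemma braid_word_shift: "braid_word n w \<Longrightarrow> braid_word (m + n) (map (shift_letter m) w)"
  by (induction w) (auto simp: shift_letter)

lemma end_position_shift:
  "braid_word n w \<Longrightarrow> end_position (map (shift_letter m) w) (m + j) = m + end_position w j"
proof (induction w arbitrary: j)
  case (Cons k w)
  have k: "k \<noteq> 0" using Cons.prems by simp
  have idx: "m + nat \<bar>k\<bar> - 1 = m + (nat \<bar>k\<bar> - 1)" using k by simp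
  have "letter_perm (shift_letter m k) (m + j) = m + letter_perm k j"
  proof -
    have "letter_perm (shift_letter m k) = Transposition.transpose (m + (nat \<bar>k\<bar> - 1)) (m + nat \<bar>k\<bar>)"
      by (simp only: letter_perm_def shift_letter(4)[OF k] idx)
    then show ?thesis by (simp add: letter_perm_def Transposition.transpose_def)
  qed
  then show ?case using Cons by simp
qed simp

lemma end_position_shift_less:
  "braid_word n w \<Longrightarrow> j < m \<Longrightarrow> end_position (map (shift_letter m) w) j = j"
proof (induction w arbitrary: j)
  case (Cons k w)
  have k: "k \<noteq> 0" using Cons.prems by simp
  have idx: "m + nat \<bar>k\<bar> - 1 = m + (nat \<bar>k\<bar> - 1)" using k by simp
  have "letter_perm (shift_letter m k) j = j"
    using k Cons.prems(2) unfolding letter_perm_def shift_letter(4)[OF k] by (auto simp: Transposition.transpose_def)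
  then show ?case using Cons by simp
qed simp

text \<open>The points of a chain from index \<open>m\<close> on; the twists keep their distance from all points of the
  chain, including the first \<open>m\<close> ones.\<close>

locale shifted_chain = lex_chain N r for N r +
  fixes m n :: nat
  assumes N: "N = m + n"
begin

definition c :: "nat \<Rightarrow> complex" where
  "c j = (if j < n then r (m + j) else 0)"

lemma c_chain: "lex_chain n c"
  using sorted in_ball N unfolding lex_chain_def c_def by auto

lemma c_zero: "j \<ge> n \<Longrightarrow> c j = 0"
  by (simp add: c_def)

lemma c_configuration: "c \<in> configurations n"
  by (rule lex_chain_configuration[OF c_chain c_zero])

text \<open>The clearance in the whole chain has more terms in its denominator.\<close>

lemma clearance_shift:
  assumes i: "0 < i" "i < n"
  shows "clearance N r (m + i) \<le> clearance n c i"
proof -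
  let ?s = "\<lambda>j. 1 / gap (r (m + i - 1)) (r (m + i)) (r j) + 4 / (1 - (cmod (r j))\<^sup>2)"
  have i': "0 < m + i" "m + i < N" using i N by auto
  have nn: "0 \<le> ?s j" if "j < N" for j
    using clearance_terms[OF i' that] by linarith
  have c': "c (i - 1) = r (m + i - 1)" "c i = r (m + i)" using i by (simp_all add: c_def)
  have "(\<Sum>j<n. 1 / gap (c (i - 1)) (c i) (c j) + 4 / (1 - (cmod (c j))\<^sup>2)) = (\<Sum>j<n. ?s (m + j))"
    unfolding c' by (intro sum.cong refl) (simp add: c_def)
  also have "\<dots> = sum ?s ((\<lambda>j. m + j) ` {..<n})"
    by (subst sum.reindex) (auto simp: inj_on_def)
  also have "\<dots> \<le> (\<Sum>j<N. ?s j)"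
    by (rule sum_mono2) (use nn N in auto)
  finally have le: "(\<Sum>j<n. 1 / gap (c (i - 1)) (c i) (c j) + 4 / (1 - (cmod (c j))\<^sup>2)) \<le> (\<Sum>j<N. ?s j)" .
  have "0 < 1 / clearance n c i"
    using lex_chain.clearance_bounds[OF c_chain i] by simp
  then have "0 < 1 + (\<Sum>j<n. 1 / gap (c (i - 1)) (c i) (c j) + 4 / (1 - (cmod (c j))\<^sup>2))"
    unfolding clearance_def by simp
  then show ?thesis using le unfolding clearance_def by (intro divide_left_mono mult_pos_pos) auto
qed

lemma strands_letter:
  assumes k: "k \<noteq> 0" "\<bar>k\<bar> < int n"
  shows "strands n (\<lambda>(t, z). letter_twist N r (shift_letter m k) t z) c =
    (\<lambda>t. twisted n c (nat \<bar>k\<bar>) (clearance N r (m + nat \<bar>k\<bar>)) (turn (of_int (sgn k) * t)))"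
proof (intro ext)
  fix t j
  let ?k = "shift_letter m k" and ?i = "nat \<bar>k\<bar>"
  note sh = shift_letter[OF k(1), of m]
  have k': "?k \<noteq> 0" "\<bar>?k\<bar> < int N" using sh k N by auto
  have i: "0 < ?i" "?i < n" using k by auto
  note ends = letter_twist_ends[OF k', of t, unfolded sh(3,4)]
  have idx: "m + ?i - 1 = m + (?i - 1)" using i by simp
  have ci: "c (?i - 1) = r (m + (?i - 1))" "c ?i = r (m + ?i)" using i by (simp_all add: c_def)
  consider "j = ?i - 1" | "j = ?i" "j \<noteq> ?i - 1" | "j \<noteq> ?i - 1" "j \<noteq> ?i" "j < n" | "j \<noteq> ?i - 1" "j \<noteq> ?i" "j \<ge> n" by linarith
  then show "strands n (\<lambda>(t, z). letter_twist N r ?k t z) c t j =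
     twisted n c ?i (clearance N r (m + ?i)) (turn (of_int (sgn k) * t)) j"
  proof cases
    case 1
    then have "j < n" using i by simp
    then show ?thesis using ends(1) unfolding strands_def twisted_def idx ci[symmetric] 1 by simp
  next
    case 2
    then have "j < n" using i by simp
    then show ?thesis using ends(2) 2 unfolding strands_def twisted_def idx ci[symmetric] by (simp del: One_nat_def)
  next
    case 3
    have "letter_twist N r ?k t (r (m + j)) = r (m + j)"
      by (rule letter_twist_other[OF k']) (use 3 i N in \<open>auto simp: sh\<close>)
    then show ?thesis using 3 unfolding strands_def twisted_def by (simp add: c_def)
  next
    case 4
    then show ?thesis unfolding strands_def twisted_def by (simp del: One_nat_def)
  qed
qed

lemma map_points_letter:
  assumes k: "k \<noteq> 0" "\<bar>k\<bar> < int n"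
  shows "map_points n (letter_twist N r (shift_letter m k) 1) c = c \<circ> letter_perm k"
proof
  fix j
  note sh = shift_letter[OF k(1), of m]
  have k': "shift_letter m k \<noteq> 0" "\<bar>shift_letter m k\<bar> < int N" using sh k N by auto
  have p: "letter_perm (shift_letter m k) (m + j) = m + letter_perm k j"
    using end_position_shift[of n "[k]" m j] k by simp
  show "map_points n (letter_twist N r (shift_letter m k) 1) c j = (c \<circ> letter_perm k) j"
  proof (cases "j < n")
    case True
    then have "letter_perm k j < n" using letter_perm_permutes(1)[OF k] by (auto simp: bij_betw_def)
    then show ?thesis using True letter_twist_perm[OF k', of "m + j"] N p by (simp add: map_points_def c_def)
  next
    case False
    then show ?thesis using letter_perm_permutes(2)[OF k, of j] by (simp add: map_points_def c_def)
  qed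
qed

text \<open>By induction on the word: the square of \<open>slide_twisted\<close> moves the slide past the first twist, turning
  that twist into the standard generator; the slide has then been relabelled by the permutation of
  the letter, and the induction hypothesis, relabelled in the same way, applies to the rest.\<close>

lemma slide_word_strands:
  "braid_word n w \<Longrightarrow> homotopic_paths (configurations n)
     (slide_path n c +++ (strands n (word_isotopy N r (map (shift_letter m) w)) c +++
        (\<lambda>t. reversepath (slide_path n c) t \<circ> end_position w)))
     (word_path n w)"
proof (induction w)
  case Nil
  have "strands n snd c = (\<lambda>t. c)" by (auto simp: fun_eq_iff strands_def c_def)
  then show ?case
    using homotopic_paths_backtrack[OF path_slide_path[OF c_chain c_zero]]
    by (simp add: pathstart_def pathfinish_def slide_path_ends[OF c_chain c_zero])
next
  case (Cons k w)
  let ?X = "configurations n" and ?A = "slide_path n c" and ?\<pi> = "letter_perm k"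
  have k: "k \<noteq> 0" "\<bar>k\<bar> < int n" and w: "braid_word n w" using Cons.prems by auto
  note sh = shift_letter[OF k(1), of m]
  have k': "shift_letter m k \<noteq> 0" "\<bar>shift_letter m k\<bar> < int N" using sh k N by auto
  have w': "braid_word N (map (shift_letter m) w)" using braid_word_shift[OF w] N by simp
  let ?h = "word_isotopy N r (map (shift_letter m) w)"
  define CK where "CK = strands n (\<lambda>(t, z). letter_twist N r (shift_letter m k) t z) c"
  define CW where "CW = (\<lambda>t. strands n ?h c t \<circ> ?\<pi>)"
  define R where "R = (\<lambda>t. reversepath ?A t \<circ> end_position w \<circ> ?\<pi>)"
  define A\<pi> where "A\<pi> = (\<lambda>t. ?A t \<circ> ?\<pi>)"
  note perm = letter_perm_permutes[OF k]
  have c\<pi>: "c \<circ> ?\<pi> \<in> ?X" by (rule configurations_perm[OF c_configuration perm])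
  have CK: "path CK" "path_image CK \<subseteq> ?X" "pathstart CK = c" "pathfinish CK = c \<circ> ?\<pi>"
    using strands_path[OF letter_twist_isotopy[OF k'] c_configuration] map_points_letter[OF k]
    unfolding CK_def by simp_all
  have CW_eq: "CW = strands n ?h (c \<circ> ?\<pi>)"
  proof (intro ext)
    fix t j
    show "CW t j = strands n ?h (c \<circ> ?\<pi>) t j"
    proof (cases "j < n")
      case True
      then have "?\<pi> j < n" using perm(1) by (auto simp: bij_betw_def)
      then show ?thesis using True by (simp add: CW_def strands_def)
    next
      case False
      then show ?thesis using perm(2)[of j] by (simp add: CW_def strands_def)
    qed
  qed
  have CW: "path CW" "path_image CW \<subseteq> ?X" "pathstart CW = c \<circ> ?\<pi>"
    using strands_path[OF word_isotopy[OF w'] c\<pi>] unfolding CW_eq by simp_all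
  note A = path_slide_path[OF c_chain c_zero] and A_ends = slide_path_ends[OF c_chain c_zero]
  from homotopic_paths_perm[OF Cons.IH[OF w] perm]
  have IH: "homotopic_paths ?X (A\<pi> +++ (CW +++ R)) (\<lambda>t. word_path n w t \<circ> ?\<pi>)"
    unfolding join_perm A\<pi>_def CW_def R_def .
  have P1: "path (A\<pi> +++ (CW +++ R))" and I1: "path_image (A\<pi> +++ (CW +++ R)) \<subseteq> ?X"
    using homotopic_paths_imp_path[OF IH] homotopic_paths_imp_subset[OF IH] by auto
  have A\<pi>_ends: "pathstart A\<pi> = base_point n \<circ> ?\<pi>" "pathfinish A\<pi> = c \<circ> ?\<pi>"
    unfolding A\<pi>_def pathstart_def pathfinish_def by (simp_all add: A_ends)
  have A\<pi>: "path A\<pi>" "path_image A\<pi> \<subseteq> ?X"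
    using homotopic_paths_perm[OF _ perm, of ?A ?A] A unfolding A\<pi>_def by simp_all
  have R0: "pathstart R = c \<circ> end_position w \<circ> ?\<pi>"
    unfolding R_def pathstart_def reversepath_def by (simp add: A_ends)
  have CW1: "pathfinish CW = c \<circ> end_position w \<circ> ?\<pi>"
  proof -
    have "pathfinish (strands n ?h c) = map_points n (word_map N r (map (shift_letter m) w)) c"
      by (rule strands_path(4)[OF word_isotopy[OF w'] c_configuration])
    also have "\<dots> = c \<circ> end_position w"
    proof
      fix j
      show "map_points n (word_map N r (map (shift_letter m) w)) c j = (c \<circ> end_position w) j"
      proof (cases "j < n")
        case True
        then have "end_position w j < n" using permutes_in_image[OF end_position_permutes[OF w], of j] by simp
        then show ?thesis
          using True word_map_point[OF w', of "m + j"] end_position_shift[OF w, of m j] N by (simp add: map_points_def c_def)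
      next
        case False
        then show ?thesis using permutes_not_in[OF end_position_permutes[OF w], of j] by (simp add: map_points_def c_def)
      qed
    qed
    finally show ?thesis unfolding CW_def pathfinish_def by simp
  qed
  have R: "path R" "path_image R \<subseteq> ?X"
  proof -
    have e: "bij_betw (end_position w) {..<n} {..<n}" "\<And>j. j \<ge> n \<Longrightarrow> end_position w j = j"
      using end_position_permutes[OF w] by (auto simp: permutes_imp_bij permutes_not_in)
    have "homotopic_paths ?X (reversepath ?A) (reversepath ?A)" using A by simp
    from homotopic_paths_perm[OF homotopic_paths_perm[OF this e] perm]
    show "path R" "path_image R \<subseteq> ?X" unfolding R_def by (simp_all add: o_assoc)
  qed
  obtain \<eta> where \<eta>: "0 < \<eta>" "\<eta> \<le> 1"
    and sq: "homotopic_paths ?X (?A +++ CK)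
       ((\<lambda>t. twisted n (base_point n) (nat \<bar>k\<bar>) \<eta> (turn (of_int (sgn k) * t))) +++ A\<pi>)"
  proof (rule slide_twisted[OF c_chain c_zero k])
    have i: "0 < nat \<bar>k\<bar>" "nat \<bar>k\<bar> < n" using k by auto
    show "0 < clearance N r (m + nat \<bar>k\<bar>)" using clearance_bounds[of "m + nat \<bar>k\<bar>"] i N by simp
    show "clearance N r (m + nat \<bar>k\<bar>) \<le> clearance n c (nat \<bar>k\<bar>)" by (rule clearance_shift[OF i])
  qed (use that in \<open>simp_all add: CK_def strands_letter[OF k] A\<pi>_def\<close>)
  define L where "L = (\<lambda>t. twisted n (base_point n) (nat \<bar>k\<bar>) \<eta> (turn (of_int (sgn k) * t)))"
  have L: "homotopic_paths ?X L (half_twist n k)"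
    unfolding L_def by (rule homotopic_twisted_half_twist[OF k \<eta>])
  have L': "path L" "path_image L \<subseteq> ?X"
    using homotopic_paths_imp_path[OF L] homotopic_paths_imp_subset[OF L] by auto
  have L1: "pathfinish L = base_point n \<circ> ?\<pi>"
  proof -
    have "turn (of_int (sgn k) * 1) = -1" using k by (cases "k > 0") (auto simp: sgn_if)
    moreover have "base_point n j = 0" if "j \<ge> n" for j using that by (simp add: base_point_def)
    ultimately show ?thesis unfolding L_def pathfinish_def
      using twisted_perm(2)[of k n "base_point n" \<eta>] k by simp
  qed
  have CWR: "path (CW +++ R)" "path_image (CW +++ R) \<subseteq> ?X" "pathstart (CW +++ R) = c \<circ> ?\<pi>"
    using CW R CW1 R0 subset_path_image_join[OF CW(2) R(2)] by simp_all
  have A0: "pathfinish ?A = c" by (simp add: pathfinish_def A_ends)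
  \<comment> \<open>The exchange of \<open>?A +++ CK\<close> for \<open>L +++ A\<pi>\<close> needs the paths bracketed accordingly.\<close>
  have "homotopic_paths ?X (?A +++ ((CK +++ CW) +++ R)) (?A +++ (CK +++ (CW +++ R)))"
    by (intro homotopic_paths_join homotopic_paths_sym[OF homotopic_paths_assoc])
       (use A CK CW R CW1 R0 A0 in auto)
  also have "homotopic_paths ?X (?A +++ (CK +++ (CW +++ R))) ((?A +++ CK) +++ (CW +++ R))"
    by (intro homotopic_paths_assoc) (use A CK CWR A0 in auto)
  also have "homotopic_paths ?X ((?A +++ CK) +++ (CW +++ R)) ((L +++ A\<pi>) +++ (CW +++ R))"
    by (rule homotopic_paths_join[OF sq[folded L_def]]) (use CWR CK in simp_all)
  also have "homotopic_paths ?X ((L +++ A\<pi>) +++ (CW +++ R)) (L +++ (A\<pi> +++ (CW +++ R)))"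
    by (intro homotopic_paths_sym[OF homotopic_paths_assoc]) (use L' L1 A\<pi> A\<pi>_ends CWR in auto)
  also have "homotopic_paths ?X (L +++ (A\<pi> +++ (CW +++ R))) (half_twist n k +++ (\<lambda>t. word_path n w t \<circ> ?\<pi>))"
    by (intro homotopic_paths_join L IH) (use L1 A\<pi>_ends in auto)
  finally have "homotopic_paths ?X (?A +++ ((CK +++ CW) +++ R)) (half_twist n k +++ (\<lambda>t. word_path n w t \<circ> ?\<pi>))" .
  moreover have "strands n (word_isotopy N r (map (shift_letter m) (k # w))) c = CK +++ CW"
    using strands_join[OF letter_twist_isotopy[OF k'] c_configuration, of ?h]
    unfolding map_points_letter[OF k] CK_def CW_eq by simp
  ultimately show ?case unfolding R_def by (simp add: o_def)
qed

text \<open>The two sides only differ in the way the concatenated paths are bracketed.\<close>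

lemma strands_append:
  assumes "braid_word N u" "braid_word N v" "x \<in> configurations n"
  shows "homotopic_paths (configurations n) (strands n (word_isotopy N r (u @ v)) x)
    (strands n (word_isotopy N r u) x +++ strands n (word_isotopy N r v) (map_points n (word_map N r u) x))"
  using assms
proof (induction u arbitrary: x)
  case Nil
  have x0: "x j = 0" if "j \<ge> n" for j using Nil.prems(3) that by (auto simp: configurations_def)
  have 1: "strands n snd x = (\<lambda>t. x)" "map_points n id x = x"
    using x0 by (auto simp: fun_eq_iff strands_def map_points_def)
  note p = strands_path[OF word_isotopy[OF Nil.prems(2)] Nil.prems(3)]
  show ?case unfolding append_Nil word_isotopy.simps(1) word_map.simps(1) 1
    by (intro homotopic_paths_sym[OF homotopic_paths_const_join] p) (simp add: p)
next
  case (Cons k u)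
  let ?X = "configurations n" and ?x = "map_points n (letter_twist N r k 1) x"
  have k: "k \<noteq> 0" "\<bar>k\<bar> < int N" and u: "braid_word N u" using Cons.prems by auto
  note pk = strands_path[OF letter_twist_isotopy[OF k] Cons.prems(3)]
  note pu = strands_path[OF word_isotopy[OF u] pk(5)]
  note pv = strands_path[OF word_isotopy[OF Cons.prems(2)] pu(5)]
  have split: "strands n (word_isotopy N r (k # w)) x =
      strands n (\<lambda>(t, z). letter_twist N r k t z) x +++ strands n (word_isotopy N r w) ?x" for w
    using strands_join[OF letter_twist_isotopy[OF k] Cons.prems(3)] by simp
  have comp: "map_points n (word_map N r (k # u)) x = map_points n (word_map N r u) ?x"
    by (auto simp: map_points_def fun_eq_iff)
  have IH: "homotopic_paths ?X (strands n (word_isotopy N r (u @ v)) ?x)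
    (strands n (word_isotopy N r u) ?x +++ strands n (word_isotopy N r v) (map_points n (word_map N r u) ?x))"
    by (rule Cons.IH[OF u Cons.prems(2) pk(5)])
  have start: "pathstart (strands n (word_isotopy N r (u @ v)) ?x) = ?x"
    using homotopic_paths_imp_pathstart[OF IH] pu(3) by simp
  have "homotopic_paths ?X
    (strands n (\<lambda>(t, z). letter_twist N r k t z) x +++ strands n (word_isotopy N r (u @ v)) ?x)
    (strands n (\<lambda>(t, z). letter_twist N r k t z) x +++
      (strands n (word_isotopy N r u) ?x +++ strands n (word_isotopy N r v) (map_points n (word_map N r u) ?x)))"
    by (rule homotopic_paths_join[OF _ IH]) (use pk start in auto)
  also have "homotopic_paths ?X \<dots>
    ((strands n (\<lambda>(t, z). letter_twist N r k t z) x +++ strands n (word_isotopy N r u) ?x) +++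
       strands n (word_isotopy N r v) (map_points n (word_map N r u) ?x))"
    by (rule homotopic_paths_assoc) (use pk pu pv in auto)
  finally show ?case unfolding append_Cons split comp .
qed

text \<open>On a horizontal segment the ellipse does not reach beyond the end points.\<close>

lemma twist_horizontal:
  assumes "Re a < Re b" "Im a = Im b" "0 < \<eta>" "cmod \<zeta> = 1"
  shows "from_unit a b (stretch \<eta> \<zeta>) = b \<or> lex_less (from_unit a b (stretch \<eta> \<zeta>)) b"
proof -
  have im: "Im ((b - a) / 2) = 0" and re: "Re ((b - a) / 2) > 0" using assms by simp_all
  have 1: "Re (from_unit a b (stretch \<eta> \<zeta>)) = Re ((a + b) / 2) + Re ((b - a) / 2) * Re \<zeta>"
    unfolding from_unit_def using im by simp
  have le: "Re \<zeta> \<le> 1" using assms(4) complex_Re_le_cmod[of \<zeta>] by simp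
  show ?thesis
  proof (cases "Re \<zeta> = 1")
    case True
    have "(Re \<zeta>)\<^sup>2 + (Im \<zeta>)\<^sup>2 = 1" using assms(4) cmod_power2[of \<zeta>] by simp
    then have "\<zeta> = 1" using True by (simp add: complex_eq_iff)
    moreover have "stretch \<eta> 1 = 1" by (simp add: complex_eq_iff)
    ultimately show ?thesis by simp
  next
    case False
    then have "Re ((b - a) / 2) * Re \<zeta> < Re ((b - a) / 2) * 1" using le re by (intro mult_strict_left_mono) auto
    then have "Re (from_unit a b (stretch \<eta> \<zeta>)) < Re b" unfolding 1 by (simp add: field_simps)
    then show ?thesis by (simp add: lex_less_def)
  qed
qed

context
  fixes u :: "int list"
  assumes u: "\<forall>k\<in>set u. k \<noteq> 0 \<and> nat \<bar>k\<bar> \<le> m" and n: "0 < n"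
    and level: "\<And>i. 0 < i \<Longrightarrow> i \<le> m \<Longrightarrow> Im (r (i - 1)) = Im (r i) \<and> Re (r (i - 1)) < Re (r i)"
begin

lemma prefix_braid_word: "braid_word N u"
  using u N n unfolding braid_word_def by fastforce

text \<open>For letters of index at most \<open>m\<close> only horizontal segments to the left of \<open>r m\<close> are involved.\<close>

lemma prefix_letter:
  assumes k: "k \<noteq> 0" "nat \<bar>k\<bar> \<le> m" and j: "j \<le> m"
  shows "letter_twist N r k t (r j) = r m \<or> lex_less (letter_twist N r k t (r j)) (r m)"
    and "letter_perm k j \<le> m"
proof -
  have k': "k \<noteq> 0" "\<bar>k\<bar> < int N" using k N n by auto
  let ?i = "nat \<bar>k\<bar>"
  have i: "0 < ?i" "?i \<le> m" using k by auto
  have upto: "x = r m \<or> lex_less x (r m)" if "x = r l \<or> lex_less x (r l)" "l \<le> m" for x l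
    using that sorted[of l m] N n lex_less_trans[of x "r l" "r m"] by (cases "l = m") auto
  have minus: "- stretch \<eta> z = stretch \<eta> (- z)" for \<eta> z by (simp add: complex_eq_iff)
  have clear: "0 < clearance N r ?i" using clearance_bounds[of ?i] i N n by simp
  have lv: "Re (r (?i - 1)) < Re (r ?i)" "Im (r (?i - 1)) = Im (r ?i)" using level[OF i] by auto
  show "letter_twist N r k t (r j) = r m \<or> lex_less (letter_twist N r k t (r j)) (r m)"
  proof (cases "j = ?i - 1 \<or> j = ?i")
    case True
    then show ?thesis
    proof
      assume 1: "j = ?i - 1"
      show ?thesis unfolding 1 letter_twist_ends(1)[OF k'] minus
        by (rule upto[OF twist_horizontal[OF lv clear] i(2)]) simp
    next
      assume 1: "j = ?i"
      show ?thesis unfolding 1 letter_twist_ends(2)[OF k']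
        by (rule upto[OF twist_horizontal[OF lv clear] i(2)]) simp
    qed
  next
    case False
    then have "letter_twist N r k t (r j) = r j"
      using letter_twist_other[OF k', of j t] j N n by simp
    then show ?thesis using upto[of "r j" j] j by simp
  qed
  show "letter_perm k j \<le> m" using letter_perm_simps(1,2)[of k] letter_perm_simps(3)[of j k] i j
    by (metis diff_le_self le_trans)
qed

lemma prefix_path:
  shows "j \<le> m \<Longrightarrow> word_isotopy N r u (t, r j) = r m \<or> lex_less (word_isotopy N r u (t, r j)) (r m)"
    and "m < j \<Longrightarrow> j < N \<Longrightarrow> word_isotopy N r u (t, r j) = r j"
proof -
  have "(j \<le> m \<longrightarrow> word_isotopy N r v (t, r j) = r m \<or> lex_less (word_isotopy N r v (t, r j)) (r m)) \<and>
        (m < j \<longrightarrow> j < N \<longrightarrow> word_isotopy N r v (t, r j) = r j)" if "\<forall>k\<in>set v. k \<noteq> 0 \<and> nat \<bar>k\<bar> \<le> m" for v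
    using that
  proof (induction v arbitrary: j t)
    case Nil
    show ?case using sorted[of j m] N n by (cases "j = m") auto
  next
    case (Cons k v)
    have k: "k \<noteq> 0" "nat \<bar>k\<bar> \<le> m" and v: "\<forall>k\<in>set v. k \<noteq> 0 \<and> nat \<bar>k\<bar> \<le> m" using Cons.prems by auto
    have k': "k \<noteq> 0" "\<bar>k\<bar> < int N" using k N n by auto
    have eq: "word_isotopy N r (k # v) (t, r j) =
      (if t \<le> 1 / 2 then letter_twist N r k (2 * t) (r j) else word_isotopy N r v (2 * t - 1, letter_twist N r k 1 (r j)))"
      by (simp add: isotopy_join_def)
    show ?case
    proof (intro conjI impI)
      assume j: "j \<le> m"
      then have "letter_twist N r k 1 (r j) = r (letter_perm k j)" using letter_twist_perm[OF k'] N n by simp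
      then show "word_isotopy N r (k # v) (t, r j) = r m \<or> lex_less (word_isotopy N r (k # v) (t, r j)) (r m)"
        unfolding eq using prefix_letter[OF k j] Cons.IH[OF v] by simp
    next
      assume j: "m < j" "j < N"
      then have "letter_twist N r k s (r j) = r j" for s using letter_twist_other[OF k', of j] k by simp
      then show "word_isotopy N r (k # v) (t, r j) = r j" unfolding eq using Cons.IH[OF v] j by simp
    qed
  qed
  with u show "j \<le> m \<Longrightarrow> word_isotopy N r u (t, r j) = r m \<or> lex_less (word_isotopy N r u (t, r j)) (r m)"
    and "m < j \<Longrightarrow> j < N \<Longrightarrow> word_isotopy N r u (t, r j) = r j" by blast+
qed

text \<open>Only the first strand of the configuration moves, and it always precedes the others in the order.\<close>

lemma prefix_null_homotopic:
  assumes closed: "end_position u m = m"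
  shows "homotopic_paths (configurations n) (strands n (word_isotopy N r u) c) (\<lambda>t. c)"
    and "map_points n (word_map N r u) c = c"
proof -
  note p = strands_path[OF word_isotopy[OF prefix_braid_word] c_configuration]
  have fixed: "strands n (word_isotopy N r u) c t j = c j" if "j \<noteq> 0" for t j
    using prefix_path(2)[of "m + j" t] that N by (simp add: strands_def c_def)
  have zero: "strands n (word_isotopy N r u) c t 0 = c 0 \<or> lex_less (strands n (word_isotopy N r u) c t 0) (c 0)" for t
    using prefix_path(1)[of m t] n by (simp add: strands_def c_def)
  show map: "map_points n (word_map N r u) c = c"
  proof
    fix j
    show "map_points n (word_map N r u) c j = c j"
    proof (cases "j = 0")
      case True
      then show ?thesis using word_map_point[OF prefix_braid_word, of m] closed n N by (simp add: map_points_def c_def)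
    next
      case False
      then show ?thesis using p(4) fixed[OF False, of 1] unfolding pathfinish_def by metis
    qed
  qed
  show "homotopic_paths (configurations n) (strands n (word_isotopy N r u) c) (\<lambda>t. c)"
  proof (rule homotopic_paths_straight)
    show "strands n (word_isotopy N r u) c 0 = c" using p(3) unfolding pathstart_def .
    show "strands n (word_isotopy N r u) c 1 = c" using p(4) map unfolding pathfinish_def by simp
    fix s t :: real assume s: "s \<in> {0..1}" and t: "t \<in> {0..1}"
    let ?z = "strands n (word_isotopy N r u) c t 0"
    define x where "x = (1 - s) *\<^sub>R ?z + s *\<^sub>R c 0"
    have same: "(1 - s) *\<^sub>R c j + s *\<^sub>R c j = c j" for j by (simp add: scaleR_left_diff_distrib)
    have eq: "(\<lambda>j. (1 - s) *\<^sub>R strands n (word_isotopy N r u) c t j + s *\<^sub>R c j) = (\<lambda>j. if j = 0 then x else c j)"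
      using fixed same by (auto simp: x_def fun_eq_iff)
    have "?z \<in> cball 0 1" "c 0 \<in> cball 0 1"
      using p(2) t configurations_cball[OF _ n] c_configuration unfolding path_image_def by blast+
    then have x1: "x \<in> cball 0 1" unfolding x_def using s by (intro convexD_alt convex_cball) auto
    have less: "lex_less x (c j)" if j: "0 < j" "j < n" for j
    proof -
      have 1: "lex_less (c 0) (c j)" using lex_chain.sorted[OF c_chain j] .
      then have "lex_less ?z (c j)" using zero[of t] lex_less_trans by auto
      then have "lex_less ((1 - s) *\<^sub>R ?z + s *\<^sub>R c 0) ((1 - s) *\<^sub>R c j + s *\<^sub>R c j)"
        by (rule lex_less_convex) (use 1 s in auto)
      then show ?thesis unfolding same x_def .
    qed
    show "(\<lambda>j. (1 - s) *\<^sub>R strands n (word_isotopy N r u) c t j + s *\<^sub>R c j) \<in> configurations n"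
      unfolding eq
    proof (rule configurationsI)
      fix i j assume ij: "i < n" "j < n" "i < j"
      show "(if i = 0 then x else c i) \<noteq> (if j = 0 then x else c j)"
        using less[of j] lex_less_irrefl lex_chain.distinct_points[OF c_chain, of i j] ij by (cases "i = 0") auto
    next
      fix i assume "i < n"
      then show "cmod (if i = 0 then x else c i) \<le> 1"
        using x1 configurations_cball[OF c_configuration] by simp
    qed (use n in \<open>auto simp: c_zero\<close>)
  qed (use p in \<open>simp_all add: path_def\<close>)
qed

text \<open>The strands of the prefix form a contractible loop, which can be dropped.\<close>

lemma slide_total_strands:
  assumes closed: "end_position u m = m" and w: "braid_word n w"
  shows "homotopic_paths (configurations n)
     (slide_path n c +++ (strands n (word_isotopy N r (u @ map (shift_letter m) w)) c +++
        (\<lambda>t. reversepath (slide_path n c) t \<circ> end_position w)))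
     (word_path n w)"
proof -
  let ?X = "configurations n" and ?v = "map (shift_letter m) w"
  have v: "braid_word N ?v" using braid_word_shift[OF w] N by simp
  note pu = strands_path[OF word_isotopy[OF prefix_braid_word] c_configuration]
  note pv = strands_path[OF word_isotopy[OF v] c_configuration]
  note null = prefix_null_homotopic[OF closed]
  have h0: "homotopic_paths ?X (strands n (word_isotopy N r (u @ ?v)) c)
      (strands n (word_isotopy N r u) c +++ strands n (word_isotopy N r ?v) c)"
    using strands_append[OF prefix_braid_word v c_configuration] unfolding null(2) .
  also have "homotopic_paths ?X \<dots> ((\<lambda>t. c) +++ strands n (word_isotopy N r ?v) c)"
    by (rule homotopic_paths_join[OF null(1)]) (use pu pv null(2) in auto)
  also have "homotopic_paths ?X \<dots> (strands n (word_isotopy N r ?v) c)"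
    by (rule homotopic_paths_const_join) (use pv in auto)
  finally have h: "homotopic_paths ?X (strands n (word_isotopy N r (u @ ?v)) c) (strands n (word_isotopy N r ?v) c)" .
  let ?R = "\<lambda>t. reversepath (slide_path n c) t \<circ> end_position w"
  note A = path_slide_path[OF c_chain c_zero] and A_ends = slide_path_ends[OF c_chain c_zero]
  have e: "bij_betw (end_position w) {..<n} {..<n}" "\<And>j. j \<ge> n \<Longrightarrow> end_position w j = j"
    using end_position_permutes[OF w] by (auto simp: permutes_imp_bij permutes_not_in)
  have R: "homotopic_paths ?X ?R ?R"
    using homotopic_paths_perm[OF _ e, of "reversepath (slide_path n c)" "reversepath (slide_path n c)"] A by simp
  have R0: "pathstart ?R = c \<circ> end_position w" unfolding pathstart_def reversepath_def by (simp add: A_ends)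
  have e1: "map_points n (word_map N r ?v) c = c \<circ> end_position w"
  proof
    fix j
    show "map_points n (word_map N r ?v) c j = (c \<circ> end_position w) j"
    proof (cases "j < n")
      case True
      then have "end_position w j < n" using permutes_in_image[OF end_position_permutes[OF w], of j] by simp
      then show ?thesis
        using True word_map_point[OF v, of "m + j"] end_position_shift[OF w, of m j] N by (simp add: map_points_def c_def)
    next
      case False
      then show ?thesis using e(2)[of j] by (simp add: map_points_def c_def)
    qed
  qed
  have tail: "homotopic_paths ?X (strands n (word_isotopy N r (u @ ?v)) c +++ ?R) (strands n (word_isotopy N r ?v) c +++ ?R)"
    by (rule homotopic_paths_join[OF h R])
       (use homotopic_paths_imp_pathfinish[OF h] pv(4) e1 R0 in simp)
  have A': "homotopic_paths ?X (slide_path n c) (slide_path n c)" using A by simp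
  have ends: "pathfinish (slide_path n c) = pathstart (strands n (word_isotopy N r (u @ ?v)) c +++ ?R)"
    using homotopic_paths_imp_pathstart[OF h] pv(3) A_ends by (simp add: pathfinish_def)
  have "homotopic_paths ?X (slide_path n c +++ (strands n (word_isotopy N r (u @ ?v)) c +++ ?R))
     (slide_path n c +++ (strands n (word_isotopy N r ?v) c +++ ?R))"
    by (rule homotopic_paths_join[OF A' tail ends])
  then show ?thesis using slide_word_strands[OF w] by (rule homotopic_paths_trans)
qed

end

end

section \<open>The points in lexicographic order\<close>

definition sorted_point :: "complex set \<Rightarrow> nat \<Rightarrow> complex" where
  "sorted_point P = inv_into P (lex_rank P)"

lemma lex_rank_strict_mono:
  assumes "finite P" "x \<in> P" "lex_less x y"
  shows "lex_rank P x < lex_rank P y"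
  unfolding lex_rank_def
proof (rule psubset_card_mono)
  show "finite {z' \<in> P. lex_less z' y}" using assms by simp
  show "{z' \<in> P. lex_less z' x} \<subset> {z' \<in> P. lex_less z' y}"
    using assms lex_less_trans lex_less_irrefl by blast
qed

lemma lex_rank_bij:
  assumes P: "finite P"
  shows "bij_betw (lex_rank P) P {..<card P}"
proof -
  have inj: "inj_on (lex_rank P) P"
  proof (rule inj_onI)
    fix x y assume "x \<in> P" "y \<in> P" "lex_rank P x = lex_rank P y"
    then show "x = y"
      using lex_rank_strict_mono[OF P, of x y] lex_rank_strict_mono[OF P, of y x] lex_less_linear[of x y] by auto
  qed
  have "lex_rank P x < card P" if "x \<in> P" for x
    unfolding lex_rank_def
    by (rule psubset_card_mono[OF P]) (use that lex_less_irrefl in blast)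
  then have "lex_rank P ` P \<subseteq> {..<card P}" by auto
  moreover have "card (lex_rank P ` P) = card {..<card P}" using card_image[OF inj] by simp
  ultimately have "lex_rank P ` P = {..<card P}" by (intro card_subset_eq) auto
  with inj show ?thesis unfolding bij_betw_def by simp
qed

lemma sorted_point:
  assumes P: "finite P"
  shows "bij_betw (sorted_point P) {..<card P} P"
    and "j < card P \<Longrightarrow> lex_rank P (sorted_point P j) = j"
    and "i < j \<Longrightarrow> j < card P \<Longrightarrow> lex_less (sorted_point P i) (sorted_point P j)"
proof -
  show bij: "bij_betw (sorted_point P) {..<card P} P"
    unfolding sorted_point_def by (rule bij_betw_inv_into[OF lex_rank_bij[OF P]])
  have rank: "lex_rank P (sorted_point P j) = j" if "j < card P" for j
    unfolding sorted_point_def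
    using f_inv_into_f[of j "lex_rank P" P] lex_rank_bij[OF P] that unfolding bij_betw_def by auto
  then show "j < card P \<Longrightarrow> lex_rank P (sorted_point P j) = j" .
  assume ij: "i < j" "j < card P"
  have mem: "sorted_point P i \<in> P" "sorted_point P j \<in> P" using bij ij unfolding bij_betw_def by auto
  show "lex_less (sorted_point P i) (sorted_point P j)"
    using lex_less_linear[of "sorted_point P i" "sorted_point P j"] lex_rank_strict_mono[OF P mem(2), of "sorted_point P i"]
      rank[of i] rank[of j] ij by auto
qed

text \<open>The new periodic points are placed on a horizontal segment that ends in the first point. Its length is
  less than \<open>(1 - x\<^sup>2) / 2 \<le> 1 - x\<close>, where \<open>x\<close> is the modulus of the first point, so it stays in the disc.\<close>

definition chain_point :: "complex set \<Rightarrow> nat \<Rightarrow> nat \<Rightarrow> complex" where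
  "chain_point P m j =
     (if j < m
      then sorted_point P 0 - of_real (real (m - j) * ((1 - (cmod (sorted_point P 0))\<^sup>2) / (2 * (real m + 1))))
      else sorted_point P (j - m))"

text \<open>A full twist of the last new point about the first old one makes the orbits linked; then the new points
  are permuted cyclically.\<close>

definition prefix_word :: "nat \<Rightarrow> int list" where
  "prefix_word m = int m # int m # map int [1..<m]"

definition total_word :: "nat \<Rightarrow> int list \<Rightarrow> int list" where
  "total_word m w = prefix_word m @ map (shift_letter m) w"

text \<open>The letters \<open>a, \<dots>, m - 1\<close> carry the strand in position \<open>a - 1\<close> all the way to position \<open>m - 1\<close>, and each
  strand that it passes moves one position down.\<close>

lemma end_position_cycle:
  assumes "0 < a" "a \<le> m"
  shows "end_position (map int [a..<m]) j = (if j = a - 1 then m - 1 else if a \<le> j \<and> j < m then j - 1 else j)"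
  using assms
proof (induction "m - a" arbitrary: a j)
  case 0
  then show ?case by auto
next
  case (Suc d)
  then have a: "a < m" "[a..<m] = a # [Suc a..<m]" by (auto simp: upt_conv_Cons)
  have IH: "end_position (map int [Suc a..<m]) i =
      (if i = a then m - 1 else if Suc a \<le> i \<and> i < m then i - 1 else i)" for i
    using Suc.hyps(1)[of "Suc a" i] Suc.hyps(2) Suc.prems a by auto
  have p: "letter_perm (int a) i = (if i = a - 1 then a else if i = a then a - 1 else i)" for i
    using Suc.prems by (auto simp: letter_perm_def Transposition.transpose_def)
  show ?case unfolding a(2) using Suc.prems a(1) by (auto simp: IH p)
qed

lemma end_position_full_twist: "end_position (k # k # w) = end_position w"
  by (simp add: fun_eq_iff letter_perm_def)

lemma end_position_prefix:
  assumes "0 < m"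
  shows "end_position (prefix_word m) j = (if j = 0 then m - 1 else if j < m then j - 1 else j)"
  unfolding prefix_word_def end_position_full_twist using end_position_cycle[of 1 m j] assms by auto

lemma braid_word_total:
  assumes "0 < n" "0 < m" "braid_word n w"
  shows "braid_word (m + n) (total_word m w)"
proof -
  have "braid_word (m + n) (map int [1..<m])" unfolding braid_word_def using assms by auto
  then show ?thesis using braid_word_shift[OF assms(3), of m] assms
    unfolding total_word_def prefix_word_def by (auto simp: braid_word_def)
qed

lemma end_position_total:
  assumes "0 < m" "braid_word n w"
  shows "end_position (total_word m w) (m + j) = m + end_position w j"
    and "j < m \<Longrightarrow> end_position (total_word m w) j = (if j = 0 then m - 1 else j - 1)"
proof -
  show "end_position (total_word m w) (m + j) = m + end_position w j"
    unfolding total_word_def end_position_append comp_apply end_position_prefix[OF assms(1)]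
    using end_position_shift[OF assms(2)] assms(1) by simp
  show "j < m \<Longrightarrow> end_position (total_word m w) j = (if j = 0 then m - 1 else j - 1)"
    unfolding total_word_def end_position_append comp_apply end_position_prefix[OF assms(1)]
    using end_position_shift_less[OF assms(2)] assms(1) by simp
qed

section \<open>Periodic orbits\<close>

lemma periodic_orbit_index:
  assumes inj: "inj_on r S" and S: "finite S" "i0 \<in> S" and X: "r ` S \<subseteq> X"
    and E: "\<And>i. i \<in> S \<Longrightarrow> E i \<in> S" "\<And>i. i \<in> S \<Longrightarrow> f (r i) = r (E i)"
    and trans: "\<And>j. j \<in> S \<Longrightarrow> \<exists>k>0. (E ^^ k) i0 = j"
  shows "periodic_orbit X f (card S) (r ` S)"
proof -
  have it: "(E ^^ k) i0 \<in> S \<and> (f ^^ k) (r i0) = r ((E ^^ k) i0)" for k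
    by (induction k) (use S E in auto)
  have "r ` S = forward_orbit f (r i0)"
  proof
    show "r ` S \<subseteq> forward_orbit f (r i0)"
    proof
      fix x assume "x \<in> r ` S"
      then obtain j k where "j \<in> S" "x = r j" "(E ^^ k) i0 = j" using trans by blast
      then have "x = (f ^^ k) (r i0)" using it[of k] by simp
      then show "x \<in> forward_orbit f (r i0)" unfolding forward_orbit_def by blast
    qed
    show "forward_orbit f (r i0) \<subseteq> r ` S" unfolding forward_orbit_def using it by auto
  qed
  moreover have "periodic_point f (r i0)"
    unfolding periodic_point_def using trans[OF S(2)] it by metis
  moreover have "card (r ` S) = card S" by (rule card_image[OF inj])
  ultimately show ?thesis unfolding periodic_orbit_def using X S(2) by blast
qed

text \<open>As words are read in the direction of time, strands move by the inverse of \<open>word_perm w\<close>. With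
  \<open>\<sigma>\<close> the cycle on \<open>cs\<close>, the strand in position \<open>cs ! 0\<close> reaches \<open>cs ! b\<close> after \<open>n - b\<close> steps.\<close>

lemma end_position_cyclic:
  assumes w: "braid_word n w" "cyclic_word n w" and n: "0 < n"
  obtains i0 where "i0 < n" "\<And>j. j < n \<Longrightarrow> \<exists>k>0. (end_position w ^^ k) i0 = j"
proof -
  obtain cs where cs: "distinct cs" "set cs = {..<n}" "word_perm w = cycle_of_list cs"
    using w(2) unfolding cyclic_word_def by blast
  let ?\<sigma> = "cycle_of_list cs" and ?E = "end_position w"
  have len: "length cs = n" using distinct_card[OF cs(1)] cs(2) by simp
  have rot: "(?\<sigma> ^^ k) (cs ! 0) = cs ! (k mod n)" for k
  proof -
    have "map (?\<sigma> ^^ k) cs ! 0 = rotate k cs ! 0" using cyclic_rotation[of cs k] cs(1) by simp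
    then show ?thesis using len n by (simp add: nth_rotate)
  qed
  have inv: "?E (?\<sigma> i) = i" for i
  proof -
    obtain x where "i = ?E x" using permutes_surj[OF end_position_permutes[OF w(1)]] by (metis surjD)
    then show ?thesis using word_perm_end_position[of w x] cs(3) by simp
  qed
  have invk: "(?E ^^ k) ((?\<sigma> ^^ k) i) = i" for k i
  proof (induction k arbitrary: i)
    case (Suc k)
    have "(?E ^^ Suc k) ((?\<sigma> ^^ Suc k) i) = (?E ^^ k) (?E (?\<sigma> ((?\<sigma> ^^ k) i)))" by (simp add: funpow_swap1)
    then show ?case using Suc.IH inv by simp
  qed simp
  show thesis
  proof (rule that[of "cs ! 0"])
    show "cs ! 0 < n" using cs(2) len n nth_mem[of 0 cs] by auto
    fix j assume "j < n"
    then obtain b where b: "b < n" "j = cs ! b" using cs(2) len by (metis in_set_conv_nth lessThan_iff)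
    have "(?\<sigma> ^^ (n - b)) j = (?\<sigma> ^^ (n - b)) ((?\<sigma> ^^ b) (cs ! 0))" using rot[of b] b by simp
    also have "\<dots> = (?\<sigma> ^^ ((n - b) + b)) (cs ! 0)" unfolding funpow_add comp_apply ..
    also have "\<dots> = cs ! 0" using rot[of n] b by simp
    finally have "(?E ^^ (n - b)) (cs ! 0) = j" using invk[of "n - b" j] by simp
    then show "\<exists>k>0. (?E ^^ k) (cs ! 0) = j" using b by (intro exI[of _ "n - b"]) auto
  qed
qed

section \<open>The homeomorphism\<close>

context
  fixes n m :: nat and P :: "complex set" and w :: "int list" and r :: "nat \<Rightarrow> complex" and f :: "complex \<Rightarrow> complex"
  assumes n: "n \<ge> 2" and P: "P \<subseteq> interior (cball 0 1)" "card P = n"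
    and w: "braid_word n w" "cyclic_word n w" and m: "m > 0"
  defines "r \<equiv> chain_point P m" and "f \<equiv> word_map (m + n) (chain_point P m) (total_word m w)"
begin

lemma finite_P: "finite P"
  using P n by (intro card_ge_0_finite) auto

lemma chain_point_level:
  assumes "0 < i" "i \<le> m"
  shows "Im (r (i - 1)) = Im (r i)" "Re (r (i - 1)) < Re (r i)"
proof -
  let ?p = "sorted_point P 0"
  define \<delta> where "\<delta> = (1 - (cmod ?p)\<^sup>2) / (2 * (real m + 1))"
  have "?p \<in> P" using sorted_point(1)[OF finite_P] P n unfolding bij_betw_def by auto
  then have "cmod ?p < 1" using P by auto
  then have \<delta>: "\<delta> > 0" unfolding \<delta>_def by (simp add: abs_square_less_1)
  have eq: "r j = ?p - of_real (real (m - j) * \<delta>)" if "j \<le> m" for j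
    using that unfolding r_def chain_point_def \<delta>_def by auto
  show "Im (r (i - 1)) = Im (r i)" using assms eq[of i] eq[of "i - 1"] by simp
  have "real (m - i) * \<delta> < real (m - (i - 1)) * \<delta>" using assms \<delta> by (intro mult_strict_right_mono) auto
  then show "Re (r (i - 1)) < Re (r i)" using assms eq[of i] eq[of "i - 1"] by simp
qed

lemma chain_point_chain: "lex_chain (m + n) r"
proof
  have old: "r (m + j) = sorted_point P j" for j by (simp add: r_def chain_point_def)
  have new: "lex_less (r i) (r j)" if "i < j" "j \<le> m" for i j
  proof -
    have "Re (r i) < Re (r j) \<and> Im (r i) = Im (r j)" using that
    proof (induction j)
      case (Suc j)
      then show ?case using chain_point_level[of "Suc j"] by (cases "i = j") auto
    qed simp
    then show ?thesis by (simp add: lex_less_def)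
  qed
  fix i j :: nat
  assume ij: "i < j" "j < m + n"
  have olds: "lex_less (r a) (r b)" if "a < b" "m \<le> a" "b < m + n" for a b
    using sorted_point(3)[OF finite_P, of "a - m" "b - m"] that old[of "a - m"] old[of "b - m"] P(2) by simp
  consider "j \<le> m" | "m \<le> i" | "i < m" "m < j" by linarith
  then show "lex_less (r i) (r j)"
  proof cases
    case 3
    then show ?thesis using new[of i m] olds[of m j] ij lex_less_trans by blast
  qed (use new olds ij in auto)
next
  let ?p = "sorted_point P 0"
  have P_mem: "sorted_point P j \<in> P" if "j < n" for j
    using sorted_point(1)[OF finite_P] P that unfolding bij_betw_def by auto
  fix j assume j: "j < m + n"
  show "cmod (r j) < 1"
  proof (cases "j < m")
    case True
    define x where "x = cmod ?p"
    have x: "0 \<le> x" "x < 1" using P_mem[of 0] P n unfolding x_def by auto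
    have x2: "0 < 1 - x\<^sup>2" using x by (simp add: abs_square_less_1)
    define \<delta> where "\<delta> = (1 - x\<^sup>2) / (2 * (real m + 1))"
    have "\<delta> > 0" using x2 unfolding \<delta>_def by simp
    have "real (m - j) * \<delta> \<le> (real m + 1) * \<delta>" using \<open>\<delta> > 0\<close> by (intro mult_right_mono) auto
    also have "\<dots> = (1 - x\<^sup>2) / 2" unfolding \<delta>_def by (simp add: field_simps)
    also have "\<dots> < 1 - x"
    proof -
      have "(1 - x) * (1 + x) < (1 - x) * 2" using x by (intro mult_strict_left_mono) auto
      then have "1 - x\<^sup>2 < 2 - 2 * x" by (simp add: power2_eq_square algebra_simps)
      then show ?thesis by simp
    qed
    finally have lt: "real (m - j) * \<delta> < 1 - x" .
    have "r j = ?p - of_real (real (m - j) * \<delta>)" using True unfolding r_def chain_point_def \<delta>_def x_def by simp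
    then have "cmod (r j) \<le> x + cmod (of_real (real (m - j) * \<delta>))"
      unfolding x_def using norm_triangle_ineq4 by metis
    also have "cmod (of_real (real (m - j) * \<delta>)) = real (m - j) * \<delta>"
      using \<open>\<delta> > 0\<close> unfolding norm_of_real by simp
    finally show ?thesis using lt by simp
  next
    case False
    then have "r j \<in> P" using P_mem[of "j - m"] j by (simp add: r_def chain_point_def)
    then have "r j \<in> ball 0 1" using P(1) by auto
    then show ?thesis by simp
  qed
qed

interpretation shifted_chain "m + n" r m n
  using chain_point_chain by (intro shifted_chain.intro shifted_chain_axioms.intro) simp_all

lemma f_eq: "f = word_map (m + n) r (total_word m w)"
  by (simp add: f_def r_def)

lemma total_braid_word: "braid_word (m + n) (total_word m w)"
  using braid_word_total[OF _ m w(1)] n by simp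

lemma f_isotopy: "isotopy_from_id (word_isotopy (m + n) r (total_word m w)) f"
  unfolding f_eq by (rule word_isotopy[OF total_braid_word])

lemma P_eq: "P = r ` {m..<m + n}"
proof -
  have "P = sorted_point P ` {..<n}" using sorted_point(1)[OF finite_P] P(2) unfolding bij_betw_def by simp
  also have "\<dots> = r ` (\<lambda>j. j + m) ` {0..<n}"
    unfolding image_image r_def chain_point_def by (intro image_cong) auto
  finally show ?thesis by (simp add: add.commute)
qed

definition new_orbit where "new_orbit = r ` {..<m}"

lemma f_point: "j < m + n \<Longrightarrow> f (r j) = r (end_position (total_word m w) j)"
  unfolding f_eq by (rule word_map_point[OF total_braid_word])

lemma end_old: "j \<in> {m..<m + n} \<Longrightarrow> end_position (total_word m w) j \<in> {m..<m + n}"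
proof -
  assume j: "j \<in> {m..<m + n}"
  then have "end_position w (j - m) < n"
    using permutes_in_image[OF end_position_permutes[OF w(1)], of "j - m"] by auto
  then show ?thesis using end_position_total(1)[OF m w(1), of "j - m"] j by simp
qed

lemma end_new: "j < m \<Longrightarrow> end_position (total_word m w) j < m"
  using end_position_total(2)[OF m w(1), of j] m by auto

lemma P_periodic: "periodic_orbit (cball 0 1) f n P"
proof -
  obtain i0 where i0: "i0 < n" "\<And>j. j < n \<Longrightarrow> \<exists>k>0. (end_position w ^^ k) i0 = j"
    using end_position_cyclic[OF w] n by auto
  have it: "(end_position (total_word m w) ^^ k) (m + i0) = m + (end_position w ^^ k) i0" for k
    by (induction k) (auto simp: end_position_total(1)[OF m w(1)])
  have "periodic_orbit (cball 0 1) f (card {m..<m + n}) (r ` {m..<m + n})"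
  proof (rule periodic_orbit_index[where E = "end_position (total_word m w)" and ?i0.0 = "m + i0"])
    show "inj_on r {m..<m + n}" by (rule inj_on_subset[OF inj_points]) auto
    show "r ` {m..<m + n} \<subseteq> cball 0 1" using points_in_disc by auto
    fix j assume j: "j \<in> {m..<m + n}"
    show "f (r j) = r (end_position (total_word m w) j)" using f_point j by simp
    show "end_position (total_word m w) j \<in> {m..<m + n}" by (rule end_old[OF j])
    have "j - m < n" using j by auto
    then obtain k where "k > 0" "(end_position w ^^ k) i0 = j - m" using i0(2) by blast
    then show "\<exists>k>0. (end_position (total_word m w) ^^ k) (m + i0) = j"
      using it[of k] j by (intro exI[of _ k]) auto
  qed (use i0 in auto)
  then show ?thesis using P_eq by simp
qed

lemma new_orbit_periodic: "periodic_orbit (cball 0 1) f m new_orbit"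
proof -
  let ?E = "end_position (total_word m w)"
  have down: "(?E ^^ k) (m - 1) = m - 1 - k" if "k < m" for k
    using that
  proof (induction k)
    case (Suc k)
    then show ?case using end_position_total(2)[OF m w(1), of "m - 1 - k"] by simp
  qed simp
  have full: "(?E ^^ m) (m - 1) = m - 1"
    using down[of "m - 1"] m end_position_total(2)[OF m w(1), of 0] by (cases m) simp_all
  have "periodic_orbit (cball 0 1) f (card {..<m}) (r ` {..<m})"
  proof (rule periodic_orbit_index[where E = ?E and ?i0.0 = "m - 1"])
    show "inj_on r {..<m}" by (rule inj_on_subset[OF inj_points]) auto
    show "r ` {..<m} \<subseteq> cball 0 1" using points_in_disc by auto
    fix j assume j: "j \<in> {..<m}"
    show "f (r j) = r (?E j)" using f_point j by simp
    show "?E j \<in> {..<m}" using end_new j by simp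
    show "\<exists>k>0. (?E ^^ k) (m - 1) = j"
    proof (cases "j = m - 1")
      case True
      then show ?thesis using full m by (intro exI[of _ m]) simp
    next
      case False
      then show ?thesis using down[of "m - 1 - j"] j by (intro exI[of _ "m - 1 - j"]) auto
    qed
  qed (use m in auto)
  then show ?thesis by (simp add: new_orbit_def)
qed

lemma f_image_P: "f ` P = P" and f_image_new_orbit: "f ` new_orbit = new_orbit"
proof -
  obtain g where g: "homeomorphism (cball 0 1) (cball 0 1) f g"
    using f_isotopy by (rule isotopy_from_id_homeomorphism)
  have inj: "inj_on f (cball 0 1)" using homeomorphism_apply1[OF g] by (rule inj_on_inverseI)
  have *: "f ` A = A" if "A \<subseteq> cball 0 1" "finite A" "f ` A \<subseteq> A" for A
    by (rule endo_inj_surj[OF that(2,3) inj_on_subset[OF inj that(1)]])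
  have disc: "r ` {..<m + n} \<subseteq> cball 0 1" using points_in_disc by auto
  show "f ` P = P"
  proof (rule *)
    show "P \<subseteq> cball 0 1" using disc unfolding P_eq by auto
    show "f ` P \<subseteq> P"
    proof (intro image_subsetI)
      fix x assume "x \<in> P"
      then obtain j where j: "x = r j" "j \<in> {m..<m + n}" using P_eq by blast
      then show "f x \<in> P" using f_point[of j] imageI[OF end_old[OF j(2)], of r] P_eq by simp
    qed
  qed (rule finite_P)
  show "f ` new_orbit = new_orbit"
  proof (rule *)
    show "new_orbit \<subseteq> cball 0 1" using disc unfolding new_orbit_def by auto
    show "f ` new_orbit \<subseteq> new_orbit" unfolding new_orbit_def using f_point end_new by auto
  qed (simp add: new_orbit_def)
qed

text \<open>No letter except the first two has index \<open>m\<close>, so no other letter mixes old and new points.\<close>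

lemma linking_number_total: "linking_number m (total_word m w) = 1"
proof -
  let ?v = "map int [1..<m] @ map (shift_letter m) w"
  have v: "braid_word (m + n) ?v" using total_braid_word unfolding total_word_def prefix_word_def by simp
  have "nat \<bar>k\<bar> \<noteq> m" if "k \<in> set ?v" for k
  proof -
    from that consider "k \<in> set (map int [1..<m])" | "k \<in> set (map (shift_letter m) w)" by auto
    then show ?thesis
    proof cases
      case 1
      then show ?thesis by auto
    next
      case 2
      then obtain l where l: "l \<in> set w" "k = shift_letter m l" by auto
      then have "l \<noteq> 0" using w(1) by (auto simp: braid_word_def)
      then show ?thesis using shift_letter(4)[of l m] l by simp
    qed
  qed
  then have "linking_number m ?v = 0" by (intro linking_number_unmixed v) auto
  then show ?thesis
    using linking_number_full_twist[OF v m] n unfolding total_word_def prefix_word_def by simp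
qed

lemma linked_P_new_orbit: "linked (cball 0 1) f P new_orbit"
proof -
  let ?h = "word_isotopy (m + n) r (total_word m w)"
  have "\<not> unlinked (cball 0 1) f P new_orbit"
  proof
    assume unl: "unlinked (cball 0 1) f P new_orbit"
    have disc: "r ` {..<m + n} \<subseteq> cball 0 1" using points_in_disc by auto
    obtain k :: int where k:
      "(\<Sum>p\<in>P. \<Sum>q\<in>new_orbit. winding_number (\<lambda>t. ?h (t, p) - ?h (t, q)) 0) = of_int k * of_nat (card P)"
    proof (rule unlinked_imp_card_dvd_linking_number[OF f_isotopy _ f_image_P finite_P _ f_image_new_orbit _ unl])
      show "P \<subseteq> cball 0 1" using disc unfolding P_eq by auto
      show "new_orbit \<subseteq> cball 0 1" using disc unfolding new_orbit_def by auto
      show "finite new_orbit" by (simp add: new_orbit_def)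
    qed
    have "(\<Sum>p\<in>P. \<Sum>q\<in>new_orbit. winding_number (\<lambda>t. ?h (t, p) - ?h (t, q)) 0) =
      (\<Sum>i\<in>{m..<m + n}. \<Sum>j<m. strand_winding ?h (r i) (r j))"
    proof -
      have inj: "inj_on r {m..<m + n}" "inj_on r {..<m}" by (rule inj_on_subset[OF inj_points]; auto)+
      have "sum F P = (\<Sum>i\<in>{m..<m + n}. F (r i))" "sum F new_orbit = (\<Sum>j<m. F (r j))" for F :: "complex \<Rightarrow> complex"
        using sum.reindex[OF inj(1), of F] sum.reindex[OF inj(2), of F] P_eq new_orbit_def by (simp_all add: o_def)
      then show ?thesis unfolding strand_winding_def by simp
    qed
    also have "\<dots> = linking_number m (total_word m w)" unfolding linking_number_def ..
    also have "\<dots> = 1" by (rule linking_number_total)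
    finally have "of_int k * of_nat (card P) = (1 :: complex)" using k by simp
    then have "of_int (k * int n) = (of_int 1 :: complex)" using P(2) by simp
    then have "k * int n = 1" unfolding of_int_eq_iff .
    then have "int n dvd 1" by (metis dvd_triv_right)
    then show False using n by simp
  qed
  then show ?thesis unfolding linked_def using f_image_P f_image_new_orbit by simp
qed

lemma c_eq: "j < n \<Longrightarrow> c j = sorted_point P j"
proof -
  assume "j < n"
  then have "c j = r (m + j)" by (simp add: c_def)
  then show ?thesis by (simp add: r_def chain_point_def)
qed

text \<open>The induced path is, coordinate by coordinate, the slide followed by the strands and by the slide back,
  the latter relabelled by the final positions.\<close>

lemma f_induces_braid: "induces_braid f n P w"
proof -
  let ?h = "word_isotopy (m + n) r (total_word m w)"
  have eq: "induced_path n ?h P =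
    slide_path n c +++ (strands n ?h c +++ (\<lambda>t. reversepath (slide_path n c) t \<circ> end_position w))"
  proof (intro ext)
    fix t j
    show "induced_path n ?h P t j =
      (slide_path n c +++ (strands n ?h c +++ (\<lambda>t. reversepath (slide_path n c) t \<circ> end_position w))) t j"
    proof (cases "j < n")
      case True
      have slide: "slide n P (c i) s = slide_path n c s i" if "i < n" for i s
        using sorted_point(2)[OF finite_P, of i] that P(2) c_eq[OF that]
        unfolding slide_def slide_path_def linepath_def by simp
      have E: "end_position w j < n"
        using permutes_in_image[OF end_position_permutes[OF w(1)], of j] True by simp
      have "c j \<in> cball 0 1" using configurations_cball[OF c_configuration True] .
      then have "?h (1, c j) = f (c j)" using f_isotopy unfolding isotopy_from_id_def by blast
      also have "\<dots> = c (end_position w j)"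
        using f_point[of "m + j"] True E end_position_total(1)[OF m w(1), of j] by (simp add: c_def)
      finally have h1: "?h (1, c j) = c (end_position w j)" .
      have inv: "inv_into P (lex_rank P) j = c j" using c_eq[OF True] by (simp add: sorted_point_def)
      show ?thesis
        using True unfolding induced_path_def induced_strand_def inv h1
        by (simp add: joinpaths_def reversepath_def slide[OF True] slide[OF E] strands_def)
    next
      case False
      then have "end_position w j = j" using permutes_not_in[OF end_position_permutes[OF w(1)], of j] by simp
      then show ?thesis using False slide_path_zero[OF c_chain c_zero, of j]
        by (simp add: induced_path_def joinpaths_def strands_def reversepath_def)
    qed
  qed
  have "homotopic_paths (configurations n) (induced_path n ?h P) (word_path n w)"
    unfolding eq unfolding total_word_def
  proof (rule slide_total_strands)
    show "\<forall>k\<in>set (prefix_word m). k \<noteq> 0 \<and> nat \<bar>k\<bar> \<le> m" using m by (auto simp: prefix_word_def)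
    show "end_position (prefix_word m) m = m" using end_position_prefix[OF m, of m] m by simp
  qed (use n w chain_point_level in auto)
  then show ?thesis unfolding induces_braid_def using f_isotopy by blast
qed

lemma f_properties:
  "\<exists>g. homeomorphism (cball 0 1) (cball 0 1) f g"
  "\<forall>z\<in>sphere 0 1. f z = z"
  "periodic_orbit (cball 0 1) f n P" "induces_braid f n P w"
  "\<exists>Q. periodic_orbit (cball 0 1) f m Q \<and> Q \<subseteq> interior (cball 0 1) \<and> Q \<noteq> P \<and> linked (cball 0 1) f P Q"
proof -
  show "\<exists>g. homeomorphism (cball 0 1) (cball 0 1) f g"
    using f_isotopy by (rule isotopy_from_id_homeomorphism) blast
  show "\<forall>z\<in>sphere 0 1. f z = z" unfolding f_eq using word_map_sphere[OF total_braid_word] by simp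
  have "new_orbit \<subseteq> interior (cball 0 1)" unfolding new_orbit_def using in_ball by auto
  moreover have "new_orbit \<noteq> P"
  proof
    assume "new_orbit = P"
    then obtain j where "j \<in> {m..<m + n}" "r 0 = r j" using m P_eq unfolding new_orbit_def by blast
    then show False using distinct_points[of 0 j] m by auto
  qed
  ultimately show "\<exists>Q. periodic_orbit (cball 0 1) f m Q \<and> Q \<subseteq> interior (cball 0 1) \<and> Q \<noteq> P \<and> linked (cball 0 1) f P Q"
    using new_orbit_periodic linked_P_new_orbit by blast
qed (rule P_periodic f_induces_braid)+

end

section \<open>Computable functions on encoded data\<close>

text \<open>There is a single program that, on the code \<open>e x\<close> of any \<open>x\<close> in \<open>X\<close>, halts with \<open>F x\<close>. The index set is
  arbitrary, so that the same notion covers the bodies of loops, whose codes contain the loop index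
  and the current value in addition to the input.\<close>

definition computes :: "'a set \<Rightarrow> ('a \<Rightarrow> real list) \<Rightarrow> ('a \<Rightarrow> real list) \<Rightarrow> bool" where
  "computes X e F \<longleftrightarrow> (\<exists>p. \<forall>x\<in>X. runs p (e x) (F x))"

abbreviation computes_real :: "'a set \<Rightarrow> ('a \<Rightarrow> real list) \<Rightarrow> ('a \<Rightarrow> real) \<Rightarrow> bool" where
  "computes_real X e a \<equiv> computes X e (\<lambda>x. [a x])"

definition computes_complex :: "'a set \<Rightarrow> ('a \<Rightarrow> real list) \<Rightarrow> ('a \<Rightarrow> complex) \<Rightarrow> bool" where
  "computes_complex X e f \<longleftrightarrow> computes_real X e (\<lambda>x. Re (f x)) \<and> computes_real X e (\<lambda>x. Im (f x))"

named_theorems computes_intros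

lemma computes_cong:
  assumes "computes X e F" "\<And>x. x \<in> X \<Longrightarrow> F x = G x"
  shows "computes X e G"
  using assms unfolding computes_def by metis

lemma computes_subset: "computes X e F \<Longrightarrow> Y \<subseteq> X \<Longrightarrow> computes Y e F"
  unfolding computes_def by blast

lemma computes_reindex:
  assumes "computes X e F" "\<And>y. y \<in> Y \<Longrightarrow> g y \<in> X"
  shows "computes Y (\<lambda>y. e (g y)) (\<lambda>y. F (g y))"
  using assms unfolding computes_def by blast

lemma computes_self: "computes X e e"
  unfolding computes_def using runs.intros(1) by blast

lemma computes_seq: "computes X e F \<Longrightarrow> computes X F G \<Longrightarrow> computes X e G"
  unfolding computes_def using runs.intros(10) by meson

lemma computes_append:
  "computes X e F \<Longrightarrow> computes X e G \<Longrightarrow> computes X e (\<lambda>x. F x @ G x)"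
  unfolding computes_def using runs.intros(11) by meson

lemma computes_Cons:
  "computes_real X e a \<Longrightarrow> computes X e G \<Longrightarrow> computes X e (\<lambda>x. a x # G x)"
  using computes_append[of X e "\<lambda>x. [a x]" G] by simp

lemma computes_1 [computes_intros]: "computes_real X e (\<lambda>x. 1)"
  unfolding computes_def using runs.intros(3) by blast

lemma computes_drop: "computes X e F \<Longrightarrow> computes X e (\<lambda>x. drop k (F x))"
proof (induction k)
  case (Suc k)
  have "computes X (\<lambda>x. drop k (F x)) (\<lambda>x. drop 1 (drop k (F x)))"
    unfolding computes_def using runs.intros(5) by blast
  from computes_seq[OF Suc.IH[OF Suc.prems] this] show ?case by simp
qed simp

lemma computes_take: "computes X e F \<Longrightarrow> computes X e (\<lambda>x. take k (F x))"
proof (induction k)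
  case 0
  show ?case unfolding computes_def take_0 using runs.intros(2) by blast
next
  case (Suc k)
  have "computes X (\<lambda>x. drop k (F x)) (\<lambda>x. take 1 (drop k (F x)))"
    unfolding computes_def using runs.intros(4) by blast
  from computes_append[OF Suc.IH[OF Suc.prems] computes_seq[OF computes_drop[OF Suc.prems] this]]
  show ?case by (rule computes_cong) (simp add: take_add[symmetric])
qed

lemma computes_nth_const:
  assumes "computes X e F" "\<And>x. x \<in> X \<Longrightarrow> k < length (F x)"
  shows "computes_real X e (\<lambda>x. F x ! k)"
  by (rule computes_cong[OF computes_take[OF computes_drop[OF assms(1)], of 1 k]])
     (use assms(2) in \<open>simp add: take_Suc Cons_nth_drop_Suc[symmetric]\<close>)

lemma computes_add [computes_intros]:
  assumes "computes_real X e a" "computes_real X e b"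
  shows "computes_real X e (\<lambda>x. a x + b x)"
proof -
  have "computes X (\<lambda>x. [a x, b x]) (\<lambda>x. [a x + b x])"
    unfolding computes_def using runs.intros(6) by blast
  then show ?thesis using computes_seq[OF computes_Cons[OF assms]] by blast
qed

lemma computes_diff [computes_intros]:
  assumes "computes_real X e a" "computes_real X e b"
  shows "computes_real X e (\<lambda>x. a x - b x)"
proof -
  have "computes X (\<lambda>x. [a x, b x]) (\<lambda>x. [a x - b x])"
    unfolding computes_def using runs.intros(7) by blast
  then show ?thesis using computes_seq[OF computes_Cons[OF assms]] by blast
qed

lemma computes_mult [computes_intros]:
  assumes "computes_real X e a" "computes_real X e b"
  shows "computes_real X e (\<lambda>x. a x * b x)"
proof -
  have "computes X (\<lambda>x. [a x, b x]) (\<lambda>x. [a x * b x])"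
    unfolding computes_def using runs.intros(8) by blast
  then show ?thesis using computes_seq[OF computes_Cons[OF assms]] by blast
qed

lemma computes_if:
  assumes c: "computes_real X e c"
    and F: "computes {x \<in> X. c x > 0} e F" and G: "computes {x \<in> X. \<not> c x > 0} e G"
  shows "computes X e (\<lambda>x. if c x > 0 then F x else G x)"
proof -
  have tail: "computes Y (\<lambda>x. c x # e x) e" for Y
  proof -
    have "computes Y (\<lambda>x. c x # e x) (\<lambda>x. drop 1 (c x # e x))"
      by (rule computes_drop[OF computes_self])
    then show ?thesis by simp
  qed
  obtain p q where p: "\<And>x. x \<in> X \<Longrightarrow> c x > 0 \<Longrightarrow> runs p (c x # e x) (F x)"
    and q: "\<And>x. x \<in> X \<Longrightarrow> \<not> c x > 0 \<Longrightarrow> runs q (c x # e x) (G x)"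
    using computes_seq[OF tail F] computes_seq[OF tail G] unfolding computes_def by blast
  have "runs (IfPos p q) (c x # e x) (if c x > 0 then F x else G x)" if "x \<in> X" for x
    using runs.intros(12)[of "c x # e x" p] runs.intros(13)[of "c x # e x" q] p[OF that] q[OF that]
    by (auto simp: head_pos_def)
  then have "computes X (\<lambda>x. c x # e x) (\<lambda>x. if c x > 0 then F x else G x)"
    unfolding computes_def by blast
  then show ?thesis using computes_seq[OF computes_Cons[OF c computes_self]] by blast
qed

lemma computes_0 [computes_intros]: "computes_real X e (\<lambda>x. 0)"
  using computes_diff[OF computes_1 computes_1, of X e] by simp

lemma computes_minus [computes_intros]: "computes_real X e a \<Longrightarrow> computes_real X e (\<lambda>x. - a x)"
  using computes_diff[OF computes_0, of X e a] by simp

lemma computes_if_less: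
  assumes "computes_real X e a" "computes_real X e b"
    and "computes {x \<in> X. a x < b x} e F" "computes {x \<in> X. \<not> a x < b x} e G"
  shows "computes X e (\<lambda>x. if a x < b x then F x else G x)"
  using computes_if[OF computes_diff[OF assms(2,1)], of F G] assms(3,4) by simp

lemma computes_real_if_less:
  assumes "computes_real X e a" "computes_real X e b"
    and "computes_real {x \<in> X. a x < b x} e c" "computes_real {x \<in> X. \<not> a x < b x} e d"
  shows "computes_real X e (\<lambda>x. if a x < b x then c x else d x)"
  using computes_if_less[OF assms] by (rule computes_cong) simp

lemma computes_max [computes_intros]:
  assumes "computes_real X e a" "computes_real X e b"
  shows "computes_real X e (\<lambda>x. max (a x) (b x))"
  by (rule computes_cong[OF computes_real_if_less[OF assms, of b a]])
     (use assms in \<open>auto simp: max_def intro: computes_subset\<close>)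

lemma computes_min [computes_intros]:
  assumes "computes_real X e a" "computes_real X e b"
  shows "computes_real X e (\<lambda>x. min (a x) (b x))"
  by (rule computes_cong[OF computes_real_if_less[OF assms, of a b]])
     (use assms in \<open>auto simp: min_def intro: computes_subset\<close>)

lemma computes_abs [computes_intros]:
  assumes "computes_real X e a"
  shows "computes_real X e (\<lambda>x. \<bar>a x\<bar>)"
  by (rule computes_cong[OF computes_max[OF assms computes_minus[OF assms]]]) auto

text \<open>Division by zero is caught by a case distinction and returns 0, as in the logic.\<close>

lemma computes_divide [computes_intros]:
  assumes a: "computes_real X e a" and b: "computes_real X e b"
  shows "computes_real X e (\<lambda>x. a x / b x)"
proof -
  have "computes X e (\<lambda>x. if b x * b x > 0 then [a x / b x] else [0])"
  proof (rule computes_if)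
    let ?Y = "{x \<in> X. b x * b x > 0}"
    have "runs Divide [a x, b x] [a x / b x]" if "x \<in> ?Y" for x
      using that by (intro runs.intros(9)) auto
    then have "computes ?Y (\<lambda>x. [a x, b x]) (\<lambda>x. [a x / b x])" unfolding computes_def by blast
    moreover have "computes ?Y e (\<lambda>x. [a x, b x])"
      by (rule computes_subset[OF computes_Cons[OF a b]]) auto
    ultimately show "computes ?Y e (\<lambda>x. [a x / b x])" using computes_seq by blast
  qed (intro computes_mult b computes_0)+
  then show ?thesis by (rule computes_cong) (auto simp: zero_less_mult_iff not_less)
qed

lemma computes_of_nat [computes_intros]: "computes_real X e (\<lambda>x. real k)"
  by (induction k) (simp_all add: computes_0 computes_add computes_1)

lemma computes_numeral [computes_intros]: "computes_real X e (\<lambda>x. numeral k)"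
  using computes_of_nat[of X e "numeral k"] by simp

lemma computes_power [computes_intros]:
  "computes_real X e a \<Longrightarrow> computes_real X e (\<lambda>x. a x ^ k)"
  by (induction k) (simp_all add: computes_1 computes_mult)

lemma computes_sgn [computes_intros]:
  assumes "computes_real X e a"
  shows "computes_real X e (\<lambda>x. sgn (a x))"
  by (rule computes_cong[OF computes_real_if_less[OF computes_0 assms computes_1
        computes_real_if_less[OF _ computes_0 computes_minus[OF computes_1] computes_0, of _ _ a]]])
     (use assms in \<open>auto simp: sgn_if intro: computes_subset\<close>)

section \<open>Programs with loops\<close>

primrec iterate :: "(nat \<Rightarrow> 's \<Rightarrow> 's) \<Rightarrow> nat \<Rightarrow> 's \<Rightarrow> 's" where
  "iterate B 0 s = s"
| "iterate B (Suc k) s = B k (iterate B k s)"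

text \<open>During the loop the state holds the number of the remaining steps, the number of the current
  step, the encoded value, and the unchanged input.\<close>

lemma computes_iterate:
  assumes N: "computes_real Y e (\<lambda>y. real (N y))" and s0: "computes Y e (\<lambda>y. V (s0 y))"
    and len: "\<And>s. length (V s) = d"
    and body: "computes {(y, i, s). y \<in> Y \<and> i < N y} (\<lambda>(y, i, s). real i # V s @ e y) (\<lambda>(y, i, s). V (B y i s))"
  shows "computes Y e (\<lambda>y. V (iterate (B y) (N y) (s0 y)))"
proof -
  define it where "it y k = iterate (B y) k (s0 y)" for y k
  define st where "st = (\<lambda>(y, k). real (N y - k) # real k # V (it y k) @ e y)"
  define Z where "Z = {(y, k). y \<in> Y \<and> k < N y}"
  have self: "computes Z st st" by (rule computes_self)
  have 1: "computes_real Z st (\<lambda>x. st x ! 0)" "computes_real Z st (\<lambda>x. st x ! 1)"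
    by (rule computes_nth_const[OF self]; simp add: st_def split: prod.split)+
  have 2: "computes Z st (\<lambda>(y, k). V (B y k (it y k)))"
  proof -
    have "computes Z (\<lambda>x. (\<lambda>(y, i, s). real i # V s @ e y) ((\<lambda>(y, k). (y, k, it y k)) x))
        (\<lambda>x. (\<lambda>(y, i, s). V (B y i s)) ((\<lambda>(y, k). (y, k, it y k)) x))"
      by (rule computes_reindex[OF body]) (auto simp: Z_def)
    moreover have "computes Z st (\<lambda>x. (\<lambda>(y, i, s). real i # V s @ e y) ((\<lambda>(y, k). (y, k, it y k)) x))"
      by (rule computes_cong[OF computes_drop[OF self, of 1]]) (auto simp: st_def)
    ultimately have "computes Z st (\<lambda>x. (\<lambda>(y, i, s). V (B y i s)) ((\<lambda>(y, k). (y, k, it y k)) x))"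
      using computes_seq by blast
    then show ?thesis by (rule computes_cong) auto
  qed
  have 3: "computes Z st (\<lambda>(y, k). e y)"
    by (rule computes_cong[OF computes_drop[OF self, of "Suc (Suc d)"]]) (auto simp: st_def len)
  have "computes Z st (\<lambda>x. (st x ! 0 - 1) # (st x ! 1 + 1) # (\<lambda>(y, k). V (B y k (it y k))) x @ (\<lambda>(y, k). e y) x)"
    by (rule computes_Cons[OF computes_diff[OF 1(1) computes_1]
          computes_Cons[OF computes_add[OF 1(2) computes_1] computes_append[OF 2 3]]])
  then have "computes Z st (\<lambda>(y, k). st (y, Suc k))"
    by (rule computes_cong) (auto simp: st_def Z_def it_def of_nat_diff)
  then obtain p where p: "\<And>y k. y \<in> Y \<Longrightarrow> k < N y \<Longrightarrow> runs p (st (y, k)) (st (y, Suc k))"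
    unfolding computes_def Z_def by auto
  have "runs (WhilePos p) (st (y, k)) (st (y, N y))" if "y \<in> Y" "k \<le> N y" for y k
    using that(2)
  proof (induction k rule: inc_induct)
    case base
    show ?case by (rule runs.intros(15)) (simp add: head_pos_def st_def)
  next
    case (step k)
    show ?case by (rule runs.intros(14)[OF _ p[OF that(1)] step.IH]) (use step in \<open>auto simp: head_pos_def st_def\<close>)
  qed
  then have loop: "computes Y (\<lambda>y. st (y, 0)) (\<lambda>y. st (y, N y))" unfolding computes_def by blast
  have "computes Y e (\<lambda>y. real (N y) # 0 # V (s0 y) @ e y)"
    by (rule computes_Cons[OF N computes_Cons[OF computes_0 computes_append[OF s0 computes_self]]])
  then have "computes Y e (\<lambda>y. st (y, 0))" by (rule computes_cong) (simp add: st_def it_def)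
  from computes_seq[OF this loop] have "computes Y e (\<lambda>y. st (y, N y))" .
  from computes_take[OF computes_drop[OF this, of 2], of d]
  show ?thesis by (rule computes_cong) (simp add: st_def it_def len)
qed

lemma computes_sum:
  assumes N: "computes_real Y e (\<lambda>y. real (N y))"
    and a: "computes_real {(y, i). y \<in> Y \<and> i < N y} (\<lambda>(y, i). real i # e y) (\<lambda>(y, i). a y i)"
  shows "computes_real Y e (\<lambda>y. \<Sum>i<N y. a y i)"
proof -
  let ?Z = "{(y, i, s :: real). y \<in> Y \<and> i < N y}" and ?st = "\<lambda>(y, i, s :: real). real i # [s] @ e y"
  have self: "computes ?Z ?st ?st" by (rule computes_self)
  have 1: "computes_real ?Z ?st (\<lambda>x. ?st x ! 0)" "computes_real ?Z ?st (\<lambda>x. ?st x ! 1)"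
    by (rule computes_nth_const[OF self]; simp split: prod.split)+
  have "computes ?Z ?st (\<lambda>x. (?st x ! 0) # drop 2 (?st x))"
    by (rule computes_Cons[OF 1(1) computes_drop[OF self]])
  then have "computes ?Z ?st (\<lambda>x. (\<lambda>(y, i). real i # e y) ((\<lambda>(y, i, s). (y, i)) x))"
    by (rule computes_cong) auto
  moreover have "computes ?Z (\<lambda>x. (\<lambda>(y, i). real i # e y) ((\<lambda>(y, i, s). (y, i)) x)) (\<lambda>x. [(\<lambda>(y, i). a y i) ((\<lambda>(y, i, s). (y, i)) x)])"
    by (rule computes_reindex[OF a]) auto
  ultimately have "computes_real ?Z ?st (\<lambda>x. (\<lambda>(y, i). a y i) ((\<lambda>(y, i, s). (y, i)) x))"
    using computes_seq by blast
  from computes_add[OF 1(2) this]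
  have "computes ?Z ?st (\<lambda>(y, i, s). [s + a y i])" by (rule computes_cong) auto
  from computes_iterate[where V = "\<lambda>s. [s]" and ?s0.0 = "\<lambda>y. 0" and B = "\<lambda>y i s. s + a y i" and d = 1, OF N computes_0 _ this]
  have "computes_real Y e (\<lambda>y. iterate (\<lambda>i s. s + a y i) (N y) 0)" by simp
  moreover have "iterate (\<lambda>i s. s + a y i) k 0 = (\<Sum>i<k. a y i)" for y k
    by (induction k) auto
  ultimately show ?thesis by simp
qed

text \<open>The program drops one entry per step until the index has been counted down to 0.\<close>

lemma computes_nth:
  assumes L: "computes X e L" and k: "computes_real X e (\<lambda>x. real (k x))" and less: "\<And>x. x \<in> X \<Longrightarrow> k x < length (L x)"
  shows "computes_real X e (\<lambda>x. L x ! k x)"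
proof -
  define st where "st = (\<lambda>(x, j). real (k x - j) # drop j (L x))"
  define Z where "Z = {(x, j). x \<in> X \<and> j < k x}"
  have self: "computes Z st st" by (rule computes_self)
  have 1: "computes_real Z st (\<lambda>x. st x ! 0)"
    by (rule computes_nth_const[OF self]; simp add: st_def split: prod.split)
  have "computes Z st (\<lambda>x. (st x ! 0 - 1) # drop 2 (st x))"
    by (rule computes_Cons[OF computes_diff[OF 1 computes_1] computes_drop[OF self]])
  then have "computes Z st (\<lambda>(x, j). st (x, Suc j))"
    by (rule computes_cong) (auto simp: st_def Z_def of_nat_diff)
  then obtain p where p: "\<And>x j. x \<in> X \<Longrightarrow> j < k x \<Longrightarrow> runs p (st (x, j)) (st (x, Suc j))"
    unfolding computes_def Z_def by auto
  have "runs (WhilePos p) (st (x, j)) (st (x, k x))" if "x \<in> X" "j \<le> k x" for x j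
    using that(2)
  proof (induction j rule: inc_induct)
    case base
    show ?case by (rule runs.intros(15)) (simp add: head_pos_def st_def)
  next
    case (step j)
    show ?case by (rule runs.intros(14)[OF _ p[OF that(1)] step.IH]) (use step in \<open>auto simp: head_pos_def st_def\<close>)
  qed
  then have loop: "computes X (\<lambda>x. st (x, 0)) (\<lambda>x. st (x, k x))" unfolding computes_def by blast
  have "computes X e (\<lambda>x. st (x, 0))" using computes_Cons[OF k L] by (simp add: st_def)
  from computes_seq[OF this loop] have 2: "computes X e (\<lambda>x. st (x, k x))" .
  have "computes_real X e (\<lambda>x. st (x, k x) ! 1)"
    by (rule computes_nth_const[OF 2]) (use less in \<open>simp add: st_def\<close>)
  then show ?thesis by (rule computes_cong) (use less in \<open>simp add: st_def less_imp_le\<close>)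
qed

section \<open>Computing with complex numbers\<close>

lemma computes_Re: "computes_complex X e f \<Longrightarrow> computes_real X e (\<lambda>x. Re (f x))"
  and computes_Im: "computes_complex X e f \<Longrightarrow> computes_real X e (\<lambda>x. Im (f x))"
  by (auto simp: computes_complex_def)

lemma computes_complex_Complex [computes_intros]:
  "computes_real X e a \<Longrightarrow> computes_real X e b \<Longrightarrow> computes_complex X e (\<lambda>x. Complex (a x) (b x))"
  by (simp add: computes_complex_def)

lemma computes_complex_of_real [computes_intros]:
  "computes_real X e a \<Longrightarrow> computes_complex X e (\<lambda>x. of_real (a x))"
  by (simp add: computes_complex_def computes_0)

lemma computes_complex_numeral [computes_intros]: "computes_complex X e (\<lambda>x. numeral k)"
  by (simp add: computes_complex_def computes_0 computes_numeral)

lemma computes_complex_add [computes_intros]: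
  "computes_complex X e f \<Longrightarrow> computes_complex X e g \<Longrightarrow> computes_complex X e (\<lambda>x. f x + g x)"
  by (simp add: computes_complex_def computes_add)

lemma computes_complex_diff [computes_intros]:
  "computes_complex X e f \<Longrightarrow> computes_complex X e g \<Longrightarrow> computes_complex X e (\<lambda>x. f x - g x)"
  by (simp add: computes_complex_def computes_diff)

lemma computes_complex_mult [computes_intros]:
  "computes_complex X e f \<Longrightarrow> computes_complex X e g \<Longrightarrow> computes_complex X e (\<lambda>x. f x * g x)"
  by (simp add: computes_complex_def computes_add computes_diff computes_mult)

lemma computes_complex_divide [computes_intros]:
  assumes "computes_complex X e f" "computes_complex X e g"
  shows "computes_complex X e (\<lambda>x. f x / g x)"
  unfolding computes_complex_def Re_divide Im_divide
  by (intro conjI computes_intros computes_Re computes_Im assms)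

lemma computes_complex_power2 [computes_intros]:
  "computes_complex X e f \<Longrightarrow> computes_complex X e (\<lambda>x. (f x)\<^sup>2)"
  unfolding power2_eq_square by (rule computes_complex_mult)

lemma computes_cmod_power2 [computes_intros]:
  "computes_complex X e f \<Longrightarrow> computes_real X e (\<lambda>x. (cmod (f x))\<^sup>2)"
  unfolding cmod_power2 by (intro computes_add computes_power computes_Re computes_Im)

lemma computes_complex_if_less:
  assumes "computes_real X e a" "computes_real X e b"
    and "computes_complex {x \<in> X. a x < b x} e f" "computes_complex {x \<in> X. \<not> a x < b x} e g"
  shows "computes_complex X e (\<lambda>x. if a x < b x then f x else g x)"
  using computes_real_if_less[OF assms(1,2), of "\<lambda>x. Re (f x)" "\<lambda>x. Re (g x)"]
    computes_real_if_less[OF assms(1,2), of "\<lambda>x. Im (f x)" "\<lambda>x. Im (g x)"] assms(3,4)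
  unfolding computes_complex_def by (simp add: if_distrib)

lemma computes_complex_cong:
  assumes "computes_complex X e f" "\<And>x. x \<in> X \<Longrightarrow> f x = g x"
  shows "computes_complex X e g"
  using assms computes_cong[of X e "\<lambda>x. [Re (f x)]" "\<lambda>x. [Re (g x)]"]
    computes_cong[of X e "\<lambda>x. [Im (f x)]" "\<lambda>x. [Im (g x)]"]
  unfolding computes_complex_def by auto

lemma computes_complex_subset: "computes_complex X e F \<Longrightarrow> Y \<subseteq> X \<Longrightarrow> computes_complex Y e F"
  unfolding computes_complex_def using computes_subset by blast

text \<open>Within a loop the code of the loop index is put in front of the code of the input.\<close>

definition loop_set :: "'a set \<Rightarrow> ('a \<Rightarrow> nat) \<Rightarrow> ('a \<times> nat) set" where
  "loop_set Y N = {x. fst x \<in> Y \<and> snd x < N (fst x)}"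

definition loop_code :: "('a \<Rightarrow> real list) \<Rightarrow> 'a \<times> nat \<Rightarrow> real list" where
  "loop_code e x = real (snd x) # e (fst x)"

lemma loop_setD: "x \<in> loop_set Y N \<Longrightarrow> fst x \<in> Y" "x \<in> loop_set Y N \<Longrightarrow> snd x < N (fst x)"
  by (auto simp: loop_set_def)

lemma computes_sum_loop:
  assumes "computes_real Y e (\<lambda>y. real (N y))"
    "computes_real (loop_set Y N) (loop_code e) (\<lambda>x. a (fst x) (snd x))"
  shows "computes_real Y e (\<lambda>y. \<Sum>i<N y. a y i)"
  by (rule computes_sum[OF assms(1)])
     (use assms(2) in \<open>simp add: loop_set_def loop_code_def[abs_def] case_prod_unfold\<close>)

lemma computes_complex_sum_loop:
  assumes "computes_real Y e (\<lambda>y. real (N y))"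
    "computes_complex (loop_set Y N) (loop_code e) (\<lambda>x. a (fst x) (snd x))"
  shows "computes_complex Y e (\<lambda>y. \<Sum>i<N y. a y i)"
  using assms(2) computes_sum_loop[OF assms(1), of "\<lambda>y i. Re (a y i)"]
    computes_sum_loop[OF assms(1), of "\<lambda>y i. Im (a y i)"]
  unfolding computes_complex_def Re_sum Im_sum by auto

lemma computes_loop_index: "computes_real (loop_set Y N) (loop_code e) (\<lambda>x. real (snd x))"
proof -
  have "computes_real (loop_set Y N) (loop_code e) (\<lambda>x. loop_code e x ! 0)"
    by (rule computes_nth_const[OF computes_self]) (simp add: loop_code_def)
  then show ?thesis by (simp add: loop_code_def)
qed

lemma computes_loop:
  assumes "computes Y e F"
  shows "computes (loop_set Y N) (loop_code e) (\<lambda>x. F (fst x))"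
proof -
  have "computes (loop_set Y N) (loop_code e) (\<lambda>x. e (fst x))"
    by (rule computes_cong[OF computes_drop[OF computes_self, of _ _ 1]]) (simp add: loop_code_def)
  moreover have "computes (loop_set Y N) (\<lambda>x. e (fst x)) (\<lambda>x. F (fst x))"
    by (rule computes_reindex[OF assms]) (rule loop_setD)
  ultimately show ?thesis by (rule computes_seq)
qed

lemma computes_complex_loop:
  "computes_complex Y e f \<Longrightarrow> computes_complex (loop_set Y N) (loop_code e) (\<lambda>x. f (fst x))"
  unfolding computes_complex_def using computes_loop[of Y e "\<lambda>y. [Re (f y)]"] computes_loop[of Y e "\<lambda>y. [Im (f y)]"] by blast

lemma computes_coords: "computes_complex Y e f \<Longrightarrow> computes Y e (\<lambda>y. coords (f y))"
  unfolding computes_complex_def coords_def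
  using computes_Cons[of Y e "\<lambda>y. Re (f y)" "\<lambda>y. [Im (f y)]"] by blast

section \<open>The twists are computable\<close>

lemma computes_stretch [computes_intros]:
  "computes_real X e \<eta> \<Longrightarrow> computes_complex X e f \<Longrightarrow> computes_complex X e (\<lambda>x. stretch (\<eta> x) (f x))"
  unfolding stretch_def by (intro computes_intros computes_Re computes_Im)

lemma computes_turn [computes_intros]:
  "computes_real X e u \<Longrightarrow> computes_complex X e (\<lambda>x. turn (u x))"
  unfolding turn_def by (intro computes_intros)

lemma computes_fade [computes_intros]:
  "computes_real X e \<eta> \<Longrightarrow> computes_complex X e f \<Longrightarrow> computes_real X e (\<lambda>x. fade (\<eta> x) (f x))"
  unfolding fade_def by (intro computes_intros)

lemma computes_to_unit [computes_intros]:
  "computes_complex X e a \<Longrightarrow> computes_complex X e b \<Longrightarrow> computes_complex X e f \<Longrightarrow>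
     computes_complex X e (\<lambda>x. to_unit (a x) (b x) (f x))"
  unfolding to_unit_def by (intro computes_intros)

lemma computes_twist [computes_intros]:
  "computes_complex X e a \<Longrightarrow> computes_complex X e b \<Longrightarrow> computes_complex X e f \<Longrightarrow>
     computes_real X e \<eta> \<Longrightarrow> computes_real X e u \<Longrightarrow>
     computes_complex X e (\<lambda>x. twist (a x) (b x) (\<eta> x) (u x) (f x))"
  unfolding twist_def unit_twist_def from_unit_def by (intro computes_intros)

lemma computes_gap [computes_intros]:
  "computes_complex X e a \<Longrightarrow> computes_complex X e b \<Longrightarrow> computes_complex X e f \<Longrightarrow>
     computes_real X e (\<lambda>x. gap (a x) (b x) (f x))"
  unfolding gap_def by (intro computes_intros computes_Re computes_Im)

lemma computes_lex_less:
  assumes f: "computes_complex X e f" and g: "computes_complex X e g"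
  shows "computes_real X e (\<lambda>x. if lex_less (f x) (g x) then 1 else 0)"
proof -
  have sub: "computes_complex Y e f" "computes_complex Y e g" if "Y \<subseteq> X" for Y
    using computes_complex_subset[OF f that] computes_complex_subset[OF g that] by auto
  have "computes_real X e (\<lambda>x. if Re (f x) < Re (g x) then 1 else if Re (g x) < Re (f x) then 0
     else if Im (f x) < Im (g x) then 1 else 0)"
    by (intro computes_real_if_less computes_Re computes_Im computes_1 computes_0 sub) auto
  then show ?thesis by (rule computes_cong) (auto simp: lex_less_def)
qed

section \<open>The algorithm\<close>

type_synonym input = "nat \<times> complex list \<times> int list \<times> nat \<times> complex"

abbreviation strand_count :: "input \<Rightarrow> nat" where "strand_count x \<equiv> fst x"
abbreviation points :: "input \<Rightarrow> complex list" where "points x \<equiv> fst (snd x)"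
abbreviation letters :: "input \<Rightarrow> int list" where "letters x \<equiv> fst (snd (snd x))"
abbreviation period :: "input \<Rightarrow> nat" where "period x \<equiv> fst (snd (snd (snd x)))"
abbreviation argument :: "input \<Rightarrow> complex" where "argument x \<equiv> snd (snd (snd (snd x)))"

definition valid_inputs :: "input set" where
  "valid_inputs = {x. length (points x) = strand_count x \<and> distinct (points x) \<and>
     braid_word (strand_count x) (letters x) \<and> 0 < period x \<and> 0 < strand_count x}"

text \<open>The input of the algorithm can be recovered from the code. All values needed are computed from such
  codes, at any depth of nested loops.\<close>

definition input_at :: "'a set \<Rightarrow> ('a \<Rightarrow> real list) \<Rightarrow> ('a \<Rightarrow> input) \<Rightarrow> bool" where
  "input_at Y e x \<longleftrightarrow> x ` Y \<subseteq> valid_inputs \<and>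
     computes Y e (\<lambda>y. encode_input (strand_count (x y)) (points (x y)) (letters (x y)) (period (x y)) (argument (x y)))"

lemma input_at_subset: "input_at Y e x \<Longrightarrow> Z \<subseteq> Y \<Longrightarrow> input_at Z e x"
  unfolding input_at_def using computes_subset by blast

lemma input_at_loop:
  assumes "input_at Y e x"
  shows "input_at (loop_set Y N) (loop_code e) (\<lambda>v. x (fst v))"
  using assms computes_loop[of Y e "\<lambda>y. encode_input (strand_count (x y)) (points (x y)) (letters (x y)) (period (x y)) (argument (x y))"]
  unfolding input_at_def by (auto dest: loop_setD)

lemma concat_coords_nth:
  "i < length ps \<Longrightarrow> concat (map coords ps) ! (2 * i) = Re (ps ! i)"
  "i < length ps \<Longrightarrow> concat (map coords ps) ! Suc (2 * i) = Im (ps ! i)"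
proof (induction ps arbitrary: i)
  case (Cons p ps)
  { case 1 then show ?case using Cons.IH(1) by (cases i) (auto simp: coords_def) }
  { case 2 then show ?case using Cons.IH(2) by (cases i) (auto simp: coords_def) }
qed simp_all

lemma length_concat_coords: "length (concat (map coords ps)) = 2 * length ps"
  by (induction ps) (auto simp: coords_def)

lemma encode_input_nth:
  "encode_input n ps w m z ! 0 = real n" "encode_input n ps w m z ! 1 = real m"
  "encode_input n ps w m z ! 2 = real (length w)"
  "encode_input n ps w m z ! 3 = Re z" "encode_input n ps w m z ! 4 = Im z"
  "i < length ps \<Longrightarrow> encode_input n ps w m z ! (5 + 2 * i) = Re (ps ! i)"
  "i < length ps \<Longrightarrow> encode_input n ps w m z ! (6 + 2 * i) = Im (ps ! i)"
  "i < length w \<Longrightarrow> encode_input n ps w m z ! (5 + 2 * length ps + i) = real_of_int (w ! i)"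
  "length (encode_input n ps w m z) = 5 + 2 * length ps + length w"
proof -
  have eq: "encode_input n ps w m z = [real n, real m, real (length w), Re z, Im z] @ concat (map coords ps) @ map real_of_int w"
    by (simp add: encode_input_def coords_def)
  show "encode_input n ps w m z ! 0 = real n" "encode_input n ps w m z ! 1 = real m"
    "encode_input n ps w m z ! 2 = real (length w)"
    "encode_input n ps w m z ! 3 = Re z" "encode_input n ps w m z ! 4 = Im z"
    unfolding eq by simp_all
  show "length (encode_input n ps w m z) = 5 + 2 * length ps + length w"
    unfolding eq by (simp add: length_concat_coords)
  have off: "encode_input n ps w m z ! (5 + j) = (concat (map coords ps) @ map real_of_int w) ! j" for j
    unfolding eq by (simp add: nth_append)
  show "encode_input n ps w m z ! (5 + 2 * i) = Re (ps ! i)" if "i < length ps"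
    unfolding off using that by (simp add: nth_append length_concat_coords concat_coords_nth)
  have "encode_input n ps w m z ! (5 + Suc (2 * i)) = Im (ps ! i)" if "i < length ps"
    unfolding off using that by (simp add: nth_append length_concat_coords concat_coords_nth)
  then show "encode_input n ps w m z ! (6 + 2 * i) = Im (ps ! i)" if "i < length ps"
    using that by simp
  have "encode_input n ps w m z ! (5 + (2 * length ps + i)) = real_of_int (w ! i)" if "i < length w"
    unfolding off using that by (simp add: nth_append length_concat_coords)
  then show "encode_input n ps w m z ! (5 + 2 * length ps + i) = real_of_int (w ! i)" if "i < length w"
    using that by (simp add: add.assoc)
qed

lemma valid_length: "input_at Y e x \<Longrightarrow> y \<in> Y \<Longrightarrow> length (points (x y)) = strand_count (x y)"
  unfolding input_at_def valid_inputs_def by auto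

lemma computes_input:
  assumes x: "input_at Y e x"
  shows "computes_real Y e (\<lambda>y. real (strand_count (x y)))" "computes_real Y e (\<lambda>y. real (period (x y)))"
    "computes_real Y e (\<lambda>y. real (length (letters (x y))))" "computes_complex Y e (\<lambda>y. argument (x y))"
    "computes_real Y e (\<lambda>y. real (i y)) \<Longrightarrow> (\<And>y. y \<in> Y \<Longrightarrow> i y < strand_count (x y)) \<Longrightarrow>
       computes_complex Y e (\<lambda>y. points (x y) ! i y)"
    "computes_real Y e (\<lambda>y. real (i y)) \<Longrightarrow> (\<And>y. y \<in> Y \<Longrightarrow> i y < length (letters (x y))) \<Longrightarrow>
       computes_real Y e (\<lambda>y. real_of_int (letters (x y) ! i y))"
proof -
  let ?e = "\<lambda>y. encode_input (strand_count (x y)) (points (x y)) (letters (x y)) (period (x y)) (argument (x y))"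
  have E: "computes Y e ?e" using x unfolding input_at_def by blast
  have c: "computes_real Y e (\<lambda>y. ?e y ! k)" if "k < 5" for k
    by (rule computes_nth_const[OF E]) (use that in \<open>simp add: encode_input_nth\<close>)
  show n: "computes_real Y e (\<lambda>y. real (strand_count (x y)))" and "computes_real Y e (\<lambda>y. real (period (x y)))"
    "computes_real Y e (\<lambda>y. real (length (letters (x y))))"
    using c[of 0] c[of 1] c[of 2] unfolding encode_input_nth by simp_all
  show "computes_complex Y e (\<lambda>y. argument (x y))"
    unfolding computes_complex_def using c[of 3] c[of 4] unfolding encode_input_nth by simp
  assume i: "computes_real Y e (\<lambda>y. real (i y))"
  show "computes_complex Y e (\<lambda>y. points (x y) ! i y)" if less: "\<And>y. y \<in> Y \<Longrightarrow> i y < strand_count (x y)"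
  proof -
    have li: "i y < length (points (x y))" if "y \<in> Y" for y using less that valid_length[OF x] by simp
    have "computes_real Y e (\<lambda>y. real (5 + 2 * i y))" "computes_real Y e (\<lambda>y. real (6 + 2 * i y))"
      unfolding of_nat_add of_nat_mult by (intro computes_add computes_mult computes_of_nat i)+
    from this[THEN computes_nth[OF E]]
    have c: "computes_real Y e (\<lambda>y. ?e y ! (5 + 2 * i y))" "computes_real Y e (\<lambda>y. ?e y ! (6 + 2 * i y))"
      using li by (fastforce simp: encode_input_nth(9))+
    have "computes_real Y e (\<lambda>y. Re (points (x y) ! i y))"
      by (rule computes_cong[OF c(1)]) (simp only: encode_input_nth(6)[OF li])
    moreover have "computes_real Y e (\<lambda>y. Im (points (x y) ! i y))"
      by (rule computes_cong[OF c(2)]) (simp only: encode_input_nth(7)[OF li])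
    ultimately show ?thesis unfolding computes_complex_def ..
  qed
  show "computes_real Y e (\<lambda>y. real_of_int (letters (x y) ! i y))" if less: "\<And>y. y \<in> Y \<Longrightarrow> i y < length (letters (x y))"
  proof -
    have "computes_real Y e (\<lambda>y. 5 + 2 * real (strand_count (x y)) + real (i y))"
      by (intro computes_intros n i)
    then have "computes_real Y e (\<lambda>y. real (5 + 2 * length (points (x y)) + i y))"
      by (rule computes_cong) (simp add: valid_length[OF x])
    from computes_nth[OF E this]
    have "computes_real Y e (\<lambda>y. ?e y ! (5 + 2 * length (points (x y)) + i y))"
      using less by (simp add: encode_input_nth(9))
    then show ?thesis by (rule computes_cong) (simp add: encode_input_nth(8) less)
  qed
qed

text \<open>Ranks and the point of a given rank are finite sums over the list, so that the points need not be
  sorted.\<close>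

lemma lex_rank_sum:
  assumes "distinct ps"
  shows "real (lex_rank (set ps) z) = (\<Sum>i<length ps. if lex_less (ps ! i) z then 1 else 0)"
proof -
  have "real (lex_rank (set ps) z) = (\<Sum>p\<in>set ps. if lex_less p z then 1 else 0)"
    unfolding lex_rank_def by (simp add: sum.If_cases Int_def conj_commute)
  also have "\<dots> = (\<Sum>i<length ps. if lex_less (ps ! i) z then 1 else 0)"
    by (rule sum.reindex_bij_betw[OF bij_betw_nth[OF assms refl refl], symmetric])
  finally show ?thesis .
qed

lemma computes_lex_rank:
  assumes x: "input_at Y e x" and f: "computes_complex Y e f"
  shows "computes_real Y e (\<lambda>y. real (lex_rank (set (points (x y))) (f y)))"
proof -
  have "computes_real Y e (\<lambda>y. \<Sum>i<strand_count (x y). if lex_less (points (x y) ! i) (f y) then 1 else 0)"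
  proof (rule computes_sum_loop[OF computes_input(1)[OF x]], rule computes_lex_less)
    let ?Z = "loop_set Y (\<lambda>y. strand_count (x y))"
    show "computes_complex ?Z (loop_code e) (\<lambda>v. points (x (fst v)) ! snd v)"
      by (rule computes_input(5)[OF input_at_loop[OF x] computes_loop_index]) (rule loop_setD)
    show "computes_complex ?Z (loop_code e) (\<lambda>v. f (fst v))" by (rule computes_complex_loop[OF f])
  qed
  then show ?thesis
  proof (rule computes_cong)
    fix y assume y: "y \<in> Y"
    then have "distinct (points (x y))" using x unfolding input_at_def valid_inputs_def by auto
    then show "[\<Sum>i<strand_count (x y). if lex_less (points (x y) ! i) (f y) then 1 else 0] =
        [real (lex_rank (set (points (x y))) (f y))]"
      using lex_rank_sum valid_length[OF x y] by simp
  qed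
qed

lemma sorted_point_sum:
  assumes ps: "distinct ps" and j: "j < length ps"
  shows "sorted_point (set ps) j = (\<Sum>i<length ps. if lex_rank (set ps) (ps ! i) = j then ps ! i else 0)"
proof -
  have card: "card (set ps) = length ps" using distinct_card[OF ps] .
  have mem: "sorted_point (set ps) j \<in> set ps"
    using sorted_point(1)[of "set ps"] j card unfolding bij_betw_def by auto
  have rank: "lex_rank (set ps) p = j \<longleftrightarrow> p = sorted_point (set ps) j" if "p \<in> set ps" for p
    using lex_rank_bij[of "set ps"] sorted_point(2)[of "set ps" j] j card that mem
    unfolding bij_betw_def inj_on_def by (metis finite_set)
  have "(\<Sum>i<length ps. if lex_rank (set ps) (ps ! i) = j then ps ! i else 0) =
      (\<Sum>p\<in>set ps. if lex_rank (set ps) p = j then p else 0)"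
    using sum.reindex_bij_betw[OF bij_betw_nth[OF ps refl refl], of "\<lambda>p. if lex_rank (set ps) p = j then p else 0"] by simp
  also have "\<dots> = (\<Sum>p\<in>set ps. if p = sorted_point (set ps) j then p else 0)"
    using rank by (intro sum.cong) auto
  also have "\<dots> = sorted_point (set ps) j" using mem by (simp add: sum.delta)
  finally show ?thesis ..
qed

lemma computes_sorted_point:
  assumes x: "input_at Y e x" and j: "computes_real Y e (\<lambda>y. real (j y))" "\<And>y. y \<in> Y \<Longrightarrow> j y < strand_count (x y)"
  shows "computes_complex Y e (\<lambda>y. sorted_point (set (points (x y))) (j y))"
proof -
  let ?rank = "\<lambda>y i. real (lex_rank (set (points (x y))) (points (x y) ! i))"
  let ?Z = "loop_set Y (\<lambda>y. strand_count (x y))"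
  have p: "computes_complex ?Z (loop_code e) (\<lambda>v. points (x (fst v)) ! snd v)"
    by (rule computes_input(5)[OF input_at_loop[OF x] computes_loop_index]) (rule loop_setD)
  have r: "computes_real ?Z (loop_code e) (\<lambda>v. ?rank (fst v) (snd v))"
    by (rule computes_lex_rank[OF input_at_loop[OF x] p])
  have j': "computes_real ?Z (loop_code e) (\<lambda>v. real (j (fst v)))" by (rule computes_loop[OF j(1)])
  have "computes_complex Y e (\<lambda>y. \<Sum>i<strand_count (x y).
      if ?rank y i < real (j y) then 0 else if real (j y) < ?rank y i then 0 else points (x y) ! i)"
    by (intro computes_complex_sum_loop[OF computes_input(1)[OF x]] computes_complex_if_less
          computes_complex_subset[OF p] computes_subset[OF r] computes_subset[OF j'])
       (auto simp: computes_complex_def computes_0)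
  then show ?thesis
  proof (rule computes_complex_cong)
    fix y assume y: "y \<in> Y"
    have d: "distinct (points (x y))" using x y unfolding input_at_def valid_inputs_def by auto
    have "(\<Sum>i<strand_count (x y). if ?rank y i < real (j y) then 0 else if real (j y) < ?rank y i then 0 else points (x y) ! i)
      = (\<Sum>i<length (points (x y)). if lex_rank (set (points (x y))) (points (x y) ! i) = j y then points (x y) ! i else 0)"
      unfolding valid_length[OF x y] by (intro sum.cong) auto
    also have "\<dots> = sorted_point (set (points (x y))) (j y)"
      using sorted_point_sum[OF d] j(2)[OF y] valid_length[OF x y] by simp
    finally show "(\<Sum>i<strand_count (x y). if ?rank y i < real (j y) then 0 else if real (j y) < ?rank y i then 0 else points (x y) ! i)
      = sorted_point (set (points (x y))) (j y)" .
  qed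
qed

lemma computes_chain_point:
  assumes x: "input_at Y e x" and j: "computes_real Y e (\<lambda>y. real (j y))"
    "\<And>y. y \<in> Y \<Longrightarrow> j y < period (x y) + strand_count (x y)"
  shows "computes_complex Y e (\<lambda>y. chain_point (set (points (x y))) (period (x y)) (j y))"
proof -
  let ?p = "\<lambda>y. sorted_point (set (points (x y))) 0"
  have pos: "0 < strand_count (x y)" if "y \<in> Y" for y using x that unfolding input_at_def valid_inputs_def by auto
  have 0: "computes_complex Y e ?p"
    by (rule computes_sorted_point[OF x]) (use pos computes_0 in auto)
  note m = computes_input(2)[OF x]
  have 1: "computes_complex Y e (\<lambda>y. ?p y - of_real ((real (period (x y)) - real (j y)) * ((1 - (cmod (?p y))\<^sup>2) / (2 * (real (period (x y)) + 1)))))"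
    by (intro computes_intros 0 m j)
  let ?Z = "{y \<in> Y. \<not> real (j y) < real (period (x y))}"
  have 2: "computes_complex ?Z e (\<lambda>y. sorted_point (set (points (x y))) (j y - period (x y)))"
  proof (rule computes_sorted_point[OF input_at_subset[OF x]])
    have "computes_real ?Z e (\<lambda>y. real (j y) - real (period (x y)))"
      by (intro computes_diff computes_subset[OF j(1)] computes_subset[OF m]) auto
    then show "computes_real ?Z e (\<lambda>y. real (j y - period (x y)))" by (rule computes_cong) (auto simp: of_nat_diff)
    show "j y - period (x y) < strand_count (x y)" if "y \<in> ?Z" for y using that j(2)[of y] by auto
  qed auto
  have "computes_complex Y e (\<lambda>y. if real (j y) < real (period (x y))
      then ?p y - of_real ((real (period (x y)) - real (j y)) * ((1 - (cmod (?p y))\<^sup>2) / (2 * (real (period (x y)) + 1))))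
      else sorted_point (set (points (x y))) (j y - period (x y)))"
    by (rule computes_complex_if_less[OF j(1) m computes_complex_subset[OF 1] 2]) auto
  then show ?thesis by (rule computes_complex_cong) (auto simp: chain_point_def of_nat_diff)
qed

lemma computes_clearance:
  assumes x: "input_at Y e x" and i: "computes_real Y e (\<lambda>y. real (i y))"
    "\<And>y. y \<in> Y \<Longrightarrow> 0 < i y \<and> i y < period (x y) + strand_count (x y)"
  shows "computes_complex Y e (\<lambda>y. chain_point (set (points (x y))) (period (x y)) (i y - 1))"
    and "computes_complex Y e (\<lambda>y. chain_point (set (points (x y))) (period (x y)) (i y))"
    and "computes_real Y e (\<lambda>y. clearance (period (x y) + strand_count (x y))
          (chain_point (set (points (x y))) (period (x y))) (i y))"
proof -
  let ?r = "\<lambda>y. chain_point (set (points (x y))) (period (x y))" and ?N = "\<lambda>y. period (x y) + strand_count (x y)"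
  have "computes_real Y e (\<lambda>y. real (i y) - 1)" by (intro computes_intros i)
  then have i1: "computes_real Y e (\<lambda>y. real (i y - 1))"
    by (rule computes_cong) (use i(2) in \<open>force simp: of_nat_diff\<close>)
  show a: "computes_complex Y e (\<lambda>y. ?r y (i y - 1))"
    by (rule computes_chain_point[OF x i1]) (use i(2) in force)
  show b: "computes_complex Y e (\<lambda>y. ?r y (i y))"
    by (rule computes_chain_point[OF x i(1)]) (use i(2) in force)
  let ?Z = "loop_set Y ?N"
  have c: "computes_complex ?Z (loop_code e) (\<lambda>v. ?r (fst v) (snd v))"
    by (rule computes_chain_point[OF input_at_loop[OF x] computes_loop_index]) (rule loop_setD)
  have N: "computes_real Y e (\<lambda>y. real (?N y))"
    unfolding of_nat_add by (intro computes_add computes_input[OF x])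
  show "computes_real Y e (\<lambda>y. clearance (?N y) (?r y) (i y))"
    unfolding clearance_def
    by (intro computes_divide computes_add computes_1 computes_sum_loop[OF N] computes_gap computes_diff computes_numeral
          computes_cmod_power2 c computes_complex_loop[OF a] computes_complex_loop[OF b])
qed

lemma computes_letter_twist:
  assumes x: "input_at Y e x" and k: "computes_real Y e (\<lambda>y. real_of_int (k y))"
    "\<And>y. y \<in> Y \<Longrightarrow> k y \<noteq> 0 \<and> \<bar>k y\<bar> < int (period (x y) + strand_count (x y))"
    and f: "computes_complex Y e f"
  shows "computes_complex Y e (\<lambda>y. letter_twist (period (x y) + strand_count (x y))
          (chain_point (set (points (x y))) (period (x y))) (k y) 1 (f y))"
proof -
  have "computes_real Y e (\<lambda>y. \<bar>real_of_int (k y)\<bar>)" by (intro computes_intros k)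
  then have i: "computes_real Y e (\<lambda>y. real (nat \<bar>k y\<bar>))" by (rule computes_cong) simp
  have i': "0 < nat \<bar>k y\<bar> \<and> nat \<bar>k y\<bar> < period (x y) + strand_count (x y)" if "y \<in> Y" for y
    using k(2)[OF that] by auto
  have "computes_real Y e (\<lambda>y. sgn (real_of_int (k y)) * 1)" by (intro computes_intros k)
  then have s: "computes_real Y e (\<lambda>y. real_of_int (sgn (k y)) * 1)" by (rule computes_cong) (simp add: sgn_if)
  show ?thesis unfolding letter_twist_def
    by (intro computes_twist computes_clearance[OF x i i'] f s)
qed

lemma total_word_nth:
  assumes "0 < m" "i < length (total_word m w)"
  shows "real_of_int (total_word m w ! i) =
    (if real i < 2 then real m else if real i < real m + 1 then real i - 1
     else real_of_int (w ! (i - (m + 1))) + sgn (real_of_int (w ! (i - (m + 1)))) * real m)"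
    and "length (total_word m w) = m + 1 + length w"
proof -
  have len: "length (prefix_word m) = m + 1" using assms(1) by (simp add: prefix_word_def)
  then show "length (total_word m w) = m + 1 + length w" by (simp add: total_word_def)
  then have i: "i < m + 1 + length w" using assms(2) by simp
  show "real_of_int (total_word m w ! i) =
    (if real i < 2 then real m else if real i < real m + 1 then real i - 1
     else real_of_int (w ! (i - (m + 1))) + sgn (real_of_int (w ! (i - (m + 1)))) * real m)"
  proof (cases "i < m + 1")
    case True
    then have "total_word m w ! i = prefix_word m ! i" unfolding total_word_def by (simp add: nth_append len)
    also have "\<dots> = (if i < 2 then int m else int i - 1)"
      using True by (auto simp: prefix_word_def nth_Cons' of_nat_diff)
    finally show ?thesis using True assms(1) by auto
  next
    case False
    then have "total_word m w ! i = shift_letter m (w ! (i - (m + 1)))"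
      using i unfolding total_word_def by (simp add: nth_append len)
    then show ?thesis using False assms(1) by (simp add: shift_letter_def sgn_if)
  qed
qed

lemma computes_total_word:
  assumes x: "input_at Y e x" and i: "computes_real Y e (\<lambda>y. real (i y))"
    "\<And>y. y \<in> Y \<Longrightarrow> i y < length (total_word (period (x y)) (letters (x y)))"
  shows "computes_real Y e (\<lambda>y. real_of_int (total_word (period (x y)) (letters (x y)) ! i y))"
proof -
  have m0: "0 < period (x y)" if "y \<in> Y" for y using x that unfolding input_at_def valid_inputs_def by auto
  note m = computes_input(2)[OF x]
  let ?Z = "{y \<in> {y \<in> Y. \<not> real (i y) < 2}. \<not> real (i y) < real (period (x y)) + 1}"
  have xZ: "input_at ?Z e x" by (rule input_at_subset[OF x]) auto
  have "computes_real ?Z e (\<lambda>y. real (i y) - (real (period (x y)) + 1))"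
    by (intro computes_intros computes_subset[OF i(1)] computes_subset[OF m]) auto
  then have "computes_real ?Z e (\<lambda>y. real (i y - (period (x y) + 1)))"
    by (rule computes_cong) (auto simp: of_nat_diff)
  then have l: "computes_real ?Z e (\<lambda>y. real_of_int (letters (x y) ! (i y - (period (x y) + 1))))"
  proof (rule computes_input(6)[OF xZ])
    fix y assume "y \<in> ?Z"
    then show "i y - (period (x y) + 1) < length (letters (x y))"
      using i(2)[of y] total_word_nth(2)[OF m0[of y] i(2)[of y]] by auto
  qed
  have "computes_real Y e (\<lambda>y. if real (i y) < 2 then real (period (x y))
     else if real (i y) < real (period (x y)) + 1 then real (i y) - 1
     else real_of_int (letters (x y) ! (i y - (period (x y) + 1))) +
       sgn (real_of_int (letters (x y) ! (i y - (period (x y) + 1)))) * real (period (x y)))"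
    by (rule computes_real_if_less[OF i(1) computes_numeral computes_subset[OF m]
          computes_real_if_less[OF computes_subset[OF i(1)] computes_add[OF computes_subset[OF m] computes_1]
            computes_diff[OF computes_subset[OF i(1)] computes_1]
            computes_add[OF l computes_mult[OF computes_sgn[OF l] computes_subset[OF m]]]]]) auto
  then show ?thesis
    by (rule computes_cong) (use total_word_nth(1)[OF m0 i(2)] in simp)
qed

lemma word_map_iterate:
  "word_map N r w = iterate (\<lambda>i. letter_twist N r (w ! i) 1) (length w)"
proof -
  have "word_map N r (take k w) z = iterate (\<lambda>i. letter_twist N r (w ! i) 1) k z" if "k \<le> length w" for k z
    using that
  proof (induction k)
    case (Suc k)
    then show ?case by (simp add: take_Suc_conv_app_nth word_map_append)
  qed simp
  from this[of "length w"] show ?thesis by (simp add: fun_eq_iff)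
qed

text \<open>Every step of the loop applies the twist of one letter to the current point; the chain of points
  and the clearance are computed from the input anew in each step.\<close>

lemma computes_word_map:
  assumes x: "input_at Y e x"
  shows "computes Y e (\<lambda>y. coords (word_map (period (x y) + strand_count (x y))
     (chain_point (set (points (x y))) (period (x y))) (total_word (period (x y)) (letters (x y))) (argument (x y))))"
proof -
  let ?W = "\<lambda>y. total_word (period (x y)) (letters (x y))"
  let ?B = "\<lambda>y i. letter_twist (period (x y) + strand_count (x y)) (chain_point (set (points (x y))) (period (x y))) (?W y ! i) 1"
  have valid: "0 < period (x y)" "0 < strand_count (x y)" "braid_word (strand_count (x y)) (letters (x y))" if "y \<in> Y" for y
    using x that unfolding input_at_def valid_inputs_def by auto
  have len: "length (?W y) = period (x y) + 1 + length (letters (x y))" if "y \<in> Y" for y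
    using valid(1)[OF that] by (simp add: total_word_def prefix_word_def)
  have "computes_real Y e (\<lambda>y. real (period (x y)) + 1 + real (length (letters (x y))))"
    by (intro computes_intros computes_input[OF x])
  then have N: "computes_real Y e (\<lambda>y. real (length (?W y)))" by (rule computes_cong) (simp add: len)
  have z: "computes Y e (\<lambda>y. coords (argument (x y)))"
    by (rule computes_coords[OF computes_input(4)[OF x]])
  let ?Z = "{(y, i, s :: complex). y \<in> Y \<and> i < length (?W y)}" and ?st = "\<lambda>(y, i, s). real i # coords s @ e y"
  have self: "computes ?Z ?st ?st" by (rule computes_self)
  have st: "computes_real ?Z ?st (\<lambda>v. ?st v ! 0)" "computes_real ?Z ?st (\<lambda>v. ?st v ! 1)" "computes_real ?Z ?st (\<lambda>v. ?st v ! 2)"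
    by (rule computes_nth_const[OF self]; auto simp: coords_def)+
  have i: "computes_real ?Z ?st (\<lambda>v. real (fst (snd v)))"
    by (rule computes_cong[OF st(1)]) auto
  have s: "computes_complex ?Z ?st (\<lambda>v. snd (snd v))"
    unfolding computes_complex_def
  proof
    show "computes_real ?Z ?st (\<lambda>v. Re (snd (snd v)))"
      by (rule computes_cong[OF st(2)]) (auto simp: coords_def)
    show "computes_real ?Z ?st (\<lambda>v. Im (snd (snd v)))"
      by (rule computes_cong[OF st(3)]) (auto simp: coords_def)
  qed
  have ev: "computes ?Z ?st (\<lambda>v. e (fst v))"
    by (rule computes_cong[OF computes_drop[OF self, of 3]]) (auto simp: coords_def)
  have x': "input_at ?Z ?st (\<lambda>v. x (fst v))"
    unfolding input_at_def
  proof (intro conjI computes_seq[OF ev])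
    show "(\<lambda>v. x (fst v)) ` ?Z \<subseteq> valid_inputs" using x unfolding input_at_def by auto
    show "computes ?Z (\<lambda>v. e (fst v)) (\<lambda>v. encode_input (strand_count (x (fst v))) (points (x (fst v)))
       (letters (x (fst v))) (period (x (fst v))) (argument (x (fst v))))"
      using x unfolding input_at_def
      by (intro computes_reindex[where g = fst and X = Y]) auto
  qed
  have k: "computes_real ?Z ?st (\<lambda>v. real_of_int (?W (fst v) ! fst (snd v)))"
    by (rule computes_total_word[OF x' i]) auto
  have "computes_complex ?Z ?st (\<lambda>v. ?B (fst v) (fst (snd v)) (snd (snd v)))"
  proof (rule computes_letter_twist[OF x' k _ s])
    fix v assume "v \<in> ?Z"
    then have v: "fst v \<in> Y" "fst (snd v) < length (?W (fst v))" by auto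
    then have "?W (fst v) ! fst (snd v) \<in> set (?W (fst v))" by simp
    then show "?W (fst v) ! fst (snd v) \<noteq> 0 \<and> \<bar>?W (fst v) ! fst (snd v)\<bar> < int (period (x (fst v)) + strand_count (x (fst v)))"
      using braid_word_total[OF valid(2,1,3)[OF v(1)]] unfolding braid_word_def by blast
  qed
  then have "computes ?Z ?st (\<lambda>v. coords (?B (fst v) (fst (snd v)) (snd (snd v))))"
    by (rule computes_coords)
  then have body: "computes ?Z ?st (\<lambda>(y, i, s). coords (?B y i s))" by (rule computes_cong) auto
  have "computes Y e (\<lambda>y. coords (iterate (?B y) (length (?W y)) (argument (x y))))"
    by (rule computes_iterate[OF N z _ body]) (simp add: coords_def)
  then show ?thesis unfolding word_map_iterate .
qed

theorem theorem1:
  shows "\<exists>A :: prog.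
    \<forall>(n::nat) (P :: complex set) (w :: int list) (m::nat) (ps :: complex list).
      n \<ge> 2 \<longrightarrow> P \<subseteq> interior (cball 0 1) \<longrightarrow> card P = n \<longrightarrow>
      braid_word n w \<longrightarrow> cyclic_word n w \<longrightarrow> m > 0 \<longrightarrow>
      set ps = P \<longrightarrow> distinct ps \<longrightarrow>
      (\<exists>f :: complex \<Rightarrow> complex.
         determines A n ps w m f \<and>
         (\<exists>g. homeomorphism (cball 0 1) (cball 0 1) f g) \<and>
         (\<forall>z\<in>sphere 0 1. f z = z) \<and>
         periodic_orbit (cball 0 1) f n P \<and> induces_braid f n P w \<and>
         (\<exists>Q. periodic_orbit (cball 0 1) f m Q \<and>
              Q \<subseteq> interior (cball 0 1) \<and> Q \<noteq> P \<and>
              linked (cball 0 1) f P Q))"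
proof -
  let ?e = "\<lambda>x :: input. encode_input (strand_count x) (points x) (letters x) (period x) (argument x)"
  have "input_at valid_inputs ?e (\<lambda>x. x)"
    unfolding input_at_def using computes_self by auto
  from computes_word_map[OF this] obtain A where A: "\<And>x. x \<in> valid_inputs \<Longrightarrow> runs A (?e x)
     (coords (word_map (period x + strand_count x) (chain_point (set (points x)) (period x))
        (total_word (period x) (letters x)) (argument x)))"
    unfolding computes_def by blast
  show ?thesis
  proof (intro exI[of _ A] allI impI)
    fix n P w m ps
    assume n: "n \<ge> 2" and P: "P \<subseteq> interior (cball 0 1 :: complex set)" "card P = n"
      and w: "braid_word n w" "cyclic_word n w" and m: "m > (0::nat)" and ps: "set ps = P" "distinct ps"
    let ?f = "word_map (m + n) (chain_point P m) (total_word m w)"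
    have len: "length ps = n" using distinct_card[OF ps(2)] ps(1) P(2) by simp
    have "determines A n ps w m ?f"
      unfolding determines_def
    proof
      fix z :: complex
      have "(n, ps, w, m, z) \<in> valid_inputs" unfolding valid_inputs_def using len ps(2) w(1) m n by simp
      from A[OF this] show "runs A (encode_input n ps w m z) (coords (?f z))" by (simp add: ps(1))
    qed
    with f_properties[OF n P w m] show "\<exists>f. determines A n ps w m f \<and>
         (\<exists>g. homeomorphism (cball 0 1) (cball 0 1) f g) \<and>
         (\<forall>z\<in>sphere 0 1. f z = z) \<and>
         periodic_orbit (cball 0 1) f n P \<and> induces_braid f n P w \<and>
         (\<exists>Q. periodic_orbit (cball 0 1) f m Q \<and>
              Q \<subseteq> interior (cball 0 1) \<and> Q \<noteq> P \<and>
              linked (cball 0 1) f P Q)"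
      by - (rule exI[of _ ?f], intro conjI)
  qed
qed

end
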